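(* Let $L$ be a set, let $m\in\mathbb{Z}^+$, and let $\Phi:\mathrm{Skew}[L|\underline{m}]\to\mathrm{Skew}[L]^{\otimes m}$ be the $\mathbb{Z}$-algebra isomorphism with $\Phi((x|i))=1\otimes\cdots\otimes1\otimes x\otimes1\otimes\cdots\otimes1$ ($x$ in the $i$-th factor) for $x\in L$ and $i\in\{1,\dots,m\}$. Then the geometric products on $\mathrm{Skew}[L]^{\otimes m}$ correspond, via $\Phi$, to the divided powers of place polarizations on $\mathrm{Skew}[L|\underline{m}]$: for all $i,j\in\{1,\dots,m\}$ with $i\ne j$ and all $h\in\mathbb{Z}^+$, $$\diamond_{ji}^{(h)}=\Phi\circ D_{ji}^{(h)}\circ\Phi^{-1}.$$
   Context: For a set $X$, $\mathrm{Skew}[X]$ denotes the free associative skew-symmetric unital $\mathbb{Z}$-algebra generated by $X$, i.e. the exterior algebra of the free $\mathbb{Z}$-module on $X$ (so $xy=-yx$ and $xx=0$ for $x,y\in X$). $\mathrm{Skew}[L]^{\otimes m}$ is the $m$-th tensor power over $\mathbb{Z}$ in the category of $\mathbb{Z}_2$-graded algebras (e.g. for $m=2$, $(A_1\otimes A_2)(B_1\otimes B_2)=(-1)^{a_2b_1}A_1B_1\otimes A_2B_2$ for homogeneous elements of degrees $a_i,b_i$). Letterplace algebra: $\underline{m}=\{1,\dots,m\}$ and $\mathrm{Skew}[L|\underline{m}]$ is the free associative skew-symmetric unital $\mathbb{Z}$-algebra generated by the set of symbols $(x|i)$, $x\in L$, $i\in\underline{m}$, i.e. the exterior algebra of the free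 $\mathbb{Z}$-module on this set of symbols. For $i,j\in\underline{m}$, the place polarization $D_{ji}$ from $i$ to $j$ is the unique (ordinary, unsigned) derivation of $\mathrm{Skew}[L|\underline{m}]$ with $D_{ji}(x|k)=\delta_{ik}(x|j)$ for all $x\in L$, $k\in\underline{m}$. For $i\ne j$ and $h\in\mathbb{Z}^+$, its $h$-th divided power $D_{ji}^{(h)}=D_{ji}^{\,h}/h!$ is well defined as an operator on $\mathrm{Skew}[L|\underline{m}]$. Coproduct slices: for a word $w=x_1\cdots x_a$ on $L$ and $r+s=a$, $r,s\geq 0$, $\sum_{(w)_{(r,s)}}w_{(1)}\otimes w_{(2)}=\sum_I\operatorname{sgn}(I,J)\,x_I\otimes x_J$, where $I$ runs over the $r$-subsets of $\{1,\dots,a\}$, $J$ is its complement, $x_I,x_J$ are the products in increasing order of index, and $\operatorname{sgn}(I,J)$ is the sign of the permutation listing $I$ increasingly then $J$ increasingly; the slice is $0$ if $r<0$ or $s<0$. Geometric products on $\mathrm{Skew}[L]^{\otimes m}$: let $A_1,\dots,A_m$ be monomials of degrees $a_1,\dots,a_m$ and let $i<j$. Then $$\diamond^{(h)}_{ji}(A_1\otimes\cdots\otimes A_m)=(-1)^{h(a_{i+1}+\cdots+a_{j-1})}\sum_{(A_i)_{(a_i-h,h)}}A_1\otimes\cdots\otimes (A_i)_{(1)}\otimes\cdots\otimes(A_i)_{(2)}A_j\otimes\cdots\otimes A_m,$$ $$\diamond^{(h)}_{ij}(A_1\otimes\cdots\otimes A_m)=(-1)^{h(a_{i+1}+\cdots+a_{j-1})}\sum_{(A_j)_{(h,a_j-h)}}A_1\otimes\cdots\otimes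 A_i(A_j)_{(1)}\otimes\cdots\otimes(A_j)_{(2)}\otimes\cdots\otimes A_m,$$ where the displayed modified factors are in positions $i$ and $j$; these are extended $\mathbb{Z}$-linearly. *)

theory Defs
  imports "HOL-Algebra.Algebra" "HOL-Combinatorics.Permutations"
begin

section \<open>Free associative and free skew-symmetric algebras over the integers\<close>

text \<open>Elements of the free algebra on \<open>S\<close> are formal integer combinations of words on \<open>S\<close>;
  multiplication is the bilinear extension of concatenation.\<close>

definition free_algebra :: "'a set \<Rightarrow> ('a list \<Rightarrow>\<^sub>0 int) ring" where
  "free_algebra S =
     \<lparr>carrier = {f. Poly_Mapping.keys f \<subseteq> lists S},
      monoid.mult = (\<lambda>f g. frag_extend (\<lambda>v. frag_extend (\<lambda>w. frag_of (v @ w)) g) f),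
      one = frag_of [], ring.zero = 0, add = (+)\<rparr>"

definition skew_ideal :: "'a set \<Rightarrow> ('a list \<Rightarrow>\<^sub>0 int) set" where
  "skew_ideal S =
     Idl\<^bsub>free_algebra S\<^esub>
       ({frag_of [x, y] + frag_of [y, x] | x y. x \<in> S \<and> y \<in> S} \<union> {frag_of [x, x] | x. x \<in> S})"

definition skew :: "'a set \<Rightarrow> ('a list \<Rightarrow>\<^sub>0 int) set ring" where
  "skew S = free_algebra S Quot skew_ideal S"

definition skew_class :: "'a set \<Rightarrow> ('a list \<Rightarrow>\<^sub>0 int) \<Rightarrow> ('a list \<Rightarrow>\<^sub>0 int) set" where
  "skew_class S f = skew_ideal S +>\<^bsub>free_algebra S\<^esub> f"

text \<open>The monomial of \<open>skew S\<close> spelled by a word on \<open>S\<close>.\<close>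

definition monomial :: "'a set \<Rightarrow> 'a list \<Rightarrow> ('a list \<Rightarrow>\<^sub>0 int) set" where
  "monomial S w = skew_class S (frag_of w)"

definition skew_homogeneous :: "'a set \<Rightarrow> nat \<Rightarrow> ('a list \<Rightarrow>\<^sub>0 int) set set" where
  "skew_homogeneous S d =
     skew_class S ` {f \<in> carrier (free_algebra S). \<forall>w \<in> Poly_Mapping.keys f. length w = d}"


section \<open>Graded tensor powers\<close>

text \<open>Tensor powers over the integers of the additive group of a ring: the free abelian group on
  \<open>m\<close>-tuples modulo additivity in each position (which over the integers is multilinearity).\<close>

definition tuples :: "('r, 'n) ring_scheme \<Rightarrow> nat \<Rightarrow> (nat \<Rightarrow> 'r) set" where
  "tuples R m = (\<Pi>\<^sub>E k \<in> {1..m}. carrier R)"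

definition tensor_relations :: "('r, 'n) ring_scheme \<Rightarrow> nat \<Rightarrow> ((nat \<Rightarrow> 'r) \<Rightarrow>\<^sub>0 int) set" where
  "tensor_relations R m =
     generate (free_Abelian_group (tuples R m))
       {frag_of (A(k := x \<oplus>\<^bsub>R\<^esub> y)) - frag_of (A(k := x)) - frag_of (A(k := y)) | A k x y.
          A \<in> tuples R m \<and> k \<in> {1..m} \<and> x \<in> carrier R \<and> y \<in> carrier R}"

definition tensor_group :: "('r, 'n) ring_scheme \<Rightarrow> nat \<Rightarrow> ((nat \<Rightarrow> 'r) \<Rightarrow>\<^sub>0 int) set monoid" where
  "tensor_group R m = free_Abelian_group (tuples R m) Mod tensor_relations R m"

definition tensor ::
  "('r, 'n) ring_scheme \<Rightarrow> nat \<Rightarrow> (nat \<Rightarrow> 'r) \<Rightarrow> ((nat \<Rightarrow> 'r) \<Rightarrow>\<^sub>0 int) set" where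
  "tensor R m A = tensor_relations R m #>\<^bsub>free_Abelian_group (tuples R m)\<^esub> frag_of A"

text \<open>\<open>H d\<close> is the set of homogeneous elements of degree \<open>d\<close> of \<open>R\<close>. The group
  \<open>tensor_group R m\<close> is written multiplicatively, so a sign acts on it as an exponent. In the
  product \<open>(A\<^sub>1 \<otimes> \<dots> \<otimes> A\<^sub>m) (B\<^sub>1 \<otimes> \<dots> \<otimes> B\<^sub>m)\<close> the factor \<open>B\<^sub>l\<close> moves past \<open>A\<^sub>k\<close> for all \<open>k > l\<close>.\<close>

definition graded_tensor_mult ::
  "('r, 'n) ring_scheme \<Rightarrow> (nat \<Rightarrow> 'r set) \<Rightarrow> nat
     \<Rightarrow> ((nat \<Rightarrow> 'r) \<Rightarrow>\<^sub>0 int) set \<times> ((nat \<Rightarrow> 'r) \<Rightarrow>\<^sub>0 int) set \<Rightarrow> ((nat \<Rightarrow> 'r) \<Rightarrow>\<^sub>0 int) set" where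
  "graded_tensor_mult R H m =
     (let G = tensor_group R m in
      THE M. M \<in> (carrier G \<times> carrier G \<rightarrow>\<^sub>E carrier G)
        \<and> (\<forall>u \<in> carrier G. (\<lambda>v. M (u, v)) \<in> hom G G)
        \<and> (\<forall>v \<in> carrier G. (\<lambda>u. M (u, v)) \<in> hom G G)
        \<and> (\<forall>A \<in> tuples R m. \<forall>B \<in> tuples R m. \<forall>a b.
             (\<forall>k \<in> {1..m}. A k \<in> H (a k) \<and> B k \<in> H (b k)) \<longrightarrow>
             M (tensor R m A, tensor R m B) =
               tensor R m (\<lambda>k \<in> {1..m}. A k \<otimes>\<^bsub>R\<^esub> B k)
                 [^]\<^bsub>G\<^esub> ((-1 :: int) ^ (\<Sum>k \<in> {1..m}. \<Sum>l \<in> {1..<k}. a k * b l))))"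

definition graded_tensor_power ::
  "('r, 'n) ring_scheme \<Rightarrow> (nat \<Rightarrow> 'r set) \<Rightarrow> nat \<Rightarrow> ((nat \<Rightarrow> 'r) \<Rightarrow>\<^sub>0 int) set ring" where
  "graded_tensor_power R H m =
     \<lparr>carrier = carrier (tensor_group R m),
      monoid.mult = (\<lambda>u v. graded_tensor_mult R H m (u, v)),
      one = tensor R m (\<lambda>k \<in> {1..m}. \<one>\<^bsub>R\<^esub>),
      ring.zero = \<one>\<^bsub>tensor_group R m\<^esub>,
      add = monoid.mult (tensor_group R m)\<rparr>"

definition skew_tensor ::
  "'a set \<Rightarrow> nat \<Rightarrow> ((nat \<Rightarrow> ('a list \<Rightarrow>\<^sub>0 int) set) \<Rightarrow>\<^sub>0 int) set ring" where
  "skew_tensor L m = graded_tensor_power (skew L) (skew_homogeneous L) m"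

text \<open>\<open>A\<^sub>1 \<otimes> \<dots> \<otimes> A\<^sub>m\<close> for the monomials \<open>A\<^sub>k\<close> spelled by the words \<open>W k\<close>.\<close>

definition monomial_tensor ::
  "'a set \<Rightarrow> nat \<Rightarrow> (nat \<Rightarrow> 'a list) \<Rightarrow> ((nat \<Rightarrow> ('a list \<Rightarrow>\<^sub>0 int) set) \<Rightarrow>\<^sub>0 int) set" where
  "monomial_tensor L m W = tensor (skew L) m (\<lambda>k \<in> {1..m}. monomial L (W k))"


section \<open>Letterplace algebra and place polarizations\<close>

definition letterplace :: "'a set \<Rightarrow> nat \<Rightarrow> (('a \<times> nat) list \<Rightarrow>\<^sub>0 int) set ring" where
  "letterplace L m = skew (L \<times> {1..m})"

text \<open>The symbol \<open>(x|k)\<close>.\<close>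

definition letter :: "'a set \<Rightarrow> nat \<Rightarrow> 'a \<Rightarrow> nat \<Rightarrow> (('a \<times> nat) list \<Rightarrow>\<^sub>0 int) set" where
  "letter L m x k = monomial (L \<times> {1..m}) [(x, k)]"

definition derivation :: "('r, 'n) ring_scheme \<Rightarrow> ('r \<Rightarrow> 'r) \<Rightarrow> bool" where
  "derivation R D \<longleftrightarrow>
     D \<in> carrier R \<rightarrow> carrier R
     \<and> (\<forall>u \<in> carrier R. \<forall>v \<in> carrier R. D (u \<oplus>\<^bsub>R\<^esub> v) = D u \<oplus>\<^bsub>R\<^esub> D v)
     \<and> (\<forall>u \<in> carrier R. \<forall>v \<in> carrier R. D (u \<otimes>\<^bsub>R\<^esub> v) = D u \<otimes>\<^bsub>R\<^esub> v \<oplus>\<^bsub>R\<^esub> u \<otimes>\<^bsub>R\<^esub> D v)"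

text \<open>\<open>place_polarization L m j i\<close> is \<open>D\<^sub>j\<^sub>i\<close>, the polarization from place \<open>i\<close> to place \<open>j\<close>.\<close>

definition place_polarization ::
  "'a set \<Rightarrow> nat \<Rightarrow> nat \<Rightarrow> nat
     \<Rightarrow> (('a \<times> nat) list \<Rightarrow>\<^sub>0 int) set \<Rightarrow> (('a \<times> nat) list \<Rightarrow>\<^sub>0 int) set" where
  "place_polarization L m j i =
     (THE D. D \<in> extensional (carrier (letterplace L m)) \<and> derivation (letterplace L m) D
        \<and> (\<forall>x \<in> L. \<forall>k \<in> {1..m}.
             D (letter L m x k) = (if i = k then letter L m x j else \<zero>\<^bsub>letterplace L m\<^esub>)))"

definition divided_power ::
  "('r, 'n) ring_scheme \<Rightarrow> ('r \<Rightarrow> 'r) \<Rightarrow> nat \<Rightarrow> 'r \<Rightarrow> 'r" where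
  "divided_power R D h u =
     (THE v. v \<in> carrier R \<and> [(fact h :: nat)] \<cdot>\<^bsub>R\<^esub> v = (D ^^ h) u)"


section \<open>Geometric products\<close>

text \<open>Positions in a word are numbered from 0. \<open>slice w r s\<close> collects the index sets \<open>I\<close> of the
  summands of the coproduct slice \<open>(w)\<^sub>(\<^sub>r\<^sub>,\<^sub>s\<^sub>)\<close>; the complement \<open>J\<close> is \<open>{..<length w} - I\<close>. The parameters
  are integers, so the slice is empty when one of them is negative.\<close>

definition slice :: "'a list \<Rightarrow> int \<Rightarrow> int \<Rightarrow> nat set set" where
  "slice w r s =
     {I. I \<subseteq> {..<length w} \<and> int (card I) = r \<and> int (card ({..<length w} - I)) = s}"

definition fst_part :: "'a list \<Rightarrow> nat set \<Rightarrow> 'a list" where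
  "fst_part w I = nths w I"

definition snd_part :: "'a list \<Rightarrow> nat set \<Rightarrow> 'a list" where
  "snd_part w I = nths w ({..<length w} - I)"

definition slice_sign :: "'a list \<Rightarrow> nat set \<Rightarrow> int" where
  "slice_sign w I =
     sign (\<lambda>k. if k < length w
               then (sorted_list_of_set I @ sorted_list_of_set ({..<length w} - I)) ! k
               else k)"

text \<open>\<open>geometric_value L m h t s W\<close> is the value of the geometric product with target position \<open>t\<close>
  and source position \<open>s\<close> on the tensor of the monomials spelled by \<open>W\<close>. The case \<open>s < t\<close> is the
  formula for \<open>\<diamond>\<^sub>j\<^sub>i\<close> with \<open>i < j\<close> (take \<open>t = j\<close>, \<open>s = i\<close>), the case \<open>t < s\<close> is the formula for
  \<open>\<diamond>\<^sub>i\<^sub>j\<close> with \<open>i < j\<close> (take \<open>t = i\<close>, \<open>s = j\<close>).\<close>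

definition geometric_value ::
  "'a set \<Rightarrow> nat \<Rightarrow> nat \<Rightarrow> nat \<Rightarrow> nat \<Rightarrow> (nat \<Rightarrow> 'a list)
     \<Rightarrow> ((nat \<Rightarrow> ('a list \<Rightarrow>\<^sub>0 int) set) \<Rightarrow>\<^sub>0 int) set" where
  "geometric_value L m h t s W =
     (let T = skew_tensor L m; a = (\<lambda>k. length (W k)) in
      [((-1 :: int) ^ (h * (\<Sum>k \<in> {min s t<..<max s t}. a k)))] \<cdot>\<^bsub>T\<^esub>
      (if s < t then
         (\<Oplus>\<^bsub>T\<^esub> I \<in> slice (W s) (int (a s) - int h) (int h).
            [slice_sign (W s) I] \<cdot>\<^bsub>T\<^esub>
            monomial_tensor L m (W(s := fst_part (W s) I, t := snd_part (W s) I @ W t)))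
       else
         (\<Oplus>\<^bsub>T\<^esub> I \<in> slice (W s) (int h) (int (a s) - int h).
            [slice_sign (W s) I] \<cdot>\<^bsub>T\<^esub>
            monomial_tensor L m (W(t := W t @ fst_part (W s) I, s := snd_part (W s) I)))))"

text \<open>\<open>geometric_product L m h t s\<close> is \<open>\<diamond>\<^sub>t\<^sub>s\<close> with divided power index \<open>h\<close>.\<close>

definition geometric_product ::
  "'a set \<Rightarrow> nat \<Rightarrow> nat \<Rightarrow> nat \<Rightarrow> nat
     \<Rightarrow> ((nat \<Rightarrow> ('a list \<Rightarrow>\<^sub>0 int) set) \<Rightarrow>\<^sub>0 int) set
     \<Rightarrow> ((nat \<Rightarrow> ('a list \<Rightarrow>\<^sub>0 int) set) \<Rightarrow>\<^sub>0 int) set" where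
  "geometric_product L m h t s =
     (let T = skew_tensor L m in
      THE G. G \<in> (carrier T \<rightarrow>\<^sub>E carrier T)
        \<and> (\<forall>u \<in> carrier T. \<forall>v \<in> carrier T. G (u \<oplus>\<^bsub>T\<^esub> v) = G u \<oplus>\<^bsub>T\<^esub> G v)
        \<and> (\<forall>W. (\<forall>k \<in> {1..m}. W k \<in> lists L) \<longrightarrow>
             G (monomial_tensor L m W) = geometric_value L m h t s W))"

end

theory Submission
  imports Defs
begin

text \<open>Let \<open>D\<close> be the polarization from place \<open>s\<close> to place \<open>t\<close>. Its divided power \<open>D\<^sup>(\<^sup>h\<^sup>)\<close> sends a word
  of letterplace symbols to the sum, over all ways to choose \<open>h\<close> of its letters at place \<open>s\<close>, of
  the words in which the chosen letters are moved to place \<open>t\<close>; no signs occur, because \<open>D\<close> is an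
  ordinary derivation. On the other side, \<open>\<Phi>\<close> sends a word to the tensor of the subwords of its
  letters at places \<open>1, \<dots>, m\<close>, with one factor \<open>-1\<close> for every pair of letters whose places are out of
  order, since sorting the word by places exchanges exactly these pairs.

  Take the word \<open>W\<^sub>1 \<dots> W\<^sub>m\<close> sorted by places, which \<open>\<Phi>\<close> sends to \<open>W\<^sub>1 \<otimes> \<dots> \<otimes> W\<^sub>m\<close>, and move
  \<open>h\<close> letters of \<open>W\<^sub>s\<close> to place \<open>t\<close>. Each of them is now out of order with all letters at the places
  strictly between \<open>s\<close> and \<open>t\<close>; this is the sign in front of the geometric product. The remaining
  pairs out of order lie inside the block \<open>W\<^sub>s\<close> and correspond to the inversions of the permutation that
  defines the sign of the coproduct slice (\<open>inversions_moved\<close>, \<open>slice_sign_inversions\<close>). The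
  subwords at \<open>s\<close> and \<open>t\<close> are the two factors that the slice produces. So the conjugate of
  \<open>D\<^sup>(\<^sup>h\<^sup>)\<close> by \<open>\<Phi>\<close> takes the values of the geometric product on tensors of monomials
  (\<open>geometric_value_subsets\<close>); as these span the tensor power, the two operators agree. In
  particular the geometric product is well defined.

  Several objects are specified by their properties, and these specifications have to be met.
  The formula for \<open>D\<^sup>(\<^sup>h\<^sup>)\<close> on words is turned into operators that respect skew-symmetry and
  satisfy \<open>D\<^sup>h = h! D\<^sup>(\<^sup>h\<^sup>)\<close>; that this determines \<open>D\<^sup>(\<^sup>h\<^sup>)\<close> follows from the absence of torsion in
  an exterior algebra (\<open>skew_torsion_free\<close>). The product of the graded tensor power is obtained from
  that of the letterplace algebra, through the separation of a word into its subwords at the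
  places and the converse concatenation (\<open>graded_bimult_exists\<close>). Once it is known to be
  bilinear, \<open>\<Phi>\<close> can be computed on words, one letter after the other (\<open>iso_on_words\<close>).\<close>

section \<open>Homomorphisms of groups\<close>

lemma group_homI: "group G \<Longrightarrow> group H \<Longrightarrow> h \<in> hom G H \<Longrightarrow> group_hom G H h"
  by (simp add: group_hom_def group_hom_axioms_def)

lemma hom_eq_on_generate:
  assumes "group G" "group H" "f \<in> hom G H" "g \<in> hom G H" "B \<subseteq> carrier G"
    and "\<And>b. b \<in> B \<Longrightarrow> f b = g b" and "x \<in> generate G B"
  shows "f x = g x"
proof -
  interpret G: group G by fact
  interpret f: group_hom G H f using assms by (simp add: group_hom_def group_hom_axioms_def)
  interpret g: group_hom G H g using assms by (simp add: group_hom_def group_hom_axioms_def)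
  show ?thesis
    using assms(7)
  proof induction
    case (inv b) then show ?case using assms(5,6) by (metis f.hom_inv g.hom_inv subsetD)
  next
    case (eng b c) then show ?case
      using G.generate_in_carrier[OF assms(5)] by simp
  qed (use assms in auto)
qed

section \<open>The free skew-symmetric algebra\<close>

lemma frag_cmul_diff_distrib2: "frag_cmul c (a - b) = frag_cmul c a - frag_cmul c b"
  by (rule poly_mapping_eqI) (simp add: lookup_minus algebra_simps)

lemma frag_extend_fun_diff: "frag_extend (\<lambda>v. F v - G v) f = frag_extend F f - frag_extend G f"
  by (simp add: frag_extend_def sum_subtractf frag_cmul_diff_distrib2)

lemma frag_extend_fun_add: "frag_extend (\<lambda>v. F v + G v) f = frag_extend F f + frag_extend G f"
  by (simp add: frag_extend_def sum.distrib frag_cmul_distrib2)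

lemma frag_extend_fun_zero: "frag_extend (\<lambda>v. 0) f = 0"
  by (simp add: frag_extend_def)

text \<open>The product of the free algebras, which does not depend on the set of letters.\<close>

definition concat_mult :: "('a list \<Rightarrow>\<^sub>0 int) \<Rightarrow> ('a list \<Rightarrow>\<^sub>0 int) \<Rightarrow> ('a list \<Rightarrow>\<^sub>0 int)" where
  "concat_mult f g = frag_extend (\<lambda>v. frag_extend (\<lambda>w. frag_of (v @ w)) g) f"

lemma concat_mult_bilinear:
  "concat_mult (f - f') g = concat_mult f g - concat_mult f' g"
  "concat_mult f (g - g') = concat_mult f g - concat_mult f g'"
  "concat_mult (f + f') g = concat_mult f g + concat_mult f' g"
  "concat_mult f (g + g') = concat_mult f g + concat_mult f g'"
  "concat_mult 0 g = 0" "concat_mult f 0 = 0"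
  by (simp_all add: concat_mult_def frag_extend_diff frag_extend_add frag_extend_fun_diff
      frag_extend_fun_add frag_extend_fun_zero)

lemma concat_mult_of: "concat_mult (frag_of v) (frag_of w) = frag_of (v @ w)"
  by (simp add: concat_mult_def)

lemma keys_concat_mult:
  "Poly_Mapping.keys f \<subseteq> lists S \<Longrightarrow> Poly_Mapping.keys g \<subseteq> lists S \<Longrightarrow>
   Poly_Mapping.keys (concat_mult f g) \<subseteq> lists S"
  unfolding concat_mult_def
  by (rule order_trans[OF keys_frag_extend], rule UN_least,
      rule order_trans[OF keys_frag_extend], rule UN_least) (auto simp: keys_frag_of)

lemma concat_mult_assoc: "concat_mult (concat_mult f g) h = concat_mult f (concat_mult g h)"
proof -
  have *: "concat_mult (concat_mult (frag_of u) (frag_of v)) h =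
           concat_mult (frag_of u) (concat_mult (frag_of v) h)" for u v
    using subset_UNIV[of "Poly_Mapping.keys h"]
    by (induction h rule: frag_induction) (simp_all add: concat_mult_bilinear concat_mult_of)
  have **: "concat_mult (concat_mult (frag_of u) g) h = concat_mult (frag_of u) (concat_mult g h)" for u
    using subset_UNIV[of "Poly_Mapping.keys g"]
    by (induction g rule: frag_induction) (simp_all add: concat_mult_bilinear *)
  show ?thesis
    using subset_UNIV[of "Poly_Mapping.keys f"]
    by (induction f rule: frag_induction) (simp_all add: concat_mult_bilinear **)
qed

lemma concat_mult_one: "concat_mult (frag_of []) f = f" "concat_mult f (frag_of []) = f"
  by (simp_all add: concat_mult_def frag_expansion[symmetric])

lemma free_algebra_simps:
  "carrier (free_algebra S) = {f. Poly_Mapping.keys f \<subseteq> lists S}"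
  "f \<otimes>\<^bsub>free_algebra S\<^esub> g = concat_mult f g"
  "\<one>\<^bsub>free_algebra S\<^esub> = frag_of []"
  "\<zero>\<^bsub>free_algebra S\<^esub> = 0"
  "f \<oplus>\<^bsub>free_algebra S\<^esub> g = f + g"
  by (simp_all add: free_algebra_def concat_mult_def)

lemma add_monoid_free_algebra: "add_monoid (free_algebra S) = free_Abelian_group (lists S)"
  by (simp add: free_algebra_def free_Abelian_group_def)

lemma ring_free_algebra: "ring (free_algebra S)"
proof (rule ringI)
  show "abelian_group (free_algebra S)"
    by (rule comm_group_abelian_groupI, unfold add_monoid_free_algebra)
       (rule abelian_free_Abelian_group)
  show "Group.monoid (free_algebra S)"
    by (rule monoidI)
       (simp_all add: free_algebra_simps concat_mult_assoc concat_mult_one keys_frag_of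
          keys_concat_mult)
qed (simp_all add: free_algebra_simps concat_mult_bilinear)

definition skew_relators :: "'a set \<Rightarrow> ('a list \<Rightarrow>\<^sub>0 int) set" where
  "skew_relators S =
     {frag_of [x, y] + frag_of [y, x] | x y. x \<in> S \<and> y \<in> S} \<union> {frag_of [x, x] | x. x \<in> S}"

lemma skew_relators_carrier: "skew_relators S \<subseteq> carrier (free_algebra S)"
  by (auto simp: skew_relators_def free_algebra_simps keys_frag_of dest!: subsetD[OF keys_add])

lemma skew_ideal_alt: "skew_ideal S = Idl\<^bsub>free_algebra S\<^esub> (skew_relators S)"
  by (simp add: skew_ideal_def skew_relators_def)

lemma ideal_skew_ideal: "ideal (skew_ideal S) (free_algebra S)"
  unfolding skew_ideal_alt
  by (rule ring.genideal_ideal[OF ring_free_algebra skew_relators_carrier])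

lemma ring_skew: "ring (skew S)"
  unfolding skew_def by (rule ideal.quotient_is_ring[OF ideal_skew_ideal])

lemma skew_class_hom: "ring_hom_ring (free_algebra S) (skew S) (skew_class S)"
  using ideal.rcos_ring_hom_ring[OF ideal_skew_ideal] unfolding skew_def skew_class_def .

lemma add_monoid_skew:
  "add_monoid (skew S) = free_Abelian_group (lists S) Mod skew_ideal S"
  by (simp add: skew_def FactRing_def FactGroup_def A_RCOSETS_def set_add_def
      flip: add_monoid_free_algebra)

lemma skew_class_r_coset: "skew_class S f = skew_ideal S #>\<^bsub>free_Abelian_group (lists S)\<^esub> f"
  by (simp add: skew_class_def a_r_coset_def flip: add_monoid_free_algebra)

lemma carrier_skew: "carrier (skew S) = skew_class S ` carrier (free_algebra S)"
proof -
  have "carrier (add_monoid (skew S)) = skew_class S ` carrier (add_monoid (free_algebra S))"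
    unfolding add_monoid_skew skew_class_r_coset add_monoid_free_algebra
    by (simp add: carrier_FactGroup)
  then show ?thesis by simp
qed

lemma monomial_closed [simp, intro]: "w \<in> lists S \<Longrightarrow> monomial S w \<in> carrier (skew S)"
  by (auto simp: monomial_def carrier_skew free_algebra_simps keys_frag_of)

lemma monomial_Nil: "monomial S [] = \<one>\<^bsub>skew S\<^esub>"
proof -
  interpret ring_hom_ring "free_algebra S" "skew S" "skew_class S" by (rule skew_class_hom)
  show ?thesis using hom_one by (simp add: monomial_def free_algebra_simps)
qed

lemma monomial_append:
  assumes "v \<in> lists S" "w \<in> lists S"
  shows "monomial S (v @ w) = monomial S v \<otimes>\<^bsub>skew S\<^esub> monomial S w"
proof -
  interpret ring_hom_ring "free_algebra S" "skew S" "skew_class S" by (rule skew_class_hom)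
  show ?thesis using assms hom_mult[of "frag_of v" "frag_of w"]
    by (simp add: monomial_def free_algebra_simps concat_mult_of keys_frag_of)
qed

lemma skew_class_relator:
  assumes "f \<in> skew_ideal S" shows "skew_class S f = \<zero>\<^bsub>skew S\<^esub>"
proof -
  interpret I: ideal "skew_ideal S" "free_algebra S" by (rule ideal_skew_ideal)
  show ?thesis using assms I.a_rcos_const by (simp add: skew_def FactRing_def skew_class_def)
qed

lemma monomial_swap2:
  assumes "x \<in> S" "y \<in> S"
  shows "monomial S [x, y] \<oplus>\<^bsub>skew S\<^esub> monomial S [y, x] = \<zero>\<^bsub>skew S\<^esub>"
proof -
  interpret ring_hom_ring "free_algebra S" "skew S" "skew_class S" by (rule skew_class_hom)
  have "frag_of [x, y] + frag_of [y, x] \<in> skew_ideal S"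
    unfolding skew_ideal_alt using assms
    by (intro subsetD[OF R.genideal_self[OF skew_relators_carrier]]) (auto simp: skew_relators_def)
  from skew_class_relator[OF this] show ?thesis
    using assms hom_add[of "frag_of [x, y]" "frag_of [y, x]"]
    by (simp add: monomial_def free_algebra_simps keys_frag_of)
qed

lemma monomial_square:
  assumes "x \<in> S" shows "monomial S [x, x] = \<zero>\<^bsub>skew S\<^esub>"
proof -
  interpret ring "free_algebra S" by (rule ring_free_algebra)
  have "frag_of [x, x] \<in> skew_ideal S"
    unfolding skew_ideal_alt using assms
    by (intro subsetD[OF genideal_self[OF skew_relators_carrier]]) (auto simp: skew_relators_def)
  from skew_class_relator[OF this] show ?thesis by (simp add: monomial_def)
qed

text \<open>The set \<open>Z\<close> of admissible words is a parameter: all words give the whole algebra, the words of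
  one length give a homogeneous component.\<close>

lemma skew_class_induct [consumes 2, case_names zero monomial diff]:
  assumes "Poly_Mapping.keys f \<subseteq> Z" and Z: "Z \<subseteq> lists S"
    and "P \<zero>\<^bsub>skew S\<^esub>" and "\<And>w. w \<in> Z \<Longrightarrow> P (monomial S w)"
    and "\<And>x y. x \<in> carrier (skew S) \<Longrightarrow> y \<in> carrier (skew S) \<Longrightarrow> P x \<Longrightarrow> P y \<Longrightarrow> P (x \<ominus>\<^bsub>skew S\<^esub> y)"
  shows "P (skew_class S f)"
  using assms(1)
proof (induction f rule: free_Abelian_group_induct[consumes 1, case_names zero diff of])
  interpret ring_hom_ring "free_algebra S" "skew S" "skew_class S" by (rule skew_class_hom)
  case zero then show ?case using assms(3) hom_zero by (simp add: free_algebra_simps)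
next
  interpret ring_hom_ring "free_algebra S" "skew S" "skew_class S" by (rule skew_class_hom)
  case (diff f g)
  have c: "f \<in> carrier (free_algebra S)" "g \<in> carrier (free_algebra S)"
    using diff(1,2) Z unfolding free_algebra_simps by blast+
  have "\<ominus>\<^bsub>free_algebra S\<^esub> g = - g"
    using c unfolding a_inv_def add_monoid_free_algebra by (simp add: free_algebra_simps)
  then have "f - g = f \<ominus>\<^bsub>free_algebra S\<^esub> g"
    by (simp add: a_minus_def free_algebra_simps)
  then have "skew_class S (f - g) = skew_class S f \<ominus>\<^bsub>skew S\<^esub> skew_class S g"
    using c by (simp add: R.minus_eq S.minus_eq)
  then show ?case using diff c assms(5) by simp
next
  case (of w) then show ?case using assms(4) by (simp add: monomial_def)
qed

lemma skew_induct [consumes 1, case_names zero monomial diff]: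
  assumes "u \<in> carrier (skew S)"
    and "P \<zero>\<^bsub>skew S\<^esub>" and "\<And>w. w \<in> lists S \<Longrightarrow> P (monomial S w)"
    and "\<And>x y. x \<in> carrier (skew S) \<Longrightarrow> y \<in> carrier (skew S) \<Longrightarrow> P x \<Longrightarrow> P y \<Longrightarrow> P (x \<ominus>\<^bsub>skew S\<^esub> y)"
  shows "P u"
proof -
  obtain f where "Poly_Mapping.keys f \<subseteq> lists S" "u = skew_class S f"
    using assms(1) by (auto simp: carrier_skew free_algebra_simps)
  then show ?thesis using skew_class_induct[of f "lists S" S P] assms(2-4) by simp
qed

lemma skew_class_in_span:
  assumes "Poly_Mapping.keys f \<subseteq> Z" and Z: "Z \<subseteq> lists S"
  shows "skew_class S f \<in> generate (add_monoid (skew S)) (monomial S ` Z)"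
proof -
  interpret ring "skew S" by (rule ring_skew)
  have B: "monomial S ` Z \<subseteq> carrier (add_monoid (skew S))" using Z by auto
  interpret H: subgroup "generate (add_monoid (skew S)) (monomial S ` Z)" "add_monoid (skew S)"
    by (rule group.generate_is_subgroup[OF a_group B])
  show ?thesis
    using assms
  proof (induction rule: skew_class_induct)
    case zero then show ?case using H.one_closed by simp
  next
    case (monomial w) then show ?case by (simp add: generate.incl)
  next
    case (diff x y) then show ?case
      using H.m_closed H.m_inv_closed by (simp add: a_minus_def a_inv_def)
  qed
qed

lemma skew_span: "carrier (skew S) = generate (add_monoid (skew S)) (monomial S ` lists S)"
proof -
  interpret ring "skew S" by (rule ring_skew)
  have B: "monomial S ` lists S \<subseteq> carrier (add_monoid (skew S))" by auto
  show ?thesis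
    using group.generate_incl[OF a_group B] skew_class_in_span[of _ "lists S" S]
    by (auto simp: carrier_skew free_algebra_simps)
qed

text \<open>A function on words extends additively to the free algebra. It annihilates the ideal as soon as
  it annihilates every product \<open>v r w\<close> of a relator with words. The elements \<open>f\<close> for which all
  products \<open>a f b\<close> are annihilated form an ideal, so that no description of the elements of a generated
  ideal is needed.\<close>

lemma (in comm_group) skew_lift:
  assumes g: "\<And>w. w \<in> lists S \<Longrightarrow> g w \<in> carrier G"
    and swap: "\<And>v w x y. v \<in> lists S \<Longrightarrow> w \<in> lists S \<Longrightarrow> x \<in> S \<Longrightarrow> y \<in> S \<Longrightarrow>
                 g (v @ [x, y] @ w) \<otimes> g (v @ [y, x] @ w) = \<one>"
    and square: "\<And>v w x. v \<in> lists S \<Longrightarrow> w \<in> lists S \<Longrightarrow> x \<in> S \<Longrightarrow> g (v @ [x, x] @ w) = \<one>"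
  obtains h where "h \<in> hom (add_monoid (skew S)) G" "\<And>w. w \<in> lists S \<Longrightarrow> h (monomial S w) = g w"
proof -
  let ?F = "free_Abelian_group (lists S)"
  interpret F: ring "free_algebra S" by (rule ring_free_algebra)
  interpret I: ideal "skew_ideal S" "free_algebra S" by (rule ideal_skew_ideal)
  obtain h where h: "h \<in> hom ?F G" and hg: "\<And>w. w \<in> lists S \<Longrightarrow> h (frag_of w) = g w"
    using free_Abelian_group_universal[of g "lists S"] g by blast
  interpret h: group_hom ?F G h
    using h by (simp add: group_hom_def group_hom_axioms_def is_group)
  define K where "K = {f \<in> carrier (free_algebra S). \<forall>a \<in> carrier (free_algebra S).
     \<forall>b \<in> carrier (free_algebra S). h (concat_mult (concat_mult a f) b) = \<one>}"
  have hadd: "h (x + y) = h x \<otimes> h y" if "Poly_Mapping.keys x \<subseteq> lists S" "Poly_Mapping.keys y \<subseteq> lists S" for x y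
    using h.hom_mult that by simp
  have hdiff: "h (x - y) = h x \<otimes> inv (h y)" if "Poly_Mapping.keys x \<subseteq> lists S" "Poly_Mapping.keys y \<subseteq> lists S" for x y
    using h.hom_mult[of x "-y"] h.hom_inv[of y] that by (simp add: keys_minus)
  have hneg: "h (- x) = inv (h x)" if "Poly_Mapping.keys x \<subseteq> lists S" for x
    using h.hom_inv[of x] that by simp
  have h0: "h 0 = \<one>" using h.hom_one by simp
  have idealK: "ideal K (free_algebra S)"
  proof (rule idealI[OF ring_free_algebra])
    show "subgroup K (add_monoid (free_algebra S))"
      unfolding add_monoid_free_algebra
    proof (rule group.subgroupI[OF group_free_Abelian_group])
      show "K \<subseteq> carrier ?F" by (auto simp: K_def free_algebra_simps)
      have "0 \<in> K" by (auto simp: K_def free_algebra_simps concat_mult_bilinear h0)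
      then show "K \<noteq> {}" by auto
      fix x y assume x: "x \<in> K" and y: "y \<in> K"
      have "concat_mult (concat_mult a (0 - x)) b = 0 - concat_mult (concat_mult a x) b" for a b
        by (simp only: concat_mult_bilinear)
      then have "concat_mult (concat_mult a (- x)) b = 0 - concat_mult (concat_mult a x) b" for a b
        by simp
      then show "inv\<^bsub>?F\<^esub> x \<in> K" using x
        by (auto simp: K_def free_algebra_simps keys_minus hneg keys_concat_mult)
      have "Poly_Mapping.keys (x + y) \<subseteq> lists S" 
        using x y by (intro order_trans[OF keys_add]) (simp add: K_def free_algebra_simps)
      then show "x \<otimes>\<^bsub>?F\<^esub> y \<in> K" using x y
        by (auto simp: K_def free_algebra_simps concat_mult_bilinear hadd keys_concat_mult)
    qed
  next
    fix a x assume a: "a \<in> K" and x: "x \<in> carrier (free_algebra S)"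
    show "x \<otimes>\<^bsub>free_algebra S\<^esub> a \<in> K" "a \<otimes>\<^bsub>free_algebra S\<^esub> x \<in> K"
      using a x by (auto simp: K_def free_algebra_simps keys_concat_mult concat_mult_assoc)
         (auto simp: concat_mult_assoc[symmetric] keys_concat_mult)
  qed
  have words: "h (concat_mult (concat_mult a r) b) = \<one>"
    if r: "Poly_Mapping.keys r \<subseteq> lists S" and
      vw: "\<And>v w. v \<in> lists S \<Longrightarrow> w \<in> lists S \<Longrightarrow> h (concat_mult (concat_mult (frag_of v) r) (frag_of w)) = \<one>"
      and a: "Poly_Mapping.keys a \<subseteq> lists S" and b: "Poly_Mapping.keys b \<subseteq> lists S" for a b r
  proof -
    have vb: "h (concat_mult (concat_mult (frag_of v) r) b) = \<one>" if v: "v \<in> lists S" for v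
      using b by (induction b rule: free_Abelian_group_induct[consumes 1])
        (use v r vw in \<open>auto simp: concat_mult_bilinear h0 hdiff keys_concat_mult keys_frag_of\<close>)
    show ?thesis
      using a by (induction a rule: free_Abelian_group_induct[consumes 1])
        (use r b vb in \<open>auto simp: concat_mult_bilinear h0 hdiff keys_concat_mult keys_frag_of\<close>)
  qed
  have "skew_relators S \<subseteq> K"
  proof
    fix r assume r: "r \<in> skew_relators S"
    then have rc: "Poly_Mapping.keys r \<subseteq> lists S"
      using skew_relators_carrier by (auto simp: free_algebra_simps)
    have "h (concat_mult (concat_mult (frag_of v) r) (frag_of w)) = \<one>"
      if vw: "v \<in> lists S" "w \<in> lists S" for v w
    proof -
      have *: "v @ [x, y] @ w \<in> lists S" if "x \<in> S" "y \<in> S" for x y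
        using vw that by simp
      have "h (frag_of (v @ [x, y] @ w) + frag_of (v @ [y, x] @ w)) = \<one>" if "x \<in> S" "y \<in> S" for x y
        using swap[OF vw that] *[OF that] *[OF that(2,1)] by (subst hadd) (simp_all add: hg keys_frag_of)
      moreover have "h (frag_of (v @ [x, x] @ w)) = \<one>" if "x \<in> S" for x
        using square[OF vw that] *[OF that that] by (subst hg)
      ultimately show ?thesis
        using r by (auto simp: skew_relators_def concat_mult_bilinear concat_mult_of)
    qed
    from words[OF rc this] rc show "r \<in> K"
      by (auto simp: K_def free_algebra_simps)
  qed
  then have IK: "skew_ideal S \<subseteq> K"
    unfolding skew_ideal_alt by (rule F.genideal_minimal[OF idealK])
  have "h f = \<one>" if "f \<in> skew_ideal S" for f
  proof -
    have "h (concat_mult (concat_mult (frag_of []) f) (frag_of [])) = \<one>"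
      using IK that by (auto simp: K_def free_algebra_simps keys_frag_of)
    then show ?thesis by (simp add: concat_mult_one)
  qed
  moreover have "skew_ideal S \<subseteq> carrier (free_algebra S)" using I.a_subset .
  ultimately have ker: "skew_ideal S \<subseteq> kernel ?F G h"
    by (auto simp: kernel_def free_algebra_simps)
  have norm: "skew_ideal S \<lhd> ?F"
    using I.a_subgroup comm_group.normal_iff_subgroup[OF abelian_free_Abelian_group]
    unfolding add_monoid_free_algebra by blast
  obtain k where k: "k \<in> hom (?F Mod skew_ideal S) G"
    "\<And>x. x \<in> carrier ?F \<Longrightarrow> k (skew_ideal S #>\<^bsub>?F\<^esub> x) = h x"
    using h.FactGroup_universal_kernel[OF norm ker] by blast
  show thesis
  proof
    show "k \<in> hom (add_monoid (skew S)) G" unfolding add_monoid_skew by (rule k)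
    show "k (monomial S w) = g w" if "w \<in> lists S" for w
      using k(2)[of "frag_of w"] that by (simp add: monomial_def skew_class_r_coset hg)
  qed
qed

section \<open>Inversions of words\<close>

text \<open>\<open>P x y\<close> says that \<open>x\<close> and \<open>y\<close> are out of order if \<open>x\<close> stands to the left of \<open>y\<close>. The relation is
  \<open>(>)\<close> for permutations of numbers and the comparison of places for letterplace words.\<close>

primrec inversions :: "('b \<Rightarrow> 'b \<Rightarrow> bool) \<Rightarrow> 'b list \<Rightarrow> nat" where
  "inversions P [] = 0"
| "inversions P (x # xs) = length (filter (P x) xs) + inversions P xs"

definition crossings :: "('b \<Rightarrow> 'b \<Rightarrow> bool) \<Rightarrow> 'b list \<Rightarrow> 'b list \<Rightarrow> nat" where
  "crossings P xs ys = (\<Sum>x\<leftarrow>xs. length (filter (P x) ys))"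

lemma inversions_append:
  "inversions P (xs @ ys) = inversions P xs + inversions P ys + crossings P xs ys"
  by (induction xs) (simp_all add: crossings_def)

lemma inversions_swap_adjacent:
  "inversions P (v @ [x, y] @ w) + of_bool (P y x) = inversions P (v @ [y, x] @ w) + of_bool (P x y)"
  by (induction v) simp_all

lemma inversion_sign_swap:
  assumes "P x y \<longleftrightarrow> \<not> P y x"
  shows "(-1 :: int) ^ inversions P (v @ [x, y] @ w) = - ((-1) ^ inversions P (v @ [y, x] @ w))"
proof -
  let ?a = "inversions P (v @ [x, y] @ w)" and ?b = "inversions P (v @ [y, x] @ w)"
  have "?a = Suc ?b \<or> ?b = Suc ?a"
    using inversions_swap_adjacent[of P v x y w] assms by (cases "P x y") auto
  moreover have "(-1 :: int) ^ a = - ((-1) ^ b)" if "a = Suc b \<or> b = Suc a" for a b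
    using that by auto
  ultimately show ?thesis by blast
qed

lemma crossings_append:
  "crossings P (xs @ ys) zs = crossings P xs zs + crossings P ys zs"
  "crossings P xs (ys @ zs) = crossings P xs ys + crossings P xs zs"
  by (simp_all add: crossings_def sum_list_addf)

lemma crossings_Cons:
  "crossings P xs [] = 0"
  "crossings P xs (y # ys) = length (filter (\<lambda>x. P x y) xs) + crossings P xs ys"
  by (induction xs) (simp_all add: crossings_def)

lemma crossings_single:
  "crossings P xs [y] = length (filter (\<lambda>x. P x y) xs)"
  "crossings P [x] ys = length (filter (P x) ys)"
  by (induction xs) (simp_all add: crossings_def)

lemma inversions_map: "inversions P (map f xs) = inversions (\<lambda>x y. P (f x) (f y)) xs"
  by (induction xs) (simp_all add: filter_map comp_def)

lemma inversions_sorted: "sorted xs \<Longrightarrow> inversions (>) xs = 0" for xs :: "nat list"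
  by (induction xs) (auto simp: filter_empty_conv not_less)

lemma move_to_front:
  assumes "distinct (p @ a # q)" "Q (p @ a # q)"
    and "\<And>v x y w. x \<noteq> y \<Longrightarrow> mset (v @ [x, y] @ w) = mset (p @ a # q) \<Longrightarrow>
           Q (v @ [x, y] @ w) \<Longrightarrow> Q (v @ [y, x] @ w)"
  shows "Q (a # p @ q)"
  using assms
proof (induction p arbitrary: q rule: rev_induct)
  case (snoc b p)
  have "Q (p @ [b, a] @ q)" using snoc.prems(2) by simp
  then have "Q (p @ [a, b] @ q)"
    using snoc.prems(1) by (intro snoc.prems(3)[of b a p q]) auto
  then have "Q (a # p @ (b # q))"
    using snoc.prems(1) snoc.prems(3) by (intro snoc.IH) (auto simp: add_mset_commute)
  then show ?case by simp
qed simp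

text \<open>Adjacent transpositions connect any two arrangements of distinct letters: move the first letter
  of the goal to the front and continue with the rest. This compares functions that change sign under
  adjacent transpositions, such as monomials and signs of permutations.\<close>

lemma adjacent_swap_induct [consumes 2, case_names refl swap]:
  assumes "distinct ys" "mset xs = mset ys" "Q ys"
    and "\<And>v x y w. x \<noteq> y \<Longrightarrow> mset (v @ [x, y] @ w) = mset ys \<Longrightarrow>
           Q (v @ [x, y] @ w) \<Longrightarrow> Q (v @ [y, x] @ w)"
  shows "Q xs"
  using assms
proof (induction xs arbitrary: ys Q)
  case (Cons a u)
  have "a \<in> set ys" using Cons.prems(2) by (metis list.set_intros(1) mset_eq_setD)
  then obtain p q where ys: "ys = p @ a # q" by (meson split_list)
  have 1: "Q (a # p @ q)"
  proof (rule move_to_front[where Q = Q])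
    show "distinct (p @ a # q)" "Q (p @ a # q)" using Cons.prems(1,3) by (simp_all add: ys)
    show "Q (v @ [y, x] @ w)" if "x \<noteq> y" "mset (v @ [x, y] @ w) = mset (p @ a # q)" "Q (v @ [x, y] @ w)"
      for v x y w using that unfolding ys[symmetric] by (rule Cons.prems(4))
  qed
  show ?case
  proof (rule Cons.IH[of "p @ q" "\<lambda>z. Q (a # z)"])
    show "mset u = mset (p @ q)" using Cons.prems(2) ys by simp
    fix v x y w assume *: "x \<noteq> y" "mset (v @ [x, y] @ w) = mset (p @ q)" "Q (a # v @ [x, y] @ w)"
    show "Q (a # v @ [y, x] @ w)"
      using Cons.prems(4)[of x y "a # v" w] * ys by simp
  qed (use 1 Cons.prems(1) ys in auto)
qed simp

section \<open>Monomials up to sign and torsion-freeness\<close>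

lemma monomial_swap:
  assumes "v \<in> lists S" "w \<in> lists S" "x \<in> S" "y \<in> S"
  shows "monomial S (v @ [y, x] @ w) = \<ominus>\<^bsub>skew S\<^esub> monomial S (v @ [x, y] @ w)"
proof -
  interpret ring "skew S" by (rule ring_skew)
  have "monomial S [y, x] = \<ominus>\<^bsub>skew S\<^esub> monomial S [x, y]"
    using monomial_swap2[OF assms(4,3)] assms by (intro minus_equality[symmetric]) auto
  then show ?thesis using assms
    by (simp add: monomial_append[of v S] monomial_append[of _ S w, simplified]
       monomial_append[of "[x,y]" S w, simplified]  monomial_append[of "[y,x]" S w, simplified]
       l_minus r_minus)
qed

lemma monomial_square_zero:
  assumes "v \<in> lists S" "w \<in> lists S" "x \<in> S"
  shows "monomial S (v @ [x, x] @ w) = \<zero>\<^bsub>skew S\<^esub>"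
proof -
  interpret ring "skew S" by (rule ring_skew)
  show ?thesis using assms
    by (simp add: monomial_append[of v S] monomial_append[of "[x,x]" S w, simplified] monomial_square)
qed

lemma monomial_not_distinct:
  assumes "w \<in> lists S" "\<not> distinct w"
  shows "monomial S w = \<zero>\<^bsub>skew S\<^esub>"
proof -
  interpret ring "skew S" by (rule ring_skew)
  obtain a x b c where w: "w = a @ [x] @ b @ [x] @ c"
    using assms(2) not_distinct_decomp by blast
  have "monomial S (a @ [x] @ b @ [x] @ c) = \<zero>\<^bsub>skew S\<^esub>"
    using assms(1) unfolding w
  proof (induction b arbitrary: a)
    case Nil then show ?case using monomial_square_zero[of a S c x] by simp
  next
    case (Cons y b)
    have "monomial S ((a @ [y]) @ [x] @ b @ [x] @ c) = \<zero>\<^bsub>skew S\<^esub>"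
      using Cons.prems by (intro Cons.IH) auto
    then show ?case
      using Cons.prems monomial_swap[of a S "b @ [x] @ c" y x] by simp
  qed
  then show ?thesis by (simp add: w)
qed

text \<open>If \<open>P\<close> compares any two distinct letters in exactly one direction, an adjacent transposition changes
  the parity of the number of inversions, just as it changes the sign of the monomial.\<close>

lemma monomial_permute:
  assumes P: "\<And>x y. x \<noteq> y \<Longrightarrow> P x y \<longleftrightarrow> \<not> P y x"
    and "v \<in> lists S" "distinct v" "mset w = mset v"
  shows "[((-1 :: int) ^ inversions P w)] \<cdot>\<^bsub>skew S\<^esub> monomial S w =
         [((-1 :: int) ^ inversions P v)] \<cdot>\<^bsub>skew S\<^esub> monomial S v"
  using assms(3,4)
proof (induction rule: adjacent_swap_induct)
  case (swap a x y b)
  interpret ring "skew S" by (rule ring_skew)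
  have "set (a @ [x, y] @ b) = set v" using swap(2) by (metis mset_eq_setD)
  then have l: "a \<in> lists S" "b \<in> lists S" "x \<in> S" "y \<in> S"
    using assms(2) by (auto simp: in_lists_conv_set)
  show ?case
    unfolding swap(3)[symmetric] monomial_swap[OF l]
    using l by (subst inversion_sign_swap[where P = P and x = y and y = x, OF P[OF swap(1)[symmetric]]])
      (simp add: add.int_pow_neg add.int_pow_inv)
qed simp

text \<open>Fix one arrangement \<open>e w\<close> of the letters of each word \<open>w\<close> with distinct letters, depending only on
  the set of letters. Sending \<open>w\<close> to the signed word \<open>e w\<close>, and words with a repeated letter to \<open>0\<close>,
  respects skew-symmetry, and the class of the image is the class of \<open>w\<close> again. Hence \<open>skew S\<close>
  embeds as an additive group into a free abelian group.\<close>

lemma skew_torsion_free: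
  assumes "u \<in> carrier (skew S)" "n \<noteq> 0" "[(n :: int)] \<cdot>\<^bsub>skew S\<^esub> u = \<zero>\<^bsub>skew S\<^esub>"
  shows "u = \<zero>\<^bsub>skew S\<^esub>"
proof -
  interpret ring "skew S" by (rule ring_skew)
  let ?F = "free_Abelian_group (lists S)"
  interpret F: comm_group ?F by (rule abelian_free_Abelian_group)
  obtain r :: "'a rel" where r: "well_order_on UNIV r"
    by (metis well_ordering)
  define P where "P x y \<longleftrightarrow> (y, x) \<in> r \<and> x \<noteq> y" for x y
  have P: "P x y \<longleftrightarrow> \<not> P y x" if "x \<noteq> y" for x y
    using r that unfolding P_def well_order_on_def linear_order_on_def total_on_def
      partial_order_on_def antisym_def by blast
  define e where "e w = (SOME v :: 'a list. distinct v \<and> mset v = mset w)" for w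
  have e: "distinct (e w) \<and> mset (e w) = mset w" if "distinct w" for w
    unfolding e_def by (rule someI[of _ w]) (simp add: that)
  have e_cong: "e v = e w" if "mset v = mset w" for v w
    unfolding e_def that ..
  have e_lists: "e w \<in> lists S" if "distinct w" "w \<in> lists S" for w
    using e[OF that(1)] that(2) by (metis in_lists_conv_set mset_eq_setD)
  define g where "g w = (if distinct w then 
      frag_cmul ((-1) ^ inversions P w * (-1) ^ inversions P (e w)) (frag_of (e w)) else 0)" for w
  have g1: "g w \<in> carrier ?F" if "w \<in> lists S" for w
  proof (cases "distinct w")
    case True
    then show ?thesis
      using order_trans[OF keys_cmul, of "frag_of (e w)" "lists S"] e_lists[OF True that]
      by (simp add: g_def keys_frag_of)
  qed (simp add: g_def)
  have g2: "g (v @ [x, y] @ w) \<otimes>\<^bsub>?F\<^esub> g (v @ [y, x] @ w) = \<one>\<^bsub>?F\<^esub>" for v w x y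
  proof (cases "distinct (v @ [x, y] @ w)")
    case True
    then have "x \<noteq> y" by auto
    with True show ?thesis
      using inversion_sign_swap[where P = P, OF P[OF \<open>x \<noteq> y\<close>], of v w] e_cong[of "v @ [x, y] @ w" "v @ [y, x] @ w"]
      by (auto simp: g_def insert_commute simp flip: frag_cmul_distrib)
  next
    case False
    then have "\<not> distinct (v @ [y, x] @ w)" by auto
    with False show ?thesis by (simp add: g_def del: distinct_append)
  qed
  have g3: "g (v @ [x, x] @ w) = \<one>\<^bsub>?F\<^esub>" for v w x by (simp add: g_def)
  obtain h where h: "h \<in> hom (add_monoid (skew S)) ?F"
    and hg: "\<And>w. w \<in> lists S \<Longrightarrow> h (monomial S w) = g w"
    using F.skew_lift[of S g, OF g1 g2 g3] by blast
  interpret cr: ring_hom_ring "free_algebra S" "skew S" "skew_class S" by (rule skew_class_hom)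
  have c: "skew_class S \<in> hom ?F (add_monoid (skew S))"
    using cr.hom_add cr.hom_closed by (intro homI) (simp_all add: free_algebra_simps)
  interpret h: group_hom "add_monoid (skew S)" ?F h
    by (intro group_hom.intro group_hom_axioms.intro a_group F.is_group h)
  interpret c: group_hom ?F "add_monoid (skew S)" "skew_class S"
    by (intro group_hom.intro group_hom_axioms.intro a_group F.is_group c)
  \<comment> \<open>\<open>h\<close> is injective, because the class map is a left inverse.\<close>
  have normal_form: "skew_class S (h u) = u" if "u \<in> carrier (skew S)" for u
    using that
  proof (induction rule: skew_induct)
    case (monomial w)
    show ?case
    proof (cases "distinct w")
      case True
      let ?s = "(-1 :: int) ^ inversions P w" and ?t = "(-1 :: int) ^ inversions P (e w)"
      have ew: "monomial S (e w) \<in> carrier (skew S)" and mw: "monomial S w \<in> carrier (skew S)"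
        using e_lists[OF True monomial] monomial by auto
      have "skew_class S (g w) = skew_class S (frag_of (e w) [^]\<^bsub>?F\<^esub> (?s * ?t))"
        using e_lists[OF True monomial] True by (simp add: g_def keys_frag_of)
      also have "\<dots> = [(?s * ?t)] \<cdot>\<^bsub>skew S\<^esub> monomial S (e w)"
        using c.hom_int_pow[of "frag_of (e w)" "?s * ?t"] e_lists[OF True monomial]
        by (simp add: add_pow_def monomial_def keys_frag_of)
      also have "\<dots> = [(?s)] \<cdot>\<^bsub>skew S\<^esub> ([(?t)] \<cdot>\<^bsub>skew S\<^esub> monomial S (e w))"
        using add.int_pow_pow[OF ew, of ?s ?t] by (simp add: mult.commute)
      also have "[(?t)] \<cdot>\<^bsub>skew S\<^esub> monomial S (e w) = [(?s)] \<cdot>\<^bsub>skew S\<^esub> monomial S w"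
        using monomial_permute[where P = P and w = w and v = "e w", OF P] e[OF True] e_lists[OF True monomial]
        by simp
      also have "[(?s)] \<cdot>\<^bsub>skew S\<^esub> ([(?s)] \<cdot>\<^bsub>skew S\<^esub> monomial S w) = [(?s * ?s)] \<cdot>\<^bsub>skew S\<^esub> monomial S w"
        using add.int_pow_pow[OF mw, of ?s ?s] by simp
      finally show ?thesis using mw monomial hg by (simp flip: power_mult_distrib)
    next
      case False
      then show ?thesis using h.hom_one c.hom_one
        by (simp add: monomial_not_distinct[OF monomial False])
    qed
  next
    case zero
    then show ?case using h.hom_one c.hom_one by simp
  next
    case (diff x y)
    have carriers: "h x \<in> carrier ?F" "h y \<in> carrier ?F"
      using h.hom_closed diff(1,2) by simp_all
    have "h (x \<ominus>\<^bsub>skew S\<^esub> y) = h x \<otimes>\<^bsub>?F\<^esub> inv\<^bsub>?F\<^esub> h y"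
      using h.hom_mult[of x "\<ominus>\<^bsub>skew S\<^esub> y"] h.hom_inv[of y] diff(1,2) a_inv_closed[of y]
      unfolding a_minus_def a_inv_def by simp
    then show ?case
      using c.hom_mult[of "h x" "inv\<^bsub>?F\<^esub> h y"] c.hom_inv[of "h y"] diff(3,4) carriers
      unfolding a_minus_def a_inv_def by (metis F.inv_closed monoid.simps(1))
  qed
  have "frag_cmul n (h u) = h \<zero>\<^bsub>skew S\<^esub>"
    using assms h.hom_int_pow[of u n] h.hom_closed[of u] by (simp add: add_pow_def)
  then have "h u = 0" using h.hom_one assms(2) by simp
  then show ?thesis using normal_form[OF assms(1)] c.hom_one by simp
qed

section \<open>Tensor powers\<close>

lemma tuples_update:
  "A \<in> tuples R m \<Longrightarrow> k \<in> {1..m} \<Longrightarrow> x \<in> carrier R \<Longrightarrow> A(k := x) \<in> tuples R m"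
  unfolding tuples_def by (auto simp: PiE_iff extensional_def)

definition multiadditive ::
  "('r, 'n) ring_scheme \<Rightarrow> nat \<Rightarrow> ('g, 'k) monoid_scheme \<Rightarrow> ((nat \<Rightarrow> 'r) \<Rightarrow> 'g) \<Rightarrow> bool" where
  "multiadditive R m G g \<longleftrightarrow> g \<in> tuples R m \<rightarrow> carrier G \<and>
     (\<forall>A \<in> tuples R m. \<forall>k \<in> {1..m}. \<forall>x \<in> carrier R. \<forall>y \<in> carrier R.
        g (A(k := x \<oplus>\<^bsub>R\<^esub> y)) = g (A(k := x)) \<otimes>\<^bsub>G\<^esub> g (A(k := y)))"

lemma multiadditive_hom:
  assumes "multiadditive R m G g" "A \<in> tuples R m" "k \<in> {1..m}"
  shows "(\<lambda>x. g (A(k := x))) \<in> hom (add_monoid R) G"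
  using assms tuples_update[of A R m k] by (auto simp: multiadditive_def hom_def)

lemma multiadditive_compose:
  assumes "multiadditive R m G g" "h \<in> hom G H"
  shows "multiadditive R m H (\<lambda>A. h (g A))"
  unfolding multiadditive_def
proof (intro conjI ballI)
  show "(\<lambda>A. h (g A)) \<in> tuples R m \<rightarrow> carrier H"
    using assms by (auto simp: multiadditive_def hom_def)
  fix A k x y
  assume *: "A \<in> tuples R m" "k \<in> {1..m}" "x \<in> carrier R" "y \<in> carrier R"
  then have "g (A(k := x)) \<in> carrier G" "g (A(k := y)) \<in> carrier G"
    using assms(1) tuples_update[OF *(1,2)] by (auto simp: multiadditive_def)
  then show "h (g (A(k := x \<oplus>\<^bsub>R\<^esub> y))) = h (g (A(k := x))) \<otimes>\<^bsub>H\<^esub> h (g (A(k := y)))"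
    using assms * by (simp add: multiadditive_def hom_mult)
qed

text \<open>Replace the generators by arbitrary elements of their span in one slot after the other.\<close>

lemma multiadditive_eqI:
  assumes "abelian_group R" "group G" and f: "multiadditive R m G f" and g: "multiadditive R m G g"
    and B: "\<And>k. k \<in> {1..m} \<Longrightarrow> B k \<subseteq> carrier R"
    and eq: "\<And>A. A \<in> tuples R m \<Longrightarrow> (\<And>k. k \<in> {1..m} \<Longrightarrow> A k \<in> B k) \<Longrightarrow> f A = g A"
    and A: "A \<in> tuples R m" "\<And>k. k \<in> {1..m} \<Longrightarrow> A k \<in> generate (add_monoid R) (B k)"
  shows "f A = g A"
proof -
  interpret abelian_group R by fact
  have "f A = g A" if "K \<subseteq> {1..m}" "A \<in> tuples R m"
    "\<And>k. k \<in> K \<Longrightarrow> A k \<in> generate (add_monoid R) (B k)"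
    "\<And>k. k \<in> {1..m} - K \<Longrightarrow> A k \<in> B k" for K A
    using finite_subset[OF that(1) finite_atLeastAtMost] that
  proof (induction K arbitrary: A rule: finite_induct)
    case empty then show ?case using eq by auto
  next
    case (insert k K)
    have k: "k \<in> {1..m}" using insert.prems(1) by simp
    have "f (A(k := A k)) = g (A(k := A k))"
    proof (rule hom_eq_on_generate[where f = "\<lambda>x. f (A(k := x))" and g = "\<lambda>x. g (A(k := x))"])
      show "B k \<subseteq> carrier (add_monoid R)" using B[OF k] by simp
      show "A k \<in> generate (add_monoid R) (B k)" using insert.prems by simp
      fix b assume b: "b \<in> B k"
      then have bc: "b \<in> carrier R" using B[OF k] by auto
      show "f (A(k := b)) = g (A(k := b))"
      proof (rule insert.IH)
        show "K \<subseteq> {1..m}" "A(k := b) \<in> tuples R m"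
          using insert.prems(1,2) tuples_update[OF _ k bc] by auto
        show "(A(k := b)) l \<in> generate (add_monoid R) (B l)" if "l \<in> K" for l
          using that insert.hyps(2) insert.prems(3)[of l] by auto
        show "(A(k := b)) l \<in> B l" if "l \<in> {1..m} - K" for l
          using that b insert.prems(4)[of l] by auto
      qed
    qed (use assms a_group multiadditive_hom[OF f insert.prems(2) k] multiadditive_hom[OF g insert.prems(2) k] in auto)
    then show ?case by simp
  qed
  from this[of "{1..m}" A] show ?thesis using A by auto
qed

definition tensor_relators :: "('r, 'n) ring_scheme \<Rightarrow> nat \<Rightarrow> ((nat \<Rightarrow> 'r) \<Rightarrow>\<^sub>0 int) set" where
  "tensor_relators R m =
     {frag_of (A(k := x \<oplus>\<^bsub>R\<^esub> y)) - frag_of (A(k := x)) - frag_of (A(k := y)) | A k x y.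
          A \<in> tuples R m \<and> k \<in> {1..m} \<and> x \<in> carrier R \<and> y \<in> carrier R}"

context
  fixes R :: "('r, 'n) ring_scheme" and m :: nat
  assumes R: "abelian_group R"
begin

interpretation R: abelian_group R by (rule R)

lemma tensor_relators_carrier:
  "tensor_relators R m \<subseteq> carrier (free_Abelian_group (tuples R m))"
proof
  fix r assume "r \<in> tensor_relators R m"
  then obtain A k x y where *: "A \<in> tuples R m" "k \<in> {1..m}" "x \<in> carrier R" "y \<in> carrier R"
    and r: "r = frag_of (A(k := x \<oplus>\<^bsub>R\<^esub> y)) - frag_of (A(k := x)) - frag_of (A(k := y))"
    unfolding tensor_relators_def by blast
  have "Poly_Mapping.keys r \<subseteq> {A(k := x \<oplus>\<^bsub>R\<^esub> y), A(k := x), A(k := y)}"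
    unfolding r by (rule order_trans[OF keys_diff], rule Un_least, rule order_trans[OF keys_diff])
      (auto simp: keys_frag_of)
  also have "\<dots> \<subseteq> tuples R m"
    using tuples_update[OF *(1,2)] *(3,4) by auto
  finally show "r \<in> carrier (free_Abelian_group (tuples R m))" by simp
qed

lemma tensor_relations_subgroup:
  "subgroup (tensor_relations R m) (free_Abelian_group (tuples R m))"
  using group.generate_is_subgroup[OF group_free_Abelian_group tensor_relators_carrier]
  unfolding tensor_relations_def tensor_relators_def .

lemma tensor_relations_normal: "tensor_relations R m \<lhd> free_Abelian_group (tuples R m)"
  using tensor_relations_subgroup comm_group.normal_iff_subgroup[OF abelian_free_Abelian_group] by blast

lemma tensor_group_comm_group: "comm_group (tensor_group R m)"
  unfolding tensor_group_def
  by (rule comm_group.abelian_FactGroup[OF abelian_free_Abelian_group tensor_relations_subgroup])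

lemma tensor_closed: "A \<in> tuples R m \<Longrightarrow> tensor R m A \<in> carrier (tensor_group R m)"
  by (auto simp: tensor_group_def tensor_def carrier_FactGroup)

lemma tensor_coset_hom:
  "(\<lambda>f. tensor_relations R m #>\<^bsub>free_Abelian_group (tuples R m)\<^esub> f)
     \<in> hom (free_Abelian_group (tuples R m)) (tensor_group R m)"
  unfolding tensor_group_def by (rule normal.r_coset_hom_Mod[OF tensor_relations_normal])

lemma multiadditive_tensor: "multiadditive R m (tensor_group R m) (tensor R m)"
  unfolding multiadditive_def
proof (intro conjI ballI)
  show "tensor R m \<in> tuples R m \<rightarrow> carrier (tensor_group R m)" using tensor_closed by blast
  fix A k x y
  assume *: "A \<in> tuples R m" "k \<in> {1..m}" "x \<in> carrier R" "y \<in> carrier R"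
  let ?F = "free_Abelian_group (tuples R m)"
  let ?q = "\<lambda>f. tensor_relations R m #>\<^bsub>?F\<^esub> f"
  let ?r = "frag_of (A(k := x \<oplus>\<^bsub>R\<^esub> y)) - frag_of (A(k := x)) - frag_of (A(k := y))"
  note upd = tuples_update[OF *(1,2)]
  have r: "?r \<in> tensor_relations R m"
    unfolding tensor_relations_def by (rule generate.incl) (use * in blast)
  have rc: "?r \<in> carrier ?F" using r subgroup.subset[OF tensor_relations_subgroup] by blast
  interpret F: group ?F by simp
  interpret T: comm_group "tensor_group R m" by (rule tensor_group_comm_group)
  interpret q: group_hom ?F "tensor_group R m" ?q
    using tensor_coset_hom by (simp add: group_hom_def group_hom_axioms_def T.is_group)
  have "?q ?r = \<one>\<^bsub>tensor_group R m\<^esub>"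
    using F.coset_join2[OF rc tensor_relations_subgroup r] by (simp add: tensor_group_def)
  moreover have "frag_of (A(k := x \<oplus>\<^bsub>R\<^esub> y)) = ?r \<otimes>\<^bsub>?F\<^esub> (frag_of (A(k := x)) \<otimes>\<^bsub>?F\<^esub> frag_of (A(k := y)))"
    by simp
  moreover have "frag_of (A(k := x)) \<in> carrier ?F" "frag_of (A(k := y)) \<in> carrier ?F"
    using upd * by auto
  ultimately show "tensor R m (A(k := x \<oplus>\<^bsub>R\<^esub> y)) =
      tensor R m (A(k := x)) \<otimes>\<^bsub>tensor_group R m\<^esub> tensor R m (A(k := y))"
    unfolding tensor_def using rc by (metis (no_types, lifting) F.m_closed T.l_one q.hom_closed q.hom_mult)
qed

lemma tensor_span: "carrier (tensor_group R m) = generate (tensor_group R m) (tensor R m ` tuples R m)"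
proof -
  interpret T: comm_group "tensor_group R m" by (rule tensor_group_comm_group)
  let ?F = "free_Abelian_group (tuples R m)"
  let ?q = "\<lambda>f. tensor_relations R m #>\<^bsub>?F\<^esub> f"
  interpret q: group_hom ?F "tensor_group R m" ?q
    using tensor_coset_hom by (simp add: group_hom_def group_hom_axioms_def T.is_group)
  have B: "tensor R m ` tuples R m \<subseteq> carrier (tensor_group R m)" using tensor_closed by blast
  interpret H: subgroup "generate (tensor_group R m) (tensor R m ` tuples R m)" "tensor_group R m"
    by (rule T.generate_is_subgroup[OF B])
  have "?q f \<in> generate (tensor_group R m) (tensor R m ` tuples R m)"
    if "Poly_Mapping.keys f \<subseteq> tuples R m" for f
    using that
  proof (induction f rule: free_Abelian_group_induct[consumes 1, case_names zero diff of])
    case zero then show ?case using q.hom_one H.one_closed by simp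
  next
    case (diff a b)
    have "?q (a - b) = ?q a \<otimes>\<^bsub>tensor_group R m\<^esub> inv\<^bsub>tensor_group R m\<^esub> ?q b"
      using q.hom_mult[of a "- b"] q.hom_inv[of b] diff by simp
    then show ?case using diff H.m_closed H.m_inv_closed by simp
  next
    case (of A) then show ?case by (simp add: tensor_def[symmetric] generate.incl)
  qed
  then have "carrier (tensor_group R m) \<subseteq> generate (tensor_group R m) (tensor R m ` tuples R m)"
    by (auto simp: tensor_group_def carrier_FactGroup)
  then show ?thesis using T.generate_incl[OF B] by blast
qed

lemma tensor_lift:
  assumes "comm_group G" and g: "multiadditive R m G g"
  obtains h where "h \<in> hom (tensor_group R m) G" "\<And>A. A \<in> tuples R m \<Longrightarrow> h (tensor R m A) = g A"
proof -
  interpret G: comm_group G by fact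
  let ?F = "free_Abelian_group (tuples R m)"
  interpret F: group ?F by simp
  have "g ` tuples R m \<subseteq> carrier G" using g by (auto simp: multiadditive_def)
  then obtain h where h: "h \<in> hom ?F G" and hg: "\<And>A. A \<in> tuples R m \<Longrightarrow> h (frag_of A) = g A"
    using G.free_Abelian_group_universal[of g "tuples R m"] by blast
  interpret h: group_hom ?F G h
    using h by (simp add: group_hom_def group_hom_axioms_def)
  have "tensor_relators R m \<subseteq> kernel ?F G h"
  proof
    fix r assume r': "r \<in> tensor_relators R m"
    then obtain A k x y where *: "A \<in> tuples R m" "k \<in> {1..m}" "x \<in> carrier R" "y \<in> carrier R"
      and r: "r = frag_of (A(k := x \<oplus>\<^bsub>R\<^esub> y)) - frag_of (A(k := x)) - frag_of (A(k := y))"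
      unfolding tensor_relators_def by blast
    note upd = tuples_update[OF *(1,2)]
    have c: "r \<in> carrier ?F" using r' tensor_relators_carrier by blast
    have "g (A(k := x \<oplus>\<^bsub>R\<^esub> y)) = h (r + (frag_of (A(k := x)) + frag_of (A(k := y))))"
      using hg[OF upd[OF R.a_closed[OF *(3,4)]]] by (simp add: r)
    also have "\<dots> = h r \<otimes>\<^bsub>G\<^esub> (g (A(k := x)) \<otimes>\<^bsub>G\<^esub> g (A(k := y)))"
    proof -
      have c': "frag_of (A(k := x)) \<in> carrier ?F" "frag_of (A(k := y)) \<in> carrier ?F"
        using upd * by auto
      show ?thesis
        using h.hom_mult[OF c F.m_closed[OF c']] h.hom_mult[OF c'] hg upd * by simp
    qed
    also have "g (A(k := x)) \<otimes>\<^bsub>G\<^esub> g (A(k := y)) = g (A(k := x \<oplus>\<^bsub>R\<^esub> y))"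
      using g * by (simp add: multiadditive_def)
    finally have "h r = \<one>\<^bsub>G\<^esub>"
      using g upd * c h.hom_closed by (metis G.r_cancel_one R.a_closed multiadditive_def Pi_mem)
    then show "r \<in> kernel ?F G h" using c by (simp add: kernel_def)
  qed
  then have "tensor_relations R m \<subseteq> kernel ?F G h"
    using F.generate_subgroup_incl[OF _ h.subgroup_kernel]
    unfolding tensor_relations_def tensor_relators_def by blast
  from h.FactGroup_universal_kernel[OF tensor_relations_normal this]
  obtain k where k: "k \<in> hom (?F Mod tensor_relations R m) G"
    "\<And>x. x \<in> carrier ?F \<Longrightarrow> k (tensor_relations R m #>\<^bsub>?F\<^esub> x) = h x" by blast
  show thesis
  proof
    show "k \<in> hom (tensor_group R m) G" using k by (simp add: tensor_group_def)
    show "k (tensor R m A) = g A" if "A \<in> tuples R m" for A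
      using k(2)[of "frag_of A"] that by (simp add: tensor_def hg)
  qed
qed

end

section \<open>Monomial tensors\<close>

lemma skew_abelian: "abelian_group (skew S)"
  by (rule ring.is_abelian_group[OF ring_skew])

lemmas skew_tensor_comm_group = tensor_group_comm_group[OF skew_abelian]
lemmas multiadditive_skew_tensor = multiadditive_tensor[OF skew_abelian]

definition words_on :: "'a set \<Rightarrow> nat \<Rightarrow> (nat \<Rightarrow> 'a list) set" where
  "words_on L m = {W. \<forall>k \<in> {1..m}. W k \<in> lists L}"

lemma monomial_tuple:
  "W \<in> words_on L m \<Longrightarrow> (\<lambda>k \<in> {1..m}. monomial L (W k)) \<in> tuples (skew L) m"
  by (auto simp: tuples_def words_on_def in_lists_conv_set)

lemma monomial_tensor_closed:
  "W \<in> words_on L m \<Longrightarrow> monomial_tensor L m W \<in> carrier (tensor_group (skew L) m)"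
  unfolding monomial_tensor_def by (rule tensor_closed[OF skew_abelian monomial_tuple])

lemma monomial_tensor_cong:
  "(\<And>k. k \<in> {1..m} \<Longrightarrow> V k = W k) \<Longrightarrow> monomial_tensor L m V = monomial_tensor L m W"
  by (simp add: monomial_tensor_def cong: restrict_cong)

lemma monomial_tensor_slot:
  assumes "k \<in> {1..m}"
  shows "monomial_tensor L m (W(k := v)) =
         tensor (skew L) m ((\<lambda>k \<in> {1..m}. monomial L (W k))(k := monomial L v))"
proof -
  have "(\<lambda>l \<in> {1..m}. monomial L ((W(k := v)) l)) = (\<lambda>k \<in> {1..m}. monomial L (W k))(k := monomial L v)"
    using assms by (intro ext) (simp add: restrict_def)
  then show ?thesis by (simp add: monomial_tensor_def)
qed

lemma monomial_tensor_swap: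
  assumes W: "W \<in> words_on L m" and k: "k \<in> {1..m}" and "v \<in> lists L" "w \<in> lists L" "x \<in> L" "y \<in> L"
  shows "monomial_tensor L m (W(k := v @ [y, x] @ w)) =
         inv\<^bsub>tensor_group (skew L) m\<^esub> monomial_tensor L m (W(k := v @ [x, y] @ w))"
proof -
  interpret R: ring "skew L" by (rule ring_skew)
  interpret T: comm_group "tensor_group (skew L) m" by (rule skew_tensor_comm_group)
  interpret h: group_hom "add_monoid (skew L)" "tensor_group (skew L) m"
    "\<lambda>x. tensor (skew L) m ((\<lambda>k \<in> {1..m}. monomial L (W k))(k := x))"
    by (rule group_homI[OF R.a_group T.is_group
         multiadditive_hom[OF multiadditive_skew_tensor monomial_tuple[OF W] k]])
  show ?thesis
    unfolding monomial_tensor_slot[OF k] monomial_swap[OF assms(3-6)] a_inv_def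
    by (rule h.hom_inv) (use assms in simp)
qed

lemma monomial_tensor_square:
  assumes W: "W \<in> words_on L m" and k: "k \<in> {1..m}" and "v \<in> lists L" "w \<in> lists L" "x \<in> L"
  shows "monomial_tensor L m (W(k := v @ [x, x] @ w)) = \<one>\<^bsub>tensor_group (skew L) m\<^esub>"
proof -
  interpret R: ring "skew L" by (rule ring_skew)
  interpret T: comm_group "tensor_group (skew L) m" by (rule skew_tensor_comm_group)
  interpret h: group_hom "add_monoid (skew L)" "tensor_group (skew L) m"
    "\<lambda>x. tensor (skew L) m ((\<lambda>k \<in> {1..m}. monomial L (W k))(k := x))"
    by (rule group_homI[OF R.a_group T.is_group
         multiadditive_hom[OF multiadditive_skew_tensor monomial_tuple[OF W] k]])
  show ?thesis
    unfolding monomial_tensor_slot[OF k] monomial_square_zero[OF assms(3-5)]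
    using h.hom_one by simp
qed

text \<open>The monomials span \<open>skew L\<close> additively, so the tensors of monomials span the tensor power.\<close>

lemma hom_eq_on_monomial_tensors:
  assumes "group G" "f \<in> hom (tensor_group (skew L) m) G" "g \<in> hom (tensor_group (skew L) m) G"
    and eq: "\<And>W. W \<in> words_on L m \<Longrightarrow> f (monomial_tensor L m W) = g (monomial_tensor L m W)"
    and u: "u \<in> carrier (tensor_group (skew L) m)"
  shows "f u = g u"
proof -
  interpret T: comm_group "tensor_group (skew L) m" by (rule skew_tensor_comm_group)
  have "f (tensor (skew L) m A) = g (tensor (skew L) m A)" if A: "A \<in> tuples (skew L) m" for A
  proof (rule multiadditive_eqI[OF skew_abelian assms(1) multiadditive_compose[OF multiadditive_skew_tensor assms(2)]
     multiadditive_compose[OF multiadditive_skew_tensor assms(3)], where B = "\<lambda>_. monomial L ` lists L"])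
    show "A k \<in> generate (add_monoid (skew L)) (monomial L ` lists L)" if "k \<in> {1..m}" for k
      using A that unfolding skew_span[symmetric] tuples_def by auto
    fix A assume A: "A \<in> tuples (skew L) m" and "\<And>k. k \<in> {1..m} \<Longrightarrow> A k \<in> monomial L ` lists L"
    then have "\<forall>k \<in> {1..m}. \<exists>w. w \<in> lists L \<and> A k = monomial L w" by blast
    then obtain W where W: "\<forall>k \<in> {1..m}. W k \<in> lists L \<and> A k = monomial L (W k)" by metis
    then have "A = (\<lambda>k \<in> {1..m}. monomial L (W k))"
      using A unfolding tuples_def by (intro extensionalityI[where A = "{1..m}"]) (auto simp: PiE_iff)
    then show "f (tensor (skew L) m A) = g (tensor (skew L) m A)"
      using eq[of W] W by (simp add: monomial_tensor_def words_on_def)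
  qed (use A in auto)
  moreover have "u \<in> generate (tensor_group (skew L) m) (tensor (skew L) m ` tuples (skew L) m)"
    using u tensor_span[OF skew_abelian] by blast
  moreover have "tensor (skew L) m ` tuples (skew L) m \<subseteq> carrier (tensor_group (skew L) m)"
    using tensor_closed[OF skew_abelian] by blast
  ultimately show ?thesis
    using hom_eq_on_generate[OF T.is_group assms(1-3)] by blast
qed

section \<open>Separating the places of a word\<close>

definition place_part :: "nat \<Rightarrow> ('a \<times> nat) list \<Rightarrow> 'a list" where
  "place_part k w = map fst (filter (\<lambda>p. snd p = k) w)"

abbreviation place_descent :: "'a \<times> nat \<Rightarrow> 'a \<times> nat \<Rightarrow> bool" where
  "place_descent p q \<equiv> snd q < snd p"

abbreviation labelled :: "nat \<Rightarrow> 'a list \<Rightarrow> ('a \<times> nat) list" where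
  "labelled k w \<equiv> map (\<lambda>x. (x, k)) w"

definition block_word :: "(nat \<Rightarrow> 'a list) \<Rightarrow> nat list \<Rightarrow> ('a \<times> nat) list" where
  "block_word W ks = concat (map (\<lambda>k. labelled k (W k)) ks)"

text \<open>The word \<open>W\<^sub>1 \<dots> W\<^sub>m\<close>, the letters of \<open>W\<^sub>k\<close> being taken at place \<open>k\<close>.\<close>

definition place_word :: "nat \<Rightarrow> (nat \<Rightarrow> 'a list) \<Rightarrow> ('a \<times> nat) list" where
  "place_word m W = block_word W [1..<Suc m]"

lemma place_part_append: "place_part k (v @ w) = place_part k v @ place_part k w"
  by (simp add: place_part_def)

lemma place_part_lists: "w \<in> lists (L \<times> {1..m}) \<Longrightarrow> place_part k w \<in> lists L"
  by (auto simp: place_part_def in_lists_conv_set)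

lemma place_part_labelled: "place_part k (map (\<lambda>x. (x, l)) w) = (if k = l then w else [])"
  by (simp add: place_part_def filter_map comp_def)

lemma set_block_word: "p \<in> set (block_word W ks) \<Longrightarrow> snd p \<in> set ks"
  by (auto simp: block_word_def)

lemma place_part_block_word:
  "distinct ks \<Longrightarrow> place_part k (block_word W ks) = (if k \<in> set ks then W k else [])"
  by (induction ks) (auto simp: block_word_def place_part_append place_part_labelled, simp add: place_part_def)

lemma length_filter_block_word:
  "distinct ks \<Longrightarrow> length (filter (\<lambda>p. Q (snd p)) (block_word W ks)) = (\<Sum>k \<in> {k \<in> set ks. Q k}. length (W k))"
proof -
  assume ks: "distinct ks"
  have "length (filter (\<lambda>p. Q (snd p)) (block_word W ks)) = (\<Sum>k\<leftarrow>ks. if Q k then length (W k) else 0)"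
    by (induction ks) (simp_all add: block_word_def filter_map comp_def)
  also have "\<dots> = (\<Sum>k \<in> set ks. if Q k then length (W k) else 0)"
    using ks by (rule sum_list_distinct_conv_sum_set)
  also have "\<dots> = (\<Sum>k \<in> {k \<in> set ks. Q k}. length (W k))"
    by (rule sum.inter_filter[symmetric]) simp
  finally show ?thesis .
qed

lemma inversions_block_word: "sorted ks \<Longrightarrow> inversions place_descent (block_word W ks) = 0"
proof -
  assume "sorted ks"
  then have "sorted (map snd (block_word W ks))"
    by (induction ks) (auto simp: block_word_def sorted_append comp_def map_replicate_const)
  then show ?thesis using inversions_sorted[of "map snd (block_word W ks)"] by (simp add: inversions_map)
qed

lemma place_part_word: "k \<in> {1..m} \<Longrightarrow> place_part k (place_word m W) = W k"
  by (simp add: place_word_def place_part_block_word del: upt_Suc)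

lemma inversions_place_word: "inversions place_descent (place_word m W) = 0"
  unfolding place_word_def by (rule inversions_block_word) (rule sorted_upt)

lemma place_word_lists: "W \<in> words_on L m \<Longrightarrow> place_word m W \<in> lists (L \<times> {1..m})"
  by (auto simp: place_word_def block_word_def words_on_def in_lists_conv_set simp del: upt_Suc)

text \<open>This is the exponent in the sign rule of the graded tensor product.\<close>

lemma crossings_place_words:
  "crossings place_descent (place_word m W) (place_word m V) =
     (\<Sum>k \<in> {1..m}. \<Sum>l \<in> {1..<k}. length (W k) * length (V l))"
proof -
  have f: "length (filter (\<lambda>q. snd q < k) (place_word m V)) = (\<Sum>l \<in> {1..<k}. length (V l))"
    if "k \<in> {1..m}" for k
    unfolding place_word_def length_filter_block_word[OF distinct_upt, where Q = "\<lambda>l. l < k"]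
    by (rule sum.cong) (use that in auto)
  have "(\<Sum>p\<leftarrow>concat (map (\<lambda>k. map (\<lambda>x. (x, k)) (W k)) ks). g (snd p)) = (\<Sum>k\<leftarrow>ks. length (W k) * g k)"
    for ks and g :: "nat \<Rightarrow> nat"
    by (induction ks) (simp_all add: comp_def sum_list_triv)
  then have "crossings place_descent (place_word m W) (place_word m V) =
     (\<Sum>k\<leftarrow>[1..<Suc m]. length (W k) * length (filter (\<lambda>q. snd q < k) (place_word m V)))"
    unfolding crossings_def by (subst (1) place_word_def, unfold block_word_def)
  also have "\<dots> = (\<Sum>k \<in> {1..m}. length (W k) * length (filter (\<lambda>q. snd q < k) (place_word m V)))"
    by (simp add: sum_list_distinct_conv_sum_set atLeastLessThanSuc_atLeastAtMost del: upt_Suc)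
  finally show ?thesis by (simp add: f sum_distrib_left)
qed

text \<open>The image of a word under \<open>\<Phi>\<close>. The exponent counts the exchanges of letters at different places that
  sort the word by places without disturbing the order at any place.\<close>

definition word_tensor ::
  "'a set \<Rightarrow> nat \<Rightarrow> ('a \<times> nat) list \<Rightarrow> ((nat \<Rightarrow> ('a list \<Rightarrow>\<^sub>0 int) set) \<Rightarrow>\<^sub>0 int) set" where
  "word_tensor L m w = monomial_tensor L m (\<lambda>k. place_part k w)
     [^]\<^bsub>tensor_group (skew L) m\<^esub> ((-1 :: int) ^ inversions place_descent w)"

text \<open>The exchange of two adjacent letters at the same place exchanges them in one tensor factor; if their
  places differ, no tensor factor changes, but the parity of the number of descents does.\<close>

lemma separation_hom:
  obtains F where "F \<in> hom (add_monoid (letterplace L m)) (tensor_group (skew L) m)"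
    "\<And>w. w \<in> lists (L \<times> {1..m}) \<Longrightarrow> F (monomial (L \<times> {1..m}) w) = word_tensor L m w"
proof -
  let ?T = "tensor_group (skew L) m"
  interpret T: comm_group ?T by (rule skew_tensor_comm_group)
  have parts: "(\<lambda>k. place_part k w) \<in> words_on L m" if "w \<in> lists (L \<times> {1..m})" for w
    using place_part_lists[OF that] by (simp add: words_on_def)
  note closed = monomial_tensor_closed[OF parts]
  have g1: "word_tensor L m w \<in> carrier ?T" if "w \<in> lists (L \<times> {1..m})" for w
    using closed[OF that] by (simp add: word_tensor_def)
  have split: "(\<lambda>l. place_part l (v @ [p, q] @ w)) =
      (\<lambda>l. place_part l (v @ w))(snd p := place_part (snd p) v @ [fst p, fst q] @ place_part (snd p) w)"
    if "snd p = snd q" for v w and p q :: "'a \<times> nat"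
    using that by (auto simp: place_part_def)
  have g2: "word_tensor L m (v @ [p, q] @ w) \<otimes>\<^bsub>?T\<^esub> word_tensor L m (v @ [q, p] @ w) = \<one>\<^bsub>?T\<^esub>"
    if vw: "v \<in> lists (L \<times> {1..m})" "w \<in> lists (L \<times> {1..m})" and pq: "p \<in> L \<times> {1..m}" "q \<in> L \<times> {1..m}"
    for v w p q
  proof (cases "snd p = snd q")
    case True
    let ?s = "(-1 :: int) ^ inversions place_descent (v @ [p, q] @ w)"
    have s: "(-1 :: int) ^ inversions place_descent (v @ [q, p] @ w) = ?s"
      using inversions_swap_adjacent[of place_descent v p q w] True by simp
    let ?t = "monomial_tensor L m (\<lambda>k. place_part k (v @ [p, q] @ w))"
    have t: "?t \<in> carrier ?T" using vw pq by (intro closed) simp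
    have "monomial_tensor L m (\<lambda>k. place_part k (v @ [q, p] @ w)) = inv\<^bsub>?T\<^esub> ?t"
      unfolding split[OF True] split[OF True[symmetric]] True
      using vw pq by (intro monomial_tensor_swap parts place_part_lists[where m = m]) auto
    then show ?thesis
      unfolding word_tensor_def s using t by (simp add: T.int_pow_inv)
  next
    case False
    have "(\<lambda>k. place_part k (v @ [q, p] @ w)) = (\<lambda>k. place_part k (v @ [p, q] @ w))"
      using False by (auto simp: place_part_def)
    moreover have "monomial_tensor L m (\<lambda>k. place_part k (v @ [p, q] @ w)) \<in> carrier ?T"
      using vw pq by (intro closed) simp
    moreover have "(-1 :: int) ^ inversions place_descent (v @ [p, q] @ w) =
        - ((-1) ^ inversions place_descent (v @ [q, p] @ w))"
      by (rule inversion_sign_swap) (use False in auto)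
    ultimately show ?thesis
      unfolding word_tensor_def by (simp add: T.int_pow_neg)
  qed
  have g3: "word_tensor L m (v @ [p, p] @ w) = \<one>\<^bsub>?T\<^esub>"
    if vw: "v \<in> lists (L \<times> {1..m})" "w \<in> lists (L \<times> {1..m})" and p: "p \<in> L \<times> {1..m}" for v w p
  proof -
    have "monomial_tensor L m (\<lambda>k. place_part k (v @ [p, p] @ w)) = \<one>\<^bsub>?T\<^esub>"
      unfolding split[OF refl]
      using vw p by (intro monomial_tensor_square parts place_part_lists[where m = m]) auto
    then show ?thesis by (simp add: word_tensor_def)
  qed
  show thesis
    using T.skew_lift[of "L \<times> {1..m}" "word_tensor L m", OF g1 g2 g3] that
    unfolding letterplace_def by blast
qed

section \<open>The graded product\<close>

text \<open>The inclusion of \<open>skew L\<close> as the subalgebra of letters at place \<open>k\<close>.\<close>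

lemma embedding_hom:
  assumes "k \<in> {1..m}"
  obtains h where "h \<in> hom (add_monoid (skew L)) (add_monoid (letterplace L m))"
    "\<And>w. w \<in> lists L \<Longrightarrow> h (monomial L w) = monomial (L \<times> {1..m}) (map (\<lambda>x. (x, k)) w)"
proof -
  let ?S = "L \<times> {1..m}"
  interpret R: ring "skew ?S" by (rule ring_skew)
  let ?g = "\<lambda>w. monomial ?S (map (\<lambda>x. (x, k)) w)"
  have l: "map (\<lambda>x. (x, k)) w \<in> lists ?S" if "w \<in> lists L" for w
    using that assms by (auto simp: in_lists_conv_set)
  have g1: "?g w \<in> carrier (add_monoid (skew ?S))" if "w \<in> lists L" for w
    using l[OF that] by simp
  have g2: "?g (v @ [x, y] @ w) \<otimes>\<^bsub>add_monoid (skew ?S)\<^esub> ?g (v @ [y, x] @ w) = \<one>\<^bsub>add_monoid (skew ?S)\<^esub>"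
    if "v \<in> lists L" "w \<in> lists L" "x \<in> L" "y \<in> L" for v w x y
  proof -
    have "?g (v @ [y, x] @ w) = \<ominus>\<^bsub>skew ?S\<^esub> ?g (v @ [x, y] @ w)"
      using monomial_swap[OF l[OF that(1)] l[OF that(2)], of "(x, k)" "(y, k)"] that assms by simp
    moreover have "?g (v @ [x, y] @ w) \<in> carrier (skew ?S)"
      using that by (intro monomial_closed l) simp
    ultimately show ?thesis using R.r_neg by simp
  qed
  have g3: "?g (v @ [x, x] @ w) = \<one>\<^bsub>add_monoid (skew ?S)\<^esub>"
    if "v \<in> lists L" "w \<in> lists L" "x \<in> L" for v w x
    using monomial_square_zero[OF l[OF that(1)] l[OF that(2)], of "(x, k)"] that assms by simp
  show thesis
    using comm_group.skew_lift[OF R.a_comm_group, of L ?g, OF g1 g2 g3] that unfolding letterplace_def by blast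
qed


lemma multiadditive_foldr_mult:
  assumes R: "ring R" and h: "\<And>k. k \<in> {1..m} \<Longrightarrow> h k \<in> hom (add_monoid Q) (add_monoid R)"
    and ks: "distinct ks" "set ks = {1..m}"
  shows "multiadditive Q m (add_monoid R) (\<lambda>A. foldr (\<lambda>k u. h k (A k) \<otimes>\<^bsub>R\<^esub> u) ks \<one>\<^bsub>R\<^esub>)"
proof -
  interpret R: ring R by fact
  let ?g = "\<lambda>ks A. foldr (\<lambda>k u. h k (A k) \<otimes>\<^bsub>R\<^esub> u) ks \<one>\<^bsub>R\<^esub>"
  have hc: "h k x \<in> carrier R" if "k \<in> {1..m}" "x \<in> carrier Q" for k x
    using h[OF that(1)] that(2) by (auto simp: hom_def)
  have closed: "?g ks A \<in> carrier R" if "set ks \<subseteq> {1..m}" "A \<in> tuples Q m" for ks A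
    using that by (induction ks) (auto simp: tuples_def intro!: R.m_closed hc)
  have other: "?g ks (A(k := x)) = ?g ks A" if "k \<notin> set ks" for ks A k x
    using that by (induction ks) auto
  have "?g ks (A(k := x \<oplus>\<^bsub>Q\<^esub> y)) = ?g ks (A(k := x)) \<oplus>\<^bsub>R\<^esub> ?g ks (A(k := y))"
    if "distinct ks" "set ks \<subseteq> {1..m}" "k \<in> set ks" and A: "A \<in> tuples Q m" "x \<in> carrier Q" "y \<in> carrier Q"
    for ks A k x y
    using that(1-3)
  proof (induction ks)
    case (Cons l ks)
    have l: "l \<in> {1..m}" using Cons.prems by simp
    show ?case
    proof (cases "l = k")
      case True
      then have "k \<notin> set ks" using Cons.prems by simp
      moreover have "h k (x \<oplus>\<^bsub>Q\<^esub> y) = h k x \<oplus>\<^bsub>R\<^esub> h k y"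
        using hom_mult[OF h[OF l]] A True by simp
      moreover have "?g ks A \<in> carrier R" using Cons.prems A by (intro closed) auto
      ultimately show ?thesis
        using True l A by (simp add: other fun_upd_same R.l_distr hc del: fun_upd_apply)
    next
      case False
      then have k: "k \<in> set ks" "k \<in> {1..m}" using Cons.prems by auto
      then have IH: "?g ks (A(k := x \<oplus>\<^bsub>Q\<^esub> y)) = ?g ks (A(k := x)) \<oplus>\<^bsub>R\<^esub> ?g ks (A(k := y))"
        using Cons by simp
      have "?g ks (A(k := z)) \<in> carrier R" if "z \<in> carrier Q" for z
        using Cons.prems by (intro closed tuples_update[OF A(1) k(2) that]) auto
      moreover have "h l (A l) \<in> carrier R" using A(1) l by (intro hc) (auto simp: tuples_def)
      ultimately show ?thesis using A False IH by (simp add: R.r_distr fun_upd_other del: fun_upd_apply)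
    qed
  qed simp
  then show ?thesis
    unfolding multiadditive_def using closed[of ks] ks by (simp add: Pi_iff)
qed

text \<open>The factors of a tensor are multiplied in the order of their places, after embedding the \<open>k\<close>-th factor
  at place \<open>k\<close>.\<close>

lemma joining_hom:
  obtains \<Psi> where "\<Psi> \<in> hom (tensor_group (skew L) m) (add_monoid (letterplace L m))"
    "\<And>W. W \<in> words_on L m \<Longrightarrow>
       \<Psi> (monomial_tensor L m W) = monomial (L \<times> {1..m}) (place_word m W)"
proof -
  let ?S = "L \<times> {1..m}" and ?P = "letterplace L m"
  interpret P: ring ?P unfolding letterplace_def by (rule ring_skew)
  have "\<forall>k. \<exists>h. k \<in> {1..m} \<longrightarrow> h \<in> hom (add_monoid (skew L)) (add_monoid ?P) \<and>
      (\<forall>w \<in> lists L. h (monomial L w) = monomial ?S (map (\<lambda>x. (x, k)) w))"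
    using embedding_hom[of _ m L] by metis
  then obtain h where "\<forall>k. k \<in> {1..m} \<longrightarrow> h k \<in> hom (add_monoid (skew L)) (add_monoid ?P) \<and>
      (\<forall>w \<in> lists L. h k (monomial L w) = monomial ?S (map (\<lambda>x. (x, k)) w))"
    by (rule choice[THEN exE])
  then have h: "\<And>k. k \<in> {1..m} \<Longrightarrow> h k \<in> hom (add_monoid (skew L)) (add_monoid ?P)"
    and hm: "\<And>k w. k \<in> {1..m} \<Longrightarrow> w \<in> lists L \<Longrightarrow> h k (monomial L w) = monomial ?S (map (\<lambda>x. (x, k)) w)"
    by blast+
  let ?g = "\<lambda>A. foldr (\<lambda>k u. h k (A k) \<otimes>\<^bsub>?P\<^esub> u) [1..<Suc m] \<one>\<^bsub>?P\<^esub>"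
  have "multiadditive (skew L) m (add_monoid ?P) ?g"
    by (rule multiadditive_foldr_mult[OF P.ring_axioms h]) auto
  then obtain \<Psi> where \<Psi>: "\<Psi> \<in> hom (tensor_group (skew L) m) (add_monoid ?P)"
    and \<Psi>g: "\<And>A. A \<in> tuples (skew L) m \<Longrightarrow> \<Psi> (tensor (skew L) m A) = ?g A"
    using tensor_lift[OF skew_abelian P.a_comm_group] by blast
  have fold: "foldr (\<lambda>k u. h k (A k) \<otimes>\<^bsub>?P\<^esub> u) ks \<one>\<^bsub>?P\<^esub> =
      monomial ?S (concat (map (\<lambda>k. map (\<lambda>x. (x, k)) (W k)) ks))"
    if W: "W \<in> words_on L m" and A: "\<And>k. k \<in> {1..m} \<Longrightarrow> A k = monomial L (W k)"
      and "set ks \<subseteq> {1..m}" for A W ks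
    using that(3)
  proof (induction ks)
    case Nil then show ?case by (simp add: monomial_Nil letterplace_def)
  next
    case (Cons k ks)
    have "map (\<lambda>x. (x, k)) (W k) \<in> lists ?S" "concat (map (\<lambda>k. map (\<lambda>x. (x, k)) (W k)) ks) \<in> lists ?S"
      using W Cons.prems by (auto simp: words_on_def in_lists_conv_set)
    then show ?case
      using Cons W by (simp add: A hm words_on_def letterplace_def monomial_append)
  qed
  show thesis
  proof (rule that[OF \<Psi>])
    show "\<Psi> (monomial_tensor L m W) = monomial ?S (place_word m W)" if "W \<in> words_on L m" for W
      unfolding monomial_tensor_def \<Psi>g[OF monomial_tuple[OF that]] place_word_def block_word_def
      by (rule fold[OF that]) (auto simp del: upt_Suc)
  qed
qed

(* Keeps index ranges such as {1..m} unchanged, so that facts about them apply. *)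
declare One_nat_def [simp del]

lemma multiadditive_mult:
  assumes "ring R" and B: "B \<in> tuples R m"
  shows "multiadditive R m (tensor_group R m) (\<lambda>A. tensor R m (\<lambda>k \<in> {1..m}. A k \<otimes>\<^bsub>R\<^esub> B k))"
    and "multiadditive R m (tensor_group R m) (\<lambda>A. tensor R m (\<lambda>k \<in> {1..m}. B k \<otimes>\<^bsub>R\<^esub> A k))"
proof -
  interpret ring R by fact
  have B': "B k \<in> carrier R" if "k \<in> {1..m}" for k using B that by (auto simp: tuples_def)
  have tup: "(\<lambda>k \<in> {1..m}. A k \<otimes>\<^bsub>R\<^esub> B k) \<in> tuples R m" "(\<lambda>k \<in> {1..m}. B k \<otimes>\<^bsub>R\<^esub> A k) \<in> tuples R m"
    if "A \<in> tuples R m" for A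
    using B that by (auto simp: tuples_def)
  have T: "tensor R m (A(k := x \<oplus>\<^bsub>R\<^esub> y)) = tensor R m (A(k := x)) \<otimes>\<^bsub>tensor_group R m\<^esub> tensor R m (A(k := y))"
    if "A \<in> tuples R m" "k \<in> {1..m}" "x \<in> carrier R" "y \<in> carrier R" for A k x y
    using multiadditive_tensor[OF is_abelian_group, of m] that by (simp add: multiadditive_def)
  have upd: "(\<lambda>l \<in> {1..m}. (A(k := x)) l \<otimes>\<^bsub>R\<^esub> B l) = (\<lambda>l \<in> {1..m}. A l \<otimes>\<^bsub>R\<^esub> B l)(k := x \<otimes>\<^bsub>R\<^esub> B k)"
     "(\<lambda>l \<in> {1..m}. B l \<otimes>\<^bsub>R\<^esub> (A(k := x)) l) = (\<lambda>l \<in> {1..m}. B l \<otimes>\<^bsub>R\<^esub> A l)(k := B k \<otimes>\<^bsub>R\<^esub> x)"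
    if "k \<in> {1..m}" for A k x using that by (auto simp: fun_eq_iff)
  show "multiadditive R m (tensor_group R m) (\<lambda>A. tensor R m (\<lambda>k \<in> {1..m}. A k \<otimes>\<^bsub>R\<^esub> B k))"
    unfolding multiadditive_def using tensor_closed[OF is_abelian_group] tup(1)
    by (simp add: Pi_iff upd l_distr B' T del: fun_upd_apply)
  show "multiadditive R m (tensor_group R m) (\<lambda>A. tensor R m (\<lambda>k \<in> {1..m}. B k \<otimes>\<^bsub>R\<^esub> A k))"
    unfolding multiadditive_def using tensor_closed[OF is_abelian_group] tup(2)
    by (simp add: Pi_iff upd r_distr B' T del: fun_upd_apply)
qed

lemma skew_homogeneous_span:
  "skew_homogeneous L d \<subseteq> generate (add_monoid (skew L)) (monomial L ` {w \<in> lists L. length w = d})"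
  unfolding skew_homogeneous_def
proof (rule image_subsetI)
  fix f assume "f \<in> {f \<in> carrier (free_algebra L). \<forall>w \<in> Poly_Mapping.keys f. length w = d}"
  then have "Poly_Mapping.keys f \<subseteq> {w \<in> lists L. length w = d}"
    by (auto simp: free_algebra_simps)
  then show "skew_class L f \<in> generate (add_monoid (skew L)) (monomial L ` {w \<in> lists L. length w = d})"
    by (rule skew_class_in_span) blast
qed

lemma monomial_homogeneous: "w \<in> lists L \<Longrightarrow> monomial L w \<in> skew_homogeneous L (length w)"
  by (auto simp: skew_homogeneous_def monomial_def free_algebra_simps keys_frag_of)

lemma (in comm_group) int_pow_hom: "(\<lambda>x. x [^] (n :: int)) \<in> hom G G"
  by (auto simp: hom_def int_pow_distrib)

text \<open>The property that specifies the product of the graded tensor power of \<open>skew L\<close>.\<close>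

definition graded_bimult ::
  "'a set \<Rightarrow> nat \<Rightarrow> (((nat \<Rightarrow> ('a list \<Rightarrow>\<^sub>0 int) set) \<Rightarrow>\<^sub>0 int) set
     \<times> ((nat \<Rightarrow> ('a list \<Rightarrow>\<^sub>0 int) set) \<Rightarrow>\<^sub>0 int) set
     \<Rightarrow> ((nat \<Rightarrow> ('a list \<Rightarrow>\<^sub>0 int) set) \<Rightarrow>\<^sub>0 int) set) \<Rightarrow> bool" where
  "graded_bimult L m M \<longleftrightarrow> (let G = tensor_group (skew L) m in
      M \<in> (carrier G \<times> carrier G \<rightarrow>\<^sub>E carrier G)
        \<and> (\<forall>u \<in> carrier G. (\<lambda>v. M (u, v)) \<in> hom G G)
        \<and> (\<forall>v \<in> carrier G. (\<lambda>u. M (u, v)) \<in> hom G G)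
        \<and> (\<forall>A \<in> tuples (skew L) m. \<forall>B \<in> tuples (skew L) m. \<forall>a b.
             (\<forall>k \<in> {1..m}. A k \<in> skew_homogeneous L (a k) \<and> B k \<in> skew_homogeneous L (b k)) \<longrightarrow>
             M (tensor (skew L) m A, tensor (skew L) m B) =
               tensor (skew L) m (\<lambda>k \<in> {1..m}. A k \<otimes>\<^bsub>skew L\<^esub> B k)
                 [^]\<^bsub>G\<^esub> ((-1 :: int) ^ (\<Sum>k \<in> {1..m}. \<Sum>l \<in> {1..<k}. a k * b l))))"

lemma graded_bimult_monomial:
  assumes M: "graded_bimult L m M" and W: "W \<in> words_on L m" and V: "V \<in> words_on L m"
  shows "M (monomial_tensor L m W, monomial_tensor L m V) =
    monomial_tensor L m (\<lambda>k. W k @ V k) [^]\<^bsub>tensor_group (skew L) m\<^esub>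
      ((-1 :: int) ^ (\<Sum>k \<in> {1..m}. \<Sum>l \<in> {1..<k}. length (W k) * length (V l)))"
proof -
  let ?A = "\<lambda>W. \<lambda>k \<in> {1..m}. monomial L (W k)"
  have prod: "(\<lambda>k \<in> {1..m}. ?A W k \<otimes>\<^bsub>skew L\<^esub> ?A V k) = ?A (\<lambda>k. W k @ V k)"
    using W V by (intro ext) (simp add: restrict_def words_on_def monomial_append)
  have homogeneous: "\<forall>k \<in> {1..m}. ?A W k \<in> skew_homogeneous L (length (W k)) \<and>
      ?A V k \<in> skew_homogeneous L (length (V k))"
    using W V by (auto simp: words_on_def intro: monomial_homogeneous)
  have "M (tensor (skew L) m (?A W), tensor (skew L) m (?A V)) =
      tensor (skew L) m (\<lambda>k \<in> {1..m}. ?A W k \<otimes>\<^bsub>skew L\<^esub> ?A V k) [^]\<^bsub>tensor_group (skew L) m\<^esub>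
        ((-1 :: int) ^ (\<Sum>k \<in> {1..m}. \<Sum>l \<in> {1..<k}. length (W k) * length (V l)))"
    using M[unfolded graded_bimult_def Let_def, THEN conjunct2, THEN conjunct2, THEN conjunct2,
      rule_format, OF monomial_tuple[OF W] monomial_tuple[OF V] homogeneous[rule_format]] .
  then show ?thesis unfolding prod monomial_tensor_def .
qed

lemma graded_bimult_unique:
  assumes M: "graded_bimult L m M" and N: "graded_bimult L m N"
  shows "M = N"
proof -
  let ?T = "tensor_group (skew L) m"
  interpret T: comm_group ?T by (rule skew_tensor_comm_group)
  have hom: "(\<lambda>v. K (u, v)) \<in> hom ?T ?T" "(\<lambda>v. K (v, u)) \<in> hom ?T ?T"
    if "graded_bimult L m K" "u \<in> carrier ?T" for K u
    using that by (simp_all add: graded_bimult_def Let_def)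
  have 1: "M (monomial_tensor L m W, v) = N (monomial_tensor L m W, v)"
    if W: "W \<in> words_on L m" and v: "v \<in> carrier ?T" for W v
    by (rule hom_eq_on_monomial_tensors[OF T.is_group hom(1)[OF M] hom(1)[OF N] _ v])
       (simp_all add: monomial_tensor_closed[OF W] graded_bimult_monomial[OF M W] graded_bimult_monomial[OF N W])
  have 2: "M (u, v) = N (u, v)" if "u \<in> carrier ?T" "v \<in> carrier ?T" for u v
    by (rule hom_eq_on_monomial_tensors[OF T.is_group hom(2)[OF M that(2)] hom(2)[OF N that(2)] _ that(1)])
       (simp add: 1 that)
  show ?thesis
    by (rule PiE_ext[where k = "carrier ?T \<times> carrier ?T" and s = "\<lambda>_. carrier ?T"])
       (use M N 2 in \<open>auto simp: graded_bimult_def Let_def\<close>)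
qed

text \<open>The product is carried over from the letterplace algebra: join both arguments to elements of that
  algebra, multiply there, and separate the places again. Bilinearity is then clear. The sign rule for
  homogeneous elements is additive in each slot, which reduces it to monomials. For these, the concatenation
  of two sorted words has as many descents as there are pairs of a letter of the first word and a
  letter of the second word at a lower place.\<close>

lemma graded_bimult_exists: "\<exists>M. graded_bimult L m M"
proof -
  let ?S = "L \<times> {1..m}" and ?P = "letterplace L m" and ?T = "tensor_group (skew L) m"
  interpret P: ring ?P unfolding letterplace_def by (rule ring_skew)
  interpret R: ring "skew L" by (rule ring_skew)
  interpret T: comm_group ?T by (rule skew_tensor_comm_group)
  obtain F where F: "F \<in> hom (add_monoid ?P) ?T"
    and Fw: "\<And>w. w \<in> lists ?S \<Longrightarrow> F (monomial ?S w) = word_tensor L m w"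
    using separation_hom by blast
  obtain \<Psi> where \<Psi>: "\<Psi> \<in> hom ?T (add_monoid ?P)"
    and \<Psi>W: "\<And>W. W \<in> words_on L m \<Longrightarrow> \<Psi> (monomial_tensor L m W) = monomial ?S (place_word m W)"
    using joining_hom by blast
  define M where "M = (\<lambda>(u, v) \<in> carrier ?T \<times> carrier ?T. F (\<Psi> u \<otimes>\<^bsub>?P\<^esub> \<Psi> v))"
  have \<Psi>c: "\<Psi> u \<in> carrier ?P" if "u \<in> carrier ?T" for u
    using \<Psi> that by (auto simp: hom_def)
  have Fc: "F u \<in> carrier ?T" if "u \<in> carrier ?P" for u
    using F that by (auto simp: hom_def)
  have \<Psi>m: "\<Psi> (u \<otimes>\<^bsub>?T\<^esub> v) = \<Psi> u \<oplus>\<^bsub>?P\<^esub> \<Psi> v" if "u \<in> carrier ?T" "v \<in> carrier ?T" for u v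
    using hom_mult[OF \<Psi> that] by simp
  have Fm: "F (u \<oplus>\<^bsub>?P\<^esub> v) = F u \<otimes>\<^bsub>?T\<^esub> F v" if "u \<in> carrier ?P" "v \<in> carrier ?P" for u v
    using hom_mult[OF F, of u v] that by simp
  have M1: "M \<in> (carrier ?T \<times> carrier ?T \<rightarrow>\<^sub>E carrier ?T)"
    by (auto simp: M_def \<Psi>c Fc)
  have M2: "(\<lambda>v. M (u, v)) \<in> hom ?T ?T" "(\<lambda>v. M (v, u)) \<in> hom ?T ?T" if "u \<in> carrier ?T" for u
    using that by (auto simp: hom_def M_def \<Psi>c \<Psi>m Fm Fc P.l_distr P.r_distr)
  have MW: "M (monomial_tensor L m W, monomial_tensor L m V) =
    monomial_tensor L m (\<lambda>k. W k @ V k) [^]\<^bsub>?T\<^esub>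
      ((-1 :: int) ^ (\<Sum>k \<in> {1..m}. \<Sum>l \<in> {1..<k}. length (W k) * length (V l)))"
    if W: "W \<in> words_on L m" and V: "V \<in> words_on L m" for W V
  proof -
    have "M (monomial_tensor L m W, monomial_tensor L m V) =
        F (monomial ?S (place_word m W @ place_word m V))"
      using that by (simp add: M_def monomial_tensor_closed \<Psi>W letterplace_def monomial_append place_word_lists)
    also have "\<dots> = word_tensor L m (place_word m W @ place_word m V)"
      using place_word_lists[OF W] place_word_lists[OF V] by (intro Fw) simp
    also have "\<dots> = monomial_tensor L m (\<lambda>k. W k @ V k) [^]\<^bsub>?T\<^esub>
      ((-1 :: int) ^ (\<Sum>k \<in> {1..m}. \<Sum>l \<in> {1..<k}. length (W k) * length (V l)))"
    proof -
      have "monomial_tensor L m (\<lambda>k. place_part k (place_word m W @ place_word m V)) =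
          monomial_tensor L m (\<lambda>k. W k @ V k)"
        by (rule monomial_tensor_cong) (simp add: place_part_append place_part_word)
      then show ?thesis
        unfolding word_tensor_def inversions_append inversions_place_word crossings_place_words by simp
    qed
    finally show ?thesis .
  qed
  have MT: "M (tensor (skew L) m A, tensor (skew L) m B) =
      tensor (skew L) m (\<lambda>k \<in> {1..m}. A k \<otimes>\<^bsub>skew L\<^esub> B k) [^]\<^bsub>?T\<^esub> ((-1 :: int) ^ (\<Sum>k \<in> {1..m}. \<Sum>l \<in> {1..<k}. a k * b l))"
    if A: "A \<in> tuples (skew L) m" and B: "B \<in> tuples (skew L) m"
      and Aa: "\<And>k. k \<in> {1..m} \<Longrightarrow> A k \<in> skew_homogeneous L (a k)"
      and Bb: "\<And>k. k \<in> {1..m} \<Longrightarrow> B k \<in> skew_homogeneous L (b k)" for A B a b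
  proof -
    let ?n = "(-1 :: int) ^ (\<Sum>k \<in> {1..m}. \<Sum>l \<in> {1..<k}. a k * b l)"
    let ?Z = "\<lambda>d. monomial L ` {w \<in> lists L. length w = d}"
    let ?val = "\<lambda>A B. tensor (skew L) m (\<lambda>k \<in> {1..m}. A k \<otimes>\<^bsub>skew L\<^esub> B k) [^]\<^bsub>?T\<^esub> ?n"
    note ma = multiadditive_compose[OF multiadditive_skew_tensor]
      multiadditive_compose[OF multiadditive_mult(1)[OF ring_skew] T.int_pow_hom]
      multiadditive_compose[OF multiadditive_mult(2)[OF ring_skew] T.int_pow_hom]
    \<comment> \<open>A tuple of monomials of prescribed degrees is spelled by a tuple of words of these lengths.\<close>
    have words: "\<exists>W \<in> words_on L m. C = (\<lambda>k \<in> {1..m}. monomial L (W k)) \<and> (\<forall>k \<in> {1..m}. length (W k) = c k)"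
      if "C \<in> tuples (skew L) m" "\<And>k. k \<in> {1..m} \<Longrightarrow> C k \<in> ?Z (c k)" for C c
    proof -
      have "\<forall>k \<in> {1..m}. \<exists>w. w \<in> lists L \<and> length w = c k \<and> C k = monomial L w" using that(2) by blast
      then obtain W where W: "\<forall>k \<in> {1..m}. W k \<in> lists L \<and> length (W k) = c k \<and> C k = monomial L (W k)" by metis
      then have "C = (\<lambda>k \<in> {1..m}. monomial L (W k))"
        using that(1) unfolding tuples_def by (intro extensionalityI[where A = "{1..m}"]) (auto simp: PiE_iff)
      then show ?thesis using W by (auto simp: words_on_def)
    qed
    have base: "M (tensor (skew L) m A, tensor (skew L) m B) = ?val A B"
      if A: "A \<in> tuples (skew L) m" "\<And>k. k \<in> {1..m} \<Longrightarrow> A k \<in> ?Z (a k)"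
        and B: "B \<in> tuples (skew L) m" "\<And>k. k \<in> {1..m} \<Longrightarrow> B k \<in> ?Z (b k)" for A B
    proof -
      obtain W where W: "W \<in> words_on L m" "A = (\<lambda>k \<in> {1..m}. monomial L (W k))" "\<forall>k \<in> {1..m}. length (W k) = a k"
        using words[OF A] by blast
      obtain V where V: "V \<in> words_on L m" "B = (\<lambda>k \<in> {1..m}. monomial L (V k))" "\<forall>k \<in> {1..m}. length (V k) = b k"
        using words[OF B] by blast
      have "(\<lambda>k \<in> {1..m}. A k \<otimes>\<^bsub>skew L\<^esub> B k) = (\<lambda>k \<in> {1..m}. monomial L (W k @ V k))"
        using W V by (intro ext) (simp add: restrict_def words_on_def monomial_append)
      moreover have "(\<Sum>k \<in> {1..m}. \<Sum>l \<in> {1..<k}. length (W k) * length (V l)) =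
          (\<Sum>k \<in> {1..m}. \<Sum>l \<in> {1..<k}. a k * b l)"
        by (intro sum.cong refl) (use W V in auto)
      ultimately show ?thesis
        using MW[OF W(1) V(1)] by (simp add: monomial_tensor_def W(2) V(2))
    qed
    have Z: "?Z d \<subseteq> carrier (skew L)" for d by auto
    have step: "M (tensor (skew L) m A, tensor (skew L) m B) = ?val A B"
      if A: "A \<in> tuples (skew L) m" "\<And>k. k \<in> {1..m} \<Longrightarrow> A k \<in> skew_homogeneous L (a k)"
        and B: "B \<in> tuples (skew L) m" "\<And>k. k \<in> {1..m} \<Longrightarrow> B k \<in> ?Z (b k)" for A B
    proof (rule multiadditive_eqI[OF skew_abelian T.is_group,
          where f = "\<lambda>A. M (tensor (skew L) m A, tensor (skew L) m B)" and g = "\<lambda>A. ?val A B" and B = "\<lambda>k. ?Z (a k)"])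
      show "multiadditive (skew L) m ?T (\<lambda>A. M (tensor (skew L) m A, tensor (skew L) m B))"
        by (rule ma(1)[OF M2(2)[OF tensor_closed[OF skew_abelian B(1)]]])
      show "multiadditive (skew L) m ?T (\<lambda>A. ?val A B)" by (rule ma(2)[OF B(1)])
      show "?Z (a k) \<subseteq> carrier (skew L)" for k by (rule Z)
      show "M (tensor (skew L) m A, tensor (skew L) m B) = ?val A B"
        if "A \<in> tuples (skew L) m" "\<And>k. k \<in> {1..m} \<Longrightarrow> A k \<in> ?Z (a k)" for A
        by (rule base[OF that B])
      show "A k \<in> generate (add_monoid (skew L)) (?Z (a k))" if "k \<in> {1..m}" for k
        by (rule subsetD[OF skew_homogeneous_span A(2)[OF that]])
    qed (rule A(1))
    show ?thesis
    proof (rule multiadditive_eqI[OF skew_abelian T.is_group,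
          where f = "\<lambda>B. M (tensor (skew L) m A, tensor (skew L) m B)" and g = "\<lambda>B. ?val A B" and B = "\<lambda>k. ?Z (b k)"])
      show "multiadditive (skew L) m ?T (\<lambda>B. M (tensor (skew L) m A, tensor (skew L) m B))"
        by (rule ma(1)[OF M2(1)[OF tensor_closed[OF skew_abelian A]]])
      show "multiadditive (skew L) m ?T (\<lambda>B. ?val A B)" by (rule ma(3)[OF A])
      show "?Z (b k) \<subseteq> carrier (skew L)" for k by (rule Z)
      show "M (tensor (skew L) m A, tensor (skew L) m B) = ?val A B"
        if "B \<in> tuples (skew L) m" "\<And>k. k \<in> {1..m} \<Longrightarrow> B k \<in> ?Z (b k)" for B
        by (rule step[OF A Aa that])
      show "B k \<in> generate (add_monoid (skew L)) (?Z (b k))" if "k \<in> {1..m}" for k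
        by (rule subsetD[OF skew_homogeneous_span Bb[OF that]])
    qed (rule B)
  qed
  show ?thesis
    unfolding graded_bimult_def Let_def
    by (intro exI[of _ M] conjI ballI allI impI M1 M2 MT) blast+
qed

lemma graded_bimult_skew_tensor:
  "graded_bimult L m (graded_tensor_mult (skew L) (skew_homogeneous L) m)"
proof -
  have "\<exists>!M. graded_bimult L m M"
    using graded_bimult_exists graded_bimult_unique by blast
  from theI'[OF this] show ?thesis
    unfolding graded_tensor_mult_def Let_def graded_bimult_def .
qed

lemma skew_tensor_simps:
  "carrier (skew_tensor L m) = carrier (tensor_group (skew L) m)"
  "u \<otimes>\<^bsub>skew_tensor L m\<^esub> v = graded_tensor_mult (skew L) (skew_homogeneous L) m (u, v)"
  "\<one>\<^bsub>skew_tensor L m\<^esub> = monomial_tensor L m (\<lambda>k. [])"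
  "\<zero>\<^bsub>skew_tensor L m\<^esub> = \<one>\<^bsub>tensor_group (skew L) m\<^esub>"
  "add (skew_tensor L m) = monoid.mult (tensor_group (skew L) m)"
  by (simp_all add: skew_tensor_def graded_tensor_power_def monomial_tensor_def monomial_Nil)

lemma add_monoid_skew_tensor: "add_monoid (skew_tensor L m) = tensor_group (skew L) m"
  by (simp add: skew_tensor_simps tensor_group_def FactGroup_def)

section \<open>The isomorphism on words\<close>

text \<open>The argument is an induction on the word: a letter at place \<open>i\<close> in front of a word passes all its
  letters at lower places, and this is at the same time the sign rule of the graded product and the
  number of new descents.\<close>

lemma iso_on_words:
  assumes \<Phi>: "\<Phi> \<in> ring_iso (letterplace L m) (skew_tensor L m)"
    and letter: "\<And>x i. x \<in> L \<Longrightarrow> i \<in> {1..m} \<Longrightarrow>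
           \<Phi> (letter L m x i) = tensor (skew L) m
             (\<lambda>k \<in> {1..m}. if k = i then monomial L [x] else \<one>\<^bsub>skew L\<^esub>)"
    and "w \<in> lists (L \<times> {1..m})"
  shows "\<Phi> (monomial (L \<times> {1..m}) w) = word_tensor L m w"
  using assms(3)
proof (induction w)
  let ?S = "L \<times> {1..m}" and ?T = "tensor_group (skew L) m"
  interpret T: comm_group ?T by (rule skew_tensor_comm_group)
  case Nil
  have "\<Phi> (monomial ?S []) = monomial_tensor L m (\<lambda>k. [])"
    using ring_hom_one[of \<Phi> "letterplace L m" "skew_tensor L m"] \<Phi> by (simp add: ring_iso_def monomial_Nil letterplace_def skew_tensor_simps)
  moreover have "monomial_tensor L m (\<lambda>k. []) \<in> carrier ?T"
    by (rule monomial_tensor_closed) (simp add: words_on_def)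
  ultimately show ?case by (simp add: word_tensor_def place_part_def)
next
  let ?S = "L \<times> {1..m}" and ?T = "tensor_group (skew L) m"
  let ?M = "graded_tensor_mult (skew L) (skew_homogeneous L) m"
  interpret T: comm_group ?T by (rule skew_tensor_comm_group)
  case (Cons p w)
  obtain x i where p: "p = (x, i)" "x \<in> L" "i \<in> {1..m}" using Cons.hyps by (cases p) auto
  have w: "w \<in> lists ?S" using Cons.hyps by simp
  let ?V = "\<lambda>k. if k = i then [x] else []" and ?W = "\<lambda>k. place_part k w"
  let ?s = "(-1 :: int) ^ inversions place_descent w"
  have V: "?V \<in> words_on L m" and W: "?W \<in> words_on L m"
    using p place_part_lists[OF w] by (auto simp: words_on_def)
  have "(\<lambda>k \<in> {1..m}. if k = i then monomial L [x] else \<one>\<^bsub>skew L\<^esub>) = (\<lambda>k \<in> {1..m}. monomial L (?V k))"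
    by (intro ext) (simp add: restrict_def monomial_Nil)
  then have 1: "\<Phi> (monomial ?S [p]) = monomial_tensor L m ?V"
    using letter[OF p(2,3)] by (simp add: letter_def p(1) monomial_tensor_def)
  have M: "(\<lambda>v. ?M (monomial_tensor L m ?V, v)) \<in> hom ?T ?T"
    using graded_bimult_skew_tensor[of L m] monomial_tensor_closed[OF V]
    by (simp add: graded_bimult_def Let_def)
  interpret M: group_hom ?T ?T "\<lambda>v. ?M (monomial_tensor L m ?V, v)"
    by (rule group_homI[OF T.is_group T.is_group M])
  have e: "(\<Sum>k \<in> {1..m}. \<Sum>l \<in> {1..<k}. length (?V k) * length (?W l)) = length (filter (place_descent p) w)"
  proof -
    have "(\<Sum>k \<in> {1..m}. \<Sum>l \<in> {1..<k}. length (?V k) * length (?W l)) =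
        (\<Sum>k \<in> {1..m}. if k = i then \<Sum>l \<in> {1..<i}. length (?W l) else 0)"
      by (intro sum.cong) auto
    also have "\<dots> = (\<Sum>l \<in> {1..<i}. length (?W l))" using p by simp
    also have "\<dots> = length (filter (place_descent p) w)"
      using w unfolding p(1)
    proof (induction w)
      case (Cons q w)
      obtain y j where q: "q = (y, j)" "j \<ge> 1" using Cons.hyps by (cases q) auto
      have "(\<Sum>l \<in> {1..<i}. length (place_part l (q # w))) =
          (\<Sum>l \<in> {1..<i}. (if l = j then 1 else 0) + length (place_part l w))"
        by (intro sum.cong) (auto simp: place_part_def q)
      also have "\<dots> = (if j < i then 1 else 0) + (\<Sum>l \<in> {1..<i}. length (place_part l w))"
        using q(2) by (simp add: sum.distrib)
      finally show ?case using Cons q by simp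
    qed (simp add: place_part_def)
    finally show ?thesis .
  qed
  have "monomial ?S (p # w) = monomial ?S [p] \<otimes>\<^bsub>letterplace L m\<^esub> monomial ?S w"
    using monomial_append[of "[p]" ?S w] w Cons.hyps by (simp add: letterplace_def)
  then have "\<Phi> (monomial ?S (p # w)) = \<Phi> (monomial ?S [p]) \<otimes>\<^bsub>skew_tensor L m\<^esub> \<Phi> (monomial ?S w)"
    using \<Phi> w Cons.hyps ring_hom_mult[of \<Phi> "letterplace L m" "skew_tensor L m"]
    by (simp add: ring_iso_def letterplace_def)
  also have "\<dots> = ?M (monomial_tensor L m ?V, monomial_tensor L m ?W [^]\<^bsub>?T\<^esub> ?s)"
    using Cons.IH by (simp add: 1 skew_tensor_simps word_tensor_def)
  also have "\<dots> = ?M (monomial_tensor L m ?V, monomial_tensor L m ?W) [^]\<^bsub>?T\<^esub> ?s"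
    by (rule M.hom_int_pow[OF monomial_tensor_closed[OF W]])
  also have "\<dots> = (monomial_tensor L m (\<lambda>k. ?V k @ ?W k) [^]\<^bsub>?T\<^esub> ((-1 :: int) ^ length (filter (place_descent p) w))) [^]\<^bsub>?T\<^esub> ?s"
    unfolding graded_bimult_monomial[OF graded_bimult_skew_tensor V W] e ..
  also have "\<dots> = monomial_tensor L m (\<lambda>k. ?V k @ ?W k) [^]\<^bsub>?T\<^esub> ((-1 :: int) ^ inversions place_descent (p # w))"
    using V W by (subst T.int_pow_pow) (auto intro!: monomial_tensor_closed simp: words_on_def power_add)
  also have "monomial_tensor L m (\<lambda>k. ?V k @ ?W k) = monomial_tensor L m (\<lambda>k. place_part k (p # w))"
    by (rule monomial_tensor_cong) (simp add: place_part_def p)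
  finally show ?case by (simp add: word_tensor_def)
qed

section \<open>Divided powers of substitution derivations\<close>

text \<open>The \<open>h\<close>-th divided power, applied to a word, of the derivation \<open>D\<close> that sends the letters \<open>p\<close> with \<open>A p\<close> to
  \<open>\<tau> p\<close> and all other letters to \<open>0\<close>. The recursion is the product rule
  \<open>D\<^sup>(\<^sup>h\<^sup>) (p w) = p D\<^sup>(\<^sup>h\<^sup>) w + D p D\<^sup>(\<^sup>h\<^sup>-\<^sup>1\<^sup>) w\<close>, which has only two terms if \<open>D (D p) = 0\<close>.\<close>

primrec divided_word ::
  "'b set \<Rightarrow> ('b \<Rightarrow> bool) \<Rightarrow> ('b \<Rightarrow> 'b) \<Rightarrow> 'b list \<Rightarrow> nat \<Rightarrow> ('b list \<Rightarrow>\<^sub>0 int) set" where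
  "divided_word S A \<tau> [] h = (if h = 0 then \<one>\<^bsub>skew S\<^esub> else \<zero>\<^bsub>skew S\<^esub>)"
| "divided_word S A \<tau> (p # w) h =
     monomial S [p] \<otimes>\<^bsub>skew S\<^esub> divided_word S A \<tau> w h \<oplus>\<^bsub>skew S\<^esub>
     (if A p \<and> h \<noteq> 0 then monomial S [\<tau> p] \<otimes>\<^bsub>skew S\<^esub> divided_word S A \<tau> w (h - 1) else \<zero>\<^bsub>skew S\<^esub>)"

text \<open>Two adjacent letters \<open>a\<close> and \<open>b\<close> with images \<open>a'\<close> and \<open>b'\<close>, followed by a word whose divided powers of three
  consecutive orders are \<open>u\<close>, \<open>v\<close>, \<open>w\<close>: letters and images anticommute, so the expansions for the
  two orders of the letters cancel.\<close>

lemma (in ring) anticommuting_expansion: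
  assumes "a \<in> carrier R" "a' \<in> carrier R" "b \<in> carrier R" "b' \<in> carrier R"
    and "u \<in> carrier R" "v \<in> carrier R" "w \<in> carrier R"
    and "a \<otimes> b \<oplus> b \<otimes> a = \<zero>" "a \<otimes> b' \<oplus> b' \<otimes> a = \<zero>" "a' \<otimes> b \<oplus> b \<otimes> a' = \<zero>" "a' \<otimes> b' \<oplus> b' \<otimes> a' = \<zero>"
  shows "(a \<otimes> (b \<otimes> u \<oplus> b' \<otimes> v) \<oplus> a' \<otimes> (b \<otimes> v \<oplus> b' \<otimes> w)) \<oplus>
         (b \<otimes> (a \<otimes> u \<oplus> a' \<otimes> v) \<oplus> b' \<otimes> (a \<otimes> v \<oplus> a' \<otimes> w)) = \<zero>" (is "?l = _")
proof -
  have "?l = (a \<otimes> b \<oplus> b \<otimes> a) \<otimes> u \<oplus> (a \<otimes> b' \<oplus> b' \<otimes> a) \<otimes> v \<oplus>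
     ((a' \<otimes> b \<oplus> b \<otimes> a') \<otimes> v \<oplus> (a' \<otimes> b' \<oplus> b' \<otimes> a') \<otimes> w)"
    using assms(1-7) by (simp add: r_distr l_distr m_assoc a_ac)
  then show ?thesis unfolding assms(8-11) using assms(1-7) by simp
qed

lemma hom_add_minus:
  assumes "ring R" "ring Q" "f \<in> hom (add_monoid R) (add_monoid Q)" "x \<in> carrier R" "y \<in> carrier R"
  shows "f (x \<ominus>\<^bsub>R\<^esub> y) = f x \<ominus>\<^bsub>Q\<^esub> f y"
proof -
  interpret R: ring R by fact
  interpret Q: ring Q by fact
  interpret f: group_hom "add_monoid R" "add_monoid Q" f
    by (rule group_homI[OF R.a_group Q.a_group assms(3)])
  show ?thesis
    using f.hom_mult[of x "\<ominus>\<^bsub>R\<^esub> y"] f.hom_inv[of y] R.a_inv_closed[OF assms(5)] assms(4,5)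
    unfolding a_minus_def a_inv_def by simp
qed

text \<open>The images of the active letters are inactive, so that the derivation annihilates them; for place
  polarizations this is the condition that the two places differ.\<close>

locale substitution_derivation =
  fixes S :: "'b set" and A :: "'b \<Rightarrow> bool" and \<tau> :: "'b \<Rightarrow> 'b"
  assumes closed: "p \<in> S \<Longrightarrow> A p \<Longrightarrow> \<tau> p \<in> S"
    and nilpotent: "p \<in> S \<Longrightarrow> A p \<Longrightarrow> \<not> A (\<tau> p)"
begin

sublocale ring "skew S" by (rule ring_skew)

abbreviation "letter_image p \<equiv> (if A p then monomial S [\<tau> p] else \<zero>\<^bsub>skew S\<^esub>)"
abbreviation "dword \<equiv> divided_word S A \<tau>"
abbreviation "dword_pred w h \<equiv> (if h = 0 then \<zero>\<^bsub>skew S\<^esub> else dword w (h - 1))"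

lemma dword_closed: "w \<in> lists S \<Longrightarrow> dword w h \<in> carrier (skew S)"
  by (induction w arbitrary: h) (auto simp: closed)

lemma dword_Cons:
  assumes "p \<in> S" "w \<in> lists S"
  shows "dword (p # w) h = monomial S [p] \<otimes>\<^bsub>skew S\<^esub> dword w h \<oplus>\<^bsub>skew S\<^esub> letter_image p \<otimes>\<^bsub>skew S\<^esub> dword_pred w h"
  using assms closed[OF assms(1)] dword_closed[OF assms(2)] by simp

lemma letter_image_closed: "p \<in> S \<Longrightarrow> letter_image p \<in> carrier (skew S)"
  using closed by auto

lemma letters_anticommute:
  assumes "p \<in> S" "q \<in> S"
  shows "monomial S [p] \<otimes>\<^bsub>skew S\<^esub> monomial S [q] \<oplus>\<^bsub>skew S\<^esub> monomial S [q] \<otimes>\<^bsub>skew S\<^esub> monomial S [p] = \<zero>\<^bsub>skew S\<^esub>"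
  using monomial_swap2[OF assms] monomial_append[of "[p]" S "[q]"] monomial_append[of "[q]" S "[p]"] assms
  by simp

lemma letter_square: "p \<in> S \<Longrightarrow> monomial S [p] \<otimes>\<^bsub>skew S\<^esub> monomial S [p] = \<zero>\<^bsub>skew S\<^esub>"
  using monomial_square[of p S] monomial_append[of "[p]" S "[p]"] by simp

lemma dword_two:
  assumes "a \<in> S" "b \<in> S" "w \<in> lists S"
  shows "dword ([a, b] @ w) h =
    monomial S [a] \<otimes>\<^bsub>skew S\<^esub>
      (monomial S [b] \<otimes>\<^bsub>skew S\<^esub> dword w h \<oplus>\<^bsub>skew S\<^esub> letter_image b \<otimes>\<^bsub>skew S\<^esub> dword_pred w h) \<oplus>\<^bsub>skew S\<^esub>
    letter_image a \<otimes>\<^bsub>skew S\<^esub>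
      (monomial S [b] \<otimes>\<^bsub>skew S\<^esub> dword_pred w h \<oplus>\<^bsub>skew S\<^esub>
       letter_image b \<otimes>\<^bsub>skew S\<^esub> (if h < 2 then \<zero>\<^bsub>skew S\<^esub> else dword w (h - 2)))"
proof -
  let ?w = "if h < 2 then \<zero>\<^bsub>skew S\<^esub> else dword w (h - 2)"
  have "dword_pred (b # w) h = monomial S [b] \<otimes>\<^bsub>skew S\<^esub> dword_pred w h \<oplus>\<^bsub>skew S\<^esub> letter_image b \<otimes>\<^bsub>skew S\<^esub> ?w"
  proof (cases h)
    case (Suc n)
    have "Suc n < 2 \<longleftrightarrow> n = 0" "Suc n - 2 = n - 1" by auto
    then show ?thesis using dword_Cons[of b w n] assms Suc by simp
  qed (use assms letter_image_closed[of b] in simp)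
  then show ?thesis
    using dword_Cons[of a "b # w" h] dword_Cons[of b w h] assms by simp
qed

lemma dword_swap:
  assumes vw: "v \<in> lists S" "w \<in> lists S" and xy: "x \<in> S" "y \<in> S"
  shows "dword (v @ [x, y] @ w) h \<oplus>\<^bsub>skew S\<^esub> dword (v @ [y, x] @ w) h = \<zero>\<^bsub>skew S\<^esub>"
  using vw(1)
proof (induction v arbitrary: h)
  case Nil
  show ?case
    unfolding append_Nil dword_two[OF xy vw(2)] dword_two[OF xy(2,1) vw(2)]
    by (rule anticommuting_expansion)
      (use xy vw closed letters_anticommute dword_closed[OF vw(2)] in auto)
next
  case (Cons p v)
  have "v @ [x, y] @ w \<in> lists S" "v @ [y, x] @ w \<in> lists S" using Cons.hyps xy vw by auto
  note c = this[THEN dword_closed]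
  have p: "monomial S [p] \<in> carrier (skew S)" "letter_image p \<in> carrier (skew S)"
    using Cons.hyps letter_image_closed[of p] by auto
  have IH': "dword_pred (v @ [x, y] @ w) h \<oplus>\<^bsub>skew S\<^esub> dword_pred (v @ [y, x] @ w) h = \<zero>\<^bsub>skew S\<^esub>"
    using Cons.IH by simp
  have "dword ((p # v) @ [x, y] @ w) h \<oplus>\<^bsub>skew S\<^esub> dword ((p # v) @ [y, x] @ w) h =
      monomial S [p] \<otimes>\<^bsub>skew S\<^esub> (dword (v @ [x, y] @ w) h \<oplus>\<^bsub>skew S\<^esub> dword (v @ [y, x] @ w) h) \<oplus>\<^bsub>skew S\<^esub>
      letter_image p \<otimes>\<^bsub>skew S\<^esub> (dword_pred (v @ [x, y] @ w) h \<oplus>\<^bsub>skew S\<^esub> dword_pred (v @ [y, x] @ w) h)"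
    using c p Cons.hyps xy vw by (simp add: dword_Cons r_distr a_ac del: divided_word.simps)
  then show ?case unfolding Cons.IH IH' using p by simp
qed

lemma dword_square:
  assumes vw: "v \<in> lists S" "w \<in> lists S" and x: "x \<in> S"
  shows "dword (v @ [x, x] @ w) h = \<zero>\<^bsub>skew S\<^esub>"
  using vw(1)
proof (induction v arbitrary: h)
  case Nil
  have sq: "letter_image x \<otimes>\<^bsub>skew S\<^esub> letter_image x = \<zero>\<^bsub>skew S\<^esub>"
    using letter_square x closed[OF x] by simp
  have ac: "monomial S [x] \<otimes>\<^bsub>skew S\<^esub> letter_image x \<oplus>\<^bsub>skew S\<^esub> letter_image x \<otimes>\<^bsub>skew S\<^esub> monomial S [x] = \<zero>\<^bsub>skew S\<^esub>"
    using letters_anticommute[OF x closed[OF x]] x by simp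
  have X: "monomial S [x] \<in> carrier (skew S)" "letter_image x \<in> carrier (skew S)"
    using x letter_image_closed by auto
  have expand: "a \<otimes>\<^bsub>skew S\<^esub> (a \<otimes>\<^bsub>skew S\<^esub> u \<oplus>\<^bsub>skew S\<^esub> b \<otimes>\<^bsub>skew S\<^esub> v) \<oplus>\<^bsub>skew S\<^esub> b \<otimes>\<^bsub>skew S\<^esub> (a \<otimes>\<^bsub>skew S\<^esub> v \<oplus>\<^bsub>skew S\<^esub> b \<otimes>\<^bsub>skew S\<^esub> w) = \<zero>\<^bsub>skew S\<^esub>"
    if c: "a \<in> carrier (skew S)" "b \<in> carrier (skew S)" "u \<in> carrier (skew S)" "v \<in> carrier (skew S)" "w \<in> carrier (skew S)"
      and z: "a \<otimes>\<^bsub>skew S\<^esub> a = \<zero>\<^bsub>skew S\<^esub>" "b \<otimes>\<^bsub>skew S\<^esub> b = \<zero>\<^bsub>skew S\<^esub>" "a \<otimes>\<^bsub>skew S\<^esub> b \<oplus>\<^bsub>skew S\<^esub> b \<otimes>\<^bsub>skew S\<^esub> a = \<zero>\<^bsub>skew S\<^esub>"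
    for a b u v w
  proof -
    have "a \<otimes>\<^bsub>skew S\<^esub> (a \<otimes>\<^bsub>skew S\<^esub> u \<oplus>\<^bsub>skew S\<^esub> b \<otimes>\<^bsub>skew S\<^esub> v) \<oplus>\<^bsub>skew S\<^esub> b \<otimes>\<^bsub>skew S\<^esub> (a \<otimes>\<^bsub>skew S\<^esub> v \<oplus>\<^bsub>skew S\<^esub> b \<otimes>\<^bsub>skew S\<^esub> w) =
       (a \<otimes>\<^bsub>skew S\<^esub> a) \<otimes>\<^bsub>skew S\<^esub> u \<oplus>\<^bsub>skew S\<^esub> (a \<otimes>\<^bsub>skew S\<^esub> b \<oplus>\<^bsub>skew S\<^esub> b \<otimes>\<^bsub>skew S\<^esub> a) \<otimes>\<^bsub>skew S\<^esub> v \<oplus>\<^bsub>skew S\<^esub> (b \<otimes>\<^bsub>skew S\<^esub> b) \<otimes>\<^bsub>skew S\<^esub> w"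
      using c by (simp add: r_distr l_distr m_assoc a_ac)
    then show ?thesis unfolding z using c by simp
  qed
  show ?case
    unfolding append_Nil dword_two[OF x x vw(2)]
    by (rule expand[OF X _ _ _ letter_square[OF x] sq ac]) (use dword_closed[OF vw(2)] in auto)
next
  case (Cons p v)
  have l: "v @ [x, x] @ w \<in> lists S" using Cons.hyps x vw by auto
  have "dword_pred (v @ [x, x] @ w) h = \<zero>\<^bsub>skew S\<^esub>" using Cons.IH by simp
  then show ?case
    using dword_Cons[OF Cons.hyps(1) l, of h] Cons.IH[of h] Cons.hyps(1) letter_image_closed[of p] by simp
qed

definition dpow :: "nat \<Rightarrow> ('b list \<Rightarrow>\<^sub>0 int) set \<Rightarrow> ('b list \<Rightarrow>\<^sub>0 int) set" where
  "dpow h = (SOME E. E \<in> hom (add_monoid (skew S)) (add_monoid (skew S)) \<and>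
     (\<forall>w \<in> lists S. E (monomial S w) = dword w h))"

lemma dpow: "dpow h \<in> hom (add_monoid (skew S)) (add_monoid (skew S))"
    "w \<in> lists S \<Longrightarrow> dpow h (monomial S w) = dword w h"
proof -
  have "\<exists>E. E \<in> hom (add_monoid (skew S)) (add_monoid (skew S)) \<and> (\<forall>w \<in> lists S. E (monomial S w) = dword w h)"
  proof -
    have g1: "dword w h \<in> carrier (add_monoid (skew S))" if "w \<in> lists S" for w
      using dword_closed[OF that] by simp
    have g2: "dword (v @ [x, y] @ w) h \<otimes>\<^bsub>add_monoid (skew S)\<^esub> dword (v @ [y, x] @ w) h = \<one>\<^bsub>add_monoid (skew S)\<^esub>"
      if "v \<in> lists S" "w \<in> lists S" "x \<in> S" "y \<in> S" for v w x y
      unfolding monoid.simps by (rule dword_swap[OF that])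
    have g3: "dword (v @ [x, x] @ w) h = \<one>\<^bsub>add_monoid (skew S)\<^esub>"
      if "v \<in> lists S" "w \<in> lists S" "x \<in> S" for v w x
      unfolding monoid.simps by (rule dword_square[OF that])
    show ?thesis
      by (rule comm_group.skew_lift[OF a_comm_group, of S "\<lambda>w. dword w h", OF g1 g2 g3]) blast+
  qed
  from someI_ex[OF this] show "dpow h \<in> hom (add_monoid (skew S)) (add_monoid (skew S))"
    "w \<in> lists S \<Longrightarrow> dpow h (monomial S w) = dword w h"
    unfolding dpow_def by blast+
qed

lemma dpow_closed: "u \<in> carrier (skew S) \<Longrightarrow> dpow h u \<in> carrier (skew S)"
  using dpow(1)[of h] by (auto simp: hom_def)

lemma dpow_add:
  "u \<in> carrier (skew S) \<Longrightarrow> v \<in> carrier (skew S) \<Longrightarrow> dpow h (u \<oplus>\<^bsub>skew S\<^esub> v) = dpow h u \<oplus>\<^bsub>skew S\<^esub> dpow h v"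
  using hom_mult[OF dpow(1)[of h], of u v] by simp

lemmas dpow_minus = hom_add_minus[OF ring_skew ring_skew dpow(1)]

lemma dpow_zero: "dpow h \<zero>\<^bsub>skew S\<^esub> = \<zero>\<^bsub>skew S\<^esub>"
  using hom_one[OF dpow(1)[of h] a_group a_group] by simp

lemma dpow_scale: "u \<in> carrier (skew S) \<Longrightarrow> dpow h ([(n :: nat)] \<cdot>\<^bsub>skew S\<^esub> u) = [n] \<cdot>\<^bsub>skew S\<^esub> dpow h u"
  unfolding add_pow_def
  by (rule group_hom.hom_nat_pow[OF group_homI[OF a_group a_group dpow(1)]]) simp

lemma dword_0: "w \<in> lists S \<Longrightarrow> dword w 0 = monomial S w"
proof (induction w)
  case (Cons p w)
  then show ?case using monomial_append[of "[p]" S w] by simp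
qed (simp add: monomial_Nil)

lemma dpow_0: "u \<in> carrier (skew S) \<Longrightarrow> dpow 0 u = u"
proof (induction rule: skew_induct)
  case zero show ?case by (rule dpow_zero)
next
  case (monomial w) then show ?case by (simp add: dpow(2) dword_0)
next
  case (diff x y) then show ?case by (simp add: dpow_minus)
qed

lemma dword_1_append:
  assumes "v \<in> lists S" "w \<in> lists S"
  shows "dword (v @ w) 1 = dword v 1 \<otimes>\<^bsub>skew S\<^esub> monomial S w \<oplus>\<^bsub>skew S\<^esub> monomial S v \<otimes>\<^bsub>skew S\<^esub> dword w 1"
  using assms(1)
proof (induction v)
  case Nil then show ?case using assms(2) dword_closed[OF assms(2)] by (simp add: monomial_Nil)
next
  case (Cons p v)
  have c: "monomial S [p] \<in> carrier (skew S)" "letter_image p \<in> carrier (skew S)"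
     "monomial S v \<in> carrier (skew S)" "monomial S w \<in> carrier (skew S)"
     "dword v 1 \<in> carrier (skew S)" "dword w 1 \<in> carrier (skew S)"
    using Cons.hyps assms letter_image_closed[of p] dword_closed by auto
  have "dword ((p # v) @ w) 1 = monomial S [p] \<otimes>\<^bsub>skew S\<^esub> dword (v @ w) 1 \<oplus>\<^bsub>skew S\<^esub> letter_image p \<otimes>\<^bsub>skew S\<^esub> (monomial S v \<otimes>\<^bsub>skew S\<^esub> monomial S w)"
    using dword_Cons[of p "v @ w" 1] Cons.hyps assms(2) by (simp add: dword_0 monomial_append del: divided_word.simps)
  also have "\<dots> = (monomial S [p] \<otimes>\<^bsub>skew S\<^esub> dword v 1 \<oplus>\<^bsub>skew S\<^esub> letter_image p \<otimes>\<^bsub>skew S\<^esub> monomial S v) \<otimes>\<^bsub>skew S\<^esub> monomial S w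
     \<oplus>\<^bsub>skew S\<^esub> (monomial S [p] \<otimes>\<^bsub>skew S\<^esub> monomial S v) \<otimes>\<^bsub>skew S\<^esub> dword w 1"
    unfolding Cons.IH using c by (simp add: r_distr l_distr m_assoc a_ac)
  also have "monomial S [p] \<otimes>\<^bsub>skew S\<^esub> dword v 1 \<oplus>\<^bsub>skew S\<^esub> letter_image p \<otimes>\<^bsub>skew S\<^esub> monomial S v = dword (p # v) 1"
    using dword_Cons[of p v 1] Cons.hyps by (simp add: dword_0 del: divided_word.simps)
  also have "monomial S [p] \<otimes>\<^bsub>skew S\<^esub> monomial S v = monomial S (p # v)"
    using monomial_append[of "[p]" S v] Cons.hyps by simp
  finally show ?case .
qed

lemma dpow_1_product:
  assumes u: "u \<in> carrier (skew S)" and v: "v \<in> carrier (skew S)"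
  shows "dpow 1 (u \<otimes>\<^bsub>skew S\<^esub> v) = dpow 1 u \<otimes>\<^bsub>skew S\<^esub> v \<oplus>\<^bsub>skew S\<^esub> u \<otimes>\<^bsub>skew S\<^esub> dpow 1 v"
proof -
  have distr: "(x \<ominus>\<^bsub>skew S\<^esub> y) \<otimes>\<^bsub>skew S\<^esub> z = x \<otimes>\<^bsub>skew S\<^esub> z \<ominus>\<^bsub>skew S\<^esub> y \<otimes>\<^bsub>skew S\<^esub> z"
     "z \<otimes>\<^bsub>skew S\<^esub> (x \<ominus>\<^bsub>skew S\<^esub> y) = z \<otimes>\<^bsub>skew S\<^esub> x \<ominus>\<^bsub>skew S\<^esub> z \<otimes>\<^bsub>skew S\<^esub> y"
    if "x \<in> carrier (skew S)" "y \<in> carrier (skew S)" "z \<in> carrier (skew S)" for x y z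
    using that by (simp_all add: minus_eq l_distr r_distr l_minus r_minus)
  have rearrange: "(a \<oplus>\<^bsub>skew S\<^esub> b) \<ominus>\<^bsub>skew S\<^esub> (c \<oplus>\<^bsub>skew S\<^esub> d) = (a \<ominus>\<^bsub>skew S\<^esub> c) \<oplus>\<^bsub>skew S\<^esub> (b \<ominus>\<^bsub>skew S\<^esub> d)"
    if "a \<in> carrier (skew S)" "b \<in> carrier (skew S)" "c \<in> carrier (skew S)" "d \<in> carrier (skew S)" for a b c d
    using that by (simp add: minus_eq minus_add a_ac)
  have words: "dpow 1 (monomial S w \<otimes>\<^bsub>skew S\<^esub> v) = dpow 1 (monomial S w) \<otimes>\<^bsub>skew S\<^esub> v \<oplus>\<^bsub>skew S\<^esub> monomial S w \<otimes>\<^bsub>skew S\<^esub> dpow 1 v"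
    if w: "w \<in> lists S" for w
    using v
  proof (induction rule: skew_induct)
    case zero then show ?case using w dpow_closed[of "monomial S w" 1] by (simp add: dpow_zero)
  next
    case (monomial w')
    then show ?case
      using dword_1_append[OF w monomial] dpow(2)[of "w @ w'" 1] w by (simp add: dpow(2) flip: monomial_append)
  next
    case (diff x y)
    then show ?case using w dpow_closed[of _ 1] by (simp add: distr dpow_minus rearrange)
  qed
  show ?thesis
    using u
  proof (induction rule: skew_induct)
    case zero then show ?case using v dpow_closed[of v 1] by (simp add: dpow_zero)
  next
    case (monomial w) then show ?case by (rule words)
  next
    case (diff x y)
    then show ?case using v dpow_closed[of _ 1] by (simp add: distr dpow_minus rearrange)
  qed
qed

lemma dpow_1_letter: "p \<in> S \<Longrightarrow> dpow 1 (monomial S [p]) = letter_image p"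
  using closed[of p] by (simp add: dpow(2))

lemma dpow_1_letter_image: "p \<in> S \<Longrightarrow> dpow 1 (letter_image p) = \<zero>\<^bsub>skew S\<^esub>"
  using closed[of p] nilpotent[of p] by (simp add: dpow(2) dpow_zero)

text \<open>The derivation acts on the first letter of \<open>p w\<close>, where it contributes \<open>\<tau> p\<close> times the \<open>h\<close>-th divided power of
  \<open>w\<close> once, and inside \<open>w\<close>, where the term that already contains \<open>\<tau> p\<close> contributes the same product \<open>h\<close> more
  times.\<close>

lemma dpow_1_dword: "w \<in> lists S \<Longrightarrow> dpow 1 (dword w h) = [(Suc h)] \<cdot>\<^bsub>skew S\<^esub> dword w (Suc h)"
proof (induction w arbitrary: h)
  case Nil
  have "dword [] 1 = \<zero>\<^bsub>skew S\<^esub>" by simp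
  then have "dpow 1 \<one>\<^bsub>skew S\<^esub> = \<zero>\<^bsub>skew S\<^esub>" using dpow(2)[of "[]" 1] by (simp add: monomial_Nil)
  then show ?case by (simp add: dpow_zero)
next
  case (Cons p w)
  have w: "w \<in> lists S" "p \<in> S" using Cons.prems by auto
  have P: "monomial S [p] \<in> carrier (skew S)" "letter_image p \<in> carrier (skew S)"
    using w letter_image_closed[of p] by auto
  note c = dword_closed[OF w(1)]
  \<comment> \<open>For \<open>h = 0\<close> both sides vanish.\<close>
  have pred: "dpow 1 (dword_pred w h) = [h] \<cdot>\<^bsub>skew S\<^esub> dword w h"
    using Cons.IH[OF w(1), of "h - 1"] by (cases h) (simp_all add: dpow_zero)
  have cp: "dword_pred w h \<in> carrier (skew S)" using c by simp
  have "dpow 1 (dword (p # w) h) =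
      dpow 1 (monomial S [p] \<otimes>\<^bsub>skew S\<^esub> dword w h) \<oplus>\<^bsub>skew S\<^esub> dpow 1 (letter_image p \<otimes>\<^bsub>skew S\<^esub> dword_pred w h)"
    unfolding dword_Cons[OF w(2,1)] by (rule dpow_add) (use P c cp in auto)
  also have "dpow 1 (monomial S [p] \<otimes>\<^bsub>skew S\<^esub> dword w h) =
      letter_image p \<otimes>\<^bsub>skew S\<^esub> dword w h \<oplus>\<^bsub>skew S\<^esub> monomial S [p] \<otimes>\<^bsub>skew S\<^esub> [(Suc h)] \<cdot>\<^bsub>skew S\<^esub> dword w (Suc h)"
    unfolding dpow_1_product[OF P(1) c] dpow_1_letter[OF w(2)] Cons.IH[OF w(1)] ..
  also have "dpow 1 (letter_image p \<otimes>\<^bsub>skew S\<^esub> dword_pred w h) = letter_image p \<otimes>\<^bsub>skew S\<^esub> [h] \<cdot>\<^bsub>skew S\<^esub> dword w h"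
    unfolding dpow_1_product[OF P(2) cp] dpow_1_letter_image[OF w(2)] pred using P c cp by simp
  also have "letter_image p \<otimes>\<^bsub>skew S\<^esub> dword w h \<oplus>\<^bsub>skew S\<^esub> monomial S [p] \<otimes>\<^bsub>skew S\<^esub> [(Suc h)] \<cdot>\<^bsub>skew S\<^esub> dword w (Suc h)
       \<oplus>\<^bsub>skew S\<^esub> letter_image p \<otimes>\<^bsub>skew S\<^esub> [h] \<cdot>\<^bsub>skew S\<^esub> dword w h =
     [(Suc h)] \<cdot>\<^bsub>skew S\<^esub> (monomial S [p] \<otimes>\<^bsub>skew S\<^esub> dword w (Suc h) \<oplus>\<^bsub>skew S\<^esub> letter_image p \<otimes>\<^bsub>skew S\<^esub> dword w h)"
  proof -
    have "x \<oplus>\<^bsub>skew S\<^esub> [(Suc h)] \<cdot>\<^bsub>skew S\<^esub> y \<oplus>\<^bsub>skew S\<^esub> [h] \<cdot>\<^bsub>skew S\<^esub> x = [(Suc h)] \<cdot>\<^bsub>skew S\<^esub> (y \<oplus>\<^bsub>skew S\<^esub> x)"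
      if "x \<in> carrier (skew S)" "y \<in> carrier (skew S)" for x y
      using that by (simp add: add.nat_pow_distrib add.nat_pow_Suc a_ac)
    note this[OF m_closed[OF P(2) c[of h]] m_closed[OF P(1) c[of "Suc h"]]]
    then show ?thesis
      unfolding add_pow_rdistr[OF P(1) c] add_pow_rdistr[OF P(2) c] .
  qed
  also have "monomial S [p] \<otimes>\<^bsub>skew S\<^esub> dword w (Suc h) \<oplus>\<^bsub>skew S\<^esub> letter_image p \<otimes>\<^bsub>skew S\<^esub> dword w h = dword (p # w) (Suc h)"
    using dword_Cons[OF w(2,1), of "Suc h"] by simp
  finally show ?case .
qed

lemma dpow_1_dpow: "u \<in> carrier (skew S) \<Longrightarrow> dpow 1 (dpow h u) = [(Suc h)] \<cdot>\<^bsub>skew S\<^esub> dpow (Suc h) u"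
proof (induction rule: skew_induct)
  case zero then show ?case by (simp add: dpow_zero)
next
  case (monomial w) then show ?case by (simp add: dpow(2) dpow_1_dword)
next
  case (diff x y)
  have "[n] \<cdot>\<^bsub>skew S\<^esub> (a \<ominus>\<^bsub>skew S\<^esub> b) = [n] \<cdot>\<^bsub>skew S\<^esub> a \<ominus>\<^bsub>skew S\<^esub> [n] \<cdot>\<^bsub>skew S\<^esub> b"
    if "a \<in> carrier (skew S)" "b \<in> carrier (skew S)" for a b and n :: nat
    using that by (simp add: minus_eq add.nat_pow_distrib add.nat_pow_inv)
  with diff show ?case by (simp add: dpow_minus dpow_closed del: add.nat_pow_Suc)
qed

lemma dpow_1_iterate: "u \<in> carrier (skew S) \<Longrightarrow> (dpow 1 ^^ h) u = [(fact h :: nat)] \<cdot>\<^bsub>skew S\<^esub> dpow h u"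
proof (induction h)
  case 0 then show ?case by (simp add: dpow_0)
next
  case (Suc h)
  then show ?case
    by (simp add: dpow_scale dpow_closed dpow_1_dpow add.nat_pow_pow mult.commute del: add.nat_pow_Suc)
qed

text \<open>The iterate of order \<open>h\<close> is \<open>h!\<close> times the operator built from words, and division by \<open>h!\<close> is
  unambiguous because \<open>skew S\<close> has no torsion.\<close>

lemma divided_power_dpow:
  assumes D: "\<And>u. u \<in> carrier (skew S) \<Longrightarrow> D u = dpow 1 u" and u: "u \<in> carrier (skew S)"
  shows "divided_power (skew S) D h u = dpow h u"
proof -
  have iter: "(D ^^ n) u = (dpow 1 ^^ n) u \<and> (dpow 1 ^^ n) u \<in> carrier (skew S)" for n
    by (induction n) (auto simp: D u dpow_closed)
  have Dh: "(D ^^ h) u = [(fact h :: nat)] \<cdot>\<^bsub>skew S\<^esub> dpow h u"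
    using iter[of h] dpow_1_iterate[OF u] by simp
  show ?thesis
    unfolding divided_power_def
  proof (rule the_equality)
    show "dpow h u \<in> carrier (skew S) \<and> [(fact h :: nat)] \<cdot>\<^bsub>skew S\<^esub> dpow h u = (D ^^ h) u"
      using u Dh dpow_closed by simp
    fix v assume v: "v \<in> carrier (skew S) \<and> [(fact h :: nat)] \<cdot>\<^bsub>skew S\<^esub> v = (D ^^ h) u"
    let ?n = "fact h :: nat" and ?e = "dpow h u"
    have e: "?e \<in> carrier (skew S)" using u by (rule dpow_closed)
    have "[?n] \<cdot>\<^bsub>skew S\<^esub> (v \<ominus>\<^bsub>skew S\<^esub> ?e) = [?n] \<cdot>\<^bsub>skew S\<^esub> v \<ominus>\<^bsub>skew S\<^esub> [?n] \<cdot>\<^bsub>skew S\<^esub> ?e"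
      using v e by (simp add: minus_eq add.nat_pow_distrib add.nat_pow_inv)
    also have "\<dots> = \<zero>\<^bsub>skew S\<^esub>" using v Dh e by (simp add: r_neg minus_eq)
    finally have "[(int ?n)] \<cdot>\<^bsub>skew S\<^esub> (v \<ominus>\<^bsub>skew S\<^esub> ?e) = \<zero>\<^bsub>skew S\<^esub>"
      unfolding add_pow_def int_pow_int .
    then have "v \<ominus>\<^bsub>skew S\<^esub> ?e = \<zero>\<^bsub>skew S\<^esub>"
      using skew_torsion_free[of "v \<ominus>\<^bsub>skew S\<^esub> ?e" S "int ?n"] v e by simp
    then show "v = ?e" using v e by (simp add: r_right_minus_eq)
  qed
qed

lemma derivation_unique:
  assumes D: "derivation (skew S) D" and E: "derivation (skew S) E"
    and eq: "\<And>p. p \<in> S \<Longrightarrow> D (monomial S [p]) = E (monomial S [p])" and u: "u \<in> carrier (skew S)"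
  shows "D u = E u"
proof -
  have one: "D \<one>\<^bsub>skew S\<^esub> = \<zero>\<^bsub>skew S\<^esub>" if "derivation (skew S) D" for D
  proof -
    have c: "D \<one>\<^bsub>skew S\<^esub> \<in> carrier (skew S)"
      using that by (auto simp: derivation_def)
    have "D (\<one>\<^bsub>skew S\<^esub> \<otimes>\<^bsub>skew S\<^esub> \<one>\<^bsub>skew S\<^esub>) =
        D \<one>\<^bsub>skew S\<^esub> \<otimes>\<^bsub>skew S\<^esub> \<one>\<^bsub>skew S\<^esub> \<oplus>\<^bsub>skew S\<^esub> \<one>\<^bsub>skew S\<^esub> \<otimes>\<^bsub>skew S\<^esub> D \<one>\<^bsub>skew S\<^esub>"
      using that unfolding derivation_def by blast
    then have "D \<one>\<^bsub>skew S\<^esub> \<oplus>\<^bsub>skew S\<^esub> D \<one>\<^bsub>skew S\<^esub> = D \<one>\<^bsub>skew S\<^esub>" using c by simp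
    then show ?thesis using add.l_cancel_one[OF c c] by simp
  qed
  have hom: "D \<in> hom (add_monoid (skew S)) (add_monoid (skew S))" if "derivation (skew S) D" for D
    using that by (simp add: derivation_def hom_def)
  have words: "D (monomial S w) = E (monomial S w)" if "w \<in> lists S" for w
    using that
  proof (induction w)
    case Nil then show ?case by (simp add: monomial_Nil one D E)
  next
    case (Cons p w)
    then show ?case
      using D E eq[of p] monomial_append[of "[p]" S w] by (simp add: derivation_def)
  qed
  show ?thesis
    using u
  proof (induction rule: skew_induct)
    case zero
    then show ?case using hom_one[OF hom[OF D] a_group a_group] hom_one[OF hom[OF E] a_group a_group] by simp
  next
    case (diff x y)
    then show ?case
      by (simp add: hom_add_minus[OF ring_skew ring_skew hom[OF D]] hom_add_minus[OF ring_skew ring_skew hom[OF E]])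
  qed (rule words)
qed

lemma derivation_dpow: "derivation (skew S) (restrict (dpow 1) (carrier (skew S)))"
  by (simp add: derivation_def Pi_iff dpow_closed dpow_add dpow_1_product)

end

section \<open>Place polarizations\<close>

lemma place_substitution:
  fixes L :: "'a set" and i j m :: nat
  assumes "j \<in> {1..m}" "i \<noteq> j"
  shows "substitution_derivation (L \<times> {1..m}) (\<lambda>p. snd p = i) (\<lambda>p. (fst p, j))"
proof
  fix p :: "'a \<times> nat" assume "p \<in> L \<times> {1..m}"
  then show "(fst p, j) \<in> L \<times> {1..m}" using assms(1) by (simp add: mem_Times_iff)
qed (use assms(2) in simp)

text \<open>A derivation is determined by its values on letters, which identifies the polarization with the
  derivation built from words, and its divided powers with the corresponding operators.\<close>

lemma divided_place_polarization:
  fixes L :: "'a set"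
  assumes j: "j \<in> {1..m}" and i: "i \<in> {1..m}" and ij: "i \<noteq> j"
  obtains E where "E \<in> hom (add_monoid (letterplace L m)) (add_monoid (letterplace L m))"
    "\<And>w. w \<in> lists (L \<times> {1..m}) \<Longrightarrow> E (monomial (L \<times> {1..m}) w) =
       divided_word (L \<times> {1..m}) (\<lambda>p. snd p = i) (\<lambda>p. (fst p, j)) w h"
    "\<And>u. u \<in> carrier (letterplace L m) \<Longrightarrow>
       divided_power (letterplace L m) (place_polarization L m j i) h u = E u"
proof -
  let ?S = "L \<times> {1..m}"
  interpret substitution_derivation ?S "\<lambda>p. snd p = i" "\<lambda>p. (fst p, j)"
    by (rule place_substitution[OF j ij])
  let ?D = "restrict (dpow 1) (carrier (skew ?S))"
  have letter: "?D (letter L m x k) = (if i = k then letter L m x j else \<zero>\<^bsub>skew ?S\<^esub>)"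
    if "x \<in> L" "k \<in> {1..m}" for x k
  proof -
    have "monomial ?S [(x, k)] \<in> carrier (skew ?S)" using that by (intro monomial_closed) simp
    moreover have "dpow 1 (monomial ?S [(x, k)]) = (if k = i then monomial ?S [(x, j)] else \<zero>\<^bsub>skew ?S\<^esub>)"
      using dpow_1_letter[of "(x, k)"] that by simp
    ultimately show ?thesis by (auto simp: letter_def)
  qed
  have "place_polarization L m j i = ?D"
    unfolding place_polarization_def letterplace_def
  proof (rule the_equality)
    show "?D \<in> extensional (carrier (skew ?S)) \<and> derivation (skew ?S) ?D
        \<and> (\<forall>x \<in> L. \<forall>k \<in> {1..m}. ?D (letter L m x k) = (if i = k then letter L m x j else \<zero>\<^bsub>skew ?S\<^esub>))"
      using letter derivation_dpow by blast
    fix D assume D: "D \<in> extensional (carrier (skew ?S)) \<and> derivation (skew ?S) D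
        \<and> (\<forall>x \<in> L. \<forall>k \<in> {1..m}. D (letter L m x k) = (if i = k then letter L m x j else \<zero>\<^bsub>skew ?S\<^esub>))"
    show "D = ?D"
    proof (rule extensionalityI[where A = "carrier (skew ?S)"])
      show "D u = ?D u" if "u \<in> carrier (skew ?S)" for u
      proof (rule derivation_unique[OF _ derivation_dpow _ that])
        show "derivation (skew ?S) D" using D by blast
        show "D (monomial ?S [p]) = ?D (monomial ?S [p])" if p: "p \<in> ?S" for p
        proof -
          obtain x k where xk: "p = (x, k)" "x \<in> L" "k \<in> {1..m}" using p by blast
          show ?thesis using D letter[OF xk(2,3)] xk by (simp add: letter_def)
        qed
      qed
    qed (use D in auto)
  qed
  then have "divided_power (letterplace L m) (place_polarization L m j i) h u = dpow h u"
    if "u \<in> carrier (letterplace L m)" for u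
    using divided_power_dpow[of ?D u h] that by (simp add: letterplace_def)
  then show thesis
    using that[of "dpow h"] dpow[where h = h] unfolding letterplace_def by blast
qed

section \<open>Divided powers of a word as sums over subsets\<close>

primrec subst_at :: "('b \<Rightarrow> 'b) \<Rightarrow> 'b list \<Rightarrow> nat set \<Rightarrow> 'b list" where
  "subst_at \<tau> [] H = []"
| "subst_at \<tau> (p # w) H = (if 0 \<in> H then \<tau> p else p) # subst_at \<tau> w {k. Suc k \<in> H}"

definition subsets_of_card :: "nat \<Rightarrow> nat \<Rightarrow> nat set set" where
  "subsets_of_card n h = {H. H \<subseteq> {..<n} \<and> card H = h}"

lemma finite_subsets_of_card: "finite (subsets_of_card n h)"
  by (rule finite_subset[of _ "Pow {..<n}"]) (auto simp: subsets_of_card_def)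

lemma subsets_of_card_0: "subsets_of_card 0 h = (if h = 0 then {{}} else {})"
  by (auto simp: subsets_of_card_def)

lemma subsets_of_card_Suc:
  "subsets_of_card (Suc n) h =
     (`) Suc ` subsets_of_card n h \<union>
     (if h = 0 then {} else (\<lambda>H. insert 0 (Suc ` H)) ` subsets_of_card n (h - 1))"
proof -
  have shift: "x \<in> H \<longleftrightarrow> (x = 0 \<and> 0 \<in> H) \<or> x \<in> Suc ` {k. Suc k \<in> H}" for x and H :: "nat set"
    by (cases x) (simp_all add: image_iff)
  have split1: "H = insert 0 (Suc ` {k. Suc k \<in> H})" if "0 \<in> H" for H :: "nat set"
    by (rule Set.set_eqI) (use shift[of _ H] that in blast)
  have split2: "H = Suc ` {k. Suc k \<in> H}" if "0 \<notin> H" for H :: "nat set"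
    by (rule Set.set_eqI) (use shift[of _ H] that in blast)
  have fin: "finite H" if "H \<subseteq> {..<n}" for H :: "nat set" using that finite_subset by blast
  have card0: "card (insert 0 (Suc ` H)) = Suc (card H)" if "H \<subseteq> {..<n}" for H
    using fin[OF that] by (simp add: card_insert_if card_image)
  show ?thesis
  proof (intro equalityI subsetI)
    fix H assume H: "H \<in> subsets_of_card (Suc n) h"
    let ?K = "{k. Suc k \<in> H}"
    have K: "?K \<subseteq> {..<n}" using H by (auto simp: subsets_of_card_def)
    show "H \<in> (`) Suc ` subsets_of_card n h \<union>
        (if h = 0 then {} else (\<lambda>H. insert 0 (Suc ` H)) ` subsets_of_card n (h - 1))"
    proof (cases "0 \<in> H")
      case True
      then have eq: "H = insert 0 (Suc ` ?K)" by (rule split1)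
      then have "card H = Suc (card ?K)" using card0[OF K] by simp
      then have "h \<noteq> 0" "?K \<in> subsets_of_card n (h - 1)" using H K by (auto simp: subsets_of_card_def)
      then show ?thesis using eq by auto
    next
      case False
      then have eq: "H = Suc ` ?K" by (rule split2)
      then have "card H = card ?K" by (metis card_image inj_Suc inj_on_subset subset_UNIV)
      then have "?K \<in> subsets_of_card n h" using H K by (auto simp: subsets_of_card_def)
      then show ?thesis using eq by auto
    qed
  next
    fix H assume "H \<in> (`) Suc ` subsets_of_card n h \<union>
        (if h = 0 then {} else (\<lambda>H. insert 0 (Suc ` H)) ` subsets_of_card n (h - 1))"
    then show "H \<in> subsets_of_card (Suc n) h"
      using card0 by (auto simp: subsets_of_card_def card_image split: if_splits)
  qed
qed

context substitution_derivation
begin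

lemma subst_at_lists:
  "w \<in> lists S \<Longrightarrow> (\<And>p. p \<in> set w \<Longrightarrow> A p) \<Longrightarrow> subst_at \<tau> w H \<in> lists S"
  by (induction w arbitrary: H) (auto simp: closed)

lemma dword_inactive:
  assumes "z \<in> lists S" "\<And>p. p \<in> set z \<Longrightarrow> \<not> A p"
  shows "dword z h = (if h = 0 then monomial S z else \<zero>\<^bsub>skew S\<^esub>)"
  using assms
proof (induction z)
  case (Cons p z)
  then show ?case using monomial_append[of "[p]" S z] by simp
qed (simp add: monomial_Nil)

lemma dword_inactive_prefix:
  assumes "u \<in> lists S" "w \<in> lists S" "\<And>p. p \<in> set u \<Longrightarrow> \<not> A p"
  shows "dword (u @ w) h = monomial S u \<otimes>\<^bsub>skew S\<^esub> dword w h"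
  using assms(1,3)
proof (induction u)
  case Nil then show ?case using dword_closed[OF assms(2)] by (simp add: monomial_Nil)
next
  case (Cons p u)
  then show ?case
    using monomial_append[of "[p]" S u] dword_closed[OF assms(2)] by (simp add: m_assoc)
qed

text \<open>The two terms of the recursion belong to the subsets without and with the position \<open>0\<close>.\<close>

lemma dword_active_prefix:
  assumes v: "v \<in> lists S" "\<And>p. p \<in> set v \<Longrightarrow> A p" and z: "z \<in> lists S" "\<And>p. p \<in> set z \<Longrightarrow> \<not> A p"
  shows "dword (v @ z) h = (\<Oplus>\<^bsub>skew S\<^esub>H \<in> subsets_of_card (length v) h. monomial S (subst_at \<tau> v H @ z))"
  using v
proof (induction v arbitrary: h)
  case Nil
  then show ?case using z dword_inactive[OF z] by (simp add: subsets_of_card_0)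
next
  case (Cons p v)
  let ?K = "subsets_of_card (length v)"
  have p: "p \<in> S" "A p" "\<tau> p \<in> S" using Cons.hyps Cons.prems closed by auto
  have v: "v \<in> lists S" "\<And>p. p \<in> set v \<Longrightarrow> A p" using Cons.hyps Cons.prems by auto
  have l: "subst_at \<tau> v H @ z \<in> lists S" for H using subst_at_lists[OF v] z by simp
  have IH: "dword (v @ z) h = (\<Oplus>\<^bsub>skew S\<^esub>H \<in> ?K h. monomial S (subst_at \<tau> v H @ z))" for h
    using Cons.IH v by blast
  have mult: "monomial S [q] \<otimes>\<^bsub>skew S\<^esub> dword (v @ z) h = (\<Oplus>\<^bsub>skew S\<^esub>H \<in> ?K h. monomial S (q # subst_at \<tau> v H @ z))"
    if "q \<in> S" for q h
  proof -
    have "monomial S [q] \<otimes>\<^bsub>skew S\<^esub> dword (v @ z) h = (\<Oplus>\<^bsub>skew S\<^esub>H \<in> ?K h. monomial S [q] \<otimes>\<^bsub>skew S\<^esub> monomial S (subst_at \<tau> v H @ z))"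
      unfolding IH using that l by (intro finsum_rdistr finite_subsets_of_card) auto
    then show ?thesis using monomial_append[of "[q]" S, OF _ l] that by simp
  qed
  have inj: "inj_on ((`) Suc) Z" for Z :: "nat set set"
    by (simp add: inj_on_def inj_image_eq_iff)
  have inj0: "inj_on (\<lambda>H. insert 0 (Suc ` H)) Z" for Z :: "nat set set"
  proof (rule inj_onI)
    fix H K :: "nat set" assume "insert 0 (Suc ` H) = insert 0 (Suc ` K)"
    then have "Suc ` H = Suc ` K" by (metis Diff_insert_absorb Zero_not_Suc imageE)
    then show "H = K" by (simp add: inj_image_eq_iff)
  qed
  let ?f = "\<lambda>H. monomial S (subst_at \<tau> (p # v) H @ z)"
  have fc: "?f H \<in> carrier (skew S)" for H
    using subst_at_lists[of "p # v" H] Cons.hyps Cons.prems z by (intro monomial_closed) simp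
  have sum1: "(\<Oplus>\<^bsub>skew S\<^esub>H \<in> (`) Suc ` ?K h. ?f H) = monomial S [p] \<otimes>\<^bsub>skew S\<^esub> dword (v @ z) h"
  proof -
    have "(\<Oplus>\<^bsub>skew S\<^esub>H \<in> (`) Suc ` ?K h. ?f H) = (\<Oplus>\<^bsub>skew S\<^esub>H \<in> ?K h. ?f (Suc ` H))"
      using fc by (intro finsum_reindex inj) auto
    also have "\<dots> = (\<Oplus>\<^bsub>skew S\<^esub>H \<in> ?K h. monomial S (p # subst_at \<tau> v H @ z))"
      by (simp add: inj_image_mem_iff image_iff)
    finally show ?thesis using mult[OF p(1)] by simp
  qed
  have sum2: "(\<Oplus>\<^bsub>skew S\<^esub>H \<in> (\<lambda>H. insert 0 (Suc ` H)) ` ?K k. ?f H) = monomial S [\<tau> p] \<otimes>\<^bsub>skew S\<^esub> dword (v @ z) k" for k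
  proof -
    have "(\<Oplus>\<^bsub>skew S\<^esub>H \<in> (\<lambda>H. insert 0 (Suc ` H)) ` ?K k. ?f H) = (\<Oplus>\<^bsub>skew S\<^esub>H \<in> ?K k. ?f (insert 0 (Suc ` H)))"
      using fc by (intro finsum_reindex inj0) auto
    also have "\<dots> = (\<Oplus>\<^bsub>skew S\<^esub>H \<in> ?K k. monomial S (\<tau> p # subst_at \<tau> v H @ z))"
      by (simp add: inj_image_mem_iff image_iff)
    finally show ?thesis using mult[OF p(3)] by simp
  qed
  show ?case
  proof (cases "h = 0")
    case True
    then have "(\<Oplus>\<^bsub>skew S\<^esub>H \<in> subsets_of_card (length (p # v)) h. ?f H) = monomial S [p] \<otimes>\<^bsub>skew S\<^esub> dword (v @ z) h"
      using sum1 by (simp add: subsets_of_card_Suc)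
    moreover have "monomial S [p] \<otimes>\<^bsub>skew S\<^esub> dword (v @ z) h \<in> carrier (skew S)"
      using p v z dword_closed[of "v @ z"] by simp
    ultimately show ?thesis using True by simp
  next
    case False
    have "(\<Oplus>\<^bsub>skew S\<^esub>H \<in> subsets_of_card (length (p # v)) h. ?f H) =
        (\<Oplus>\<^bsub>skew S\<^esub>H \<in> (`) Suc ` ?K h. ?f H) \<oplus>\<^bsub>skew S\<^esub> (\<Oplus>\<^bsub>skew S\<^esub>H \<in> (\<lambda>H. insert 0 (Suc ` H)) ` ?K (h - 1). ?f H)"
      using False fc
      by (simp only: list.size add_0_right add_Suc_right subsets_of_card_Suc if_False One_nat_def, intro finsum_Un_disjoint)
        (auto simp: finite_subsets_of_card)
    then show ?thesis unfolding sum1 sum2 using False p by simp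
  qed
qed

lemma dword_block:
  assumes u: "u \<in> lists S" "\<And>p. p \<in> set u \<Longrightarrow> \<not> A p"
    and v: "v \<in> lists S" "\<And>p. p \<in> set v \<Longrightarrow> A p" and z: "z \<in> lists S" "\<And>p. p \<in> set z \<Longrightarrow> \<not> A p"
  shows "dword (u @ v @ z) h = (\<Oplus>\<^bsub>skew S\<^esub>H \<in> subsets_of_card (length v) h. monomial S (u @ subst_at \<tau> v H @ z))"
proof -
  have l: "subst_at \<tau> v H @ z \<in> lists S" for H using subst_at_lists[OF v] z by simp
  have "dword (u @ v @ z) h = monomial S u \<otimes>\<^bsub>skew S\<^esub> (\<Oplus>\<^bsub>skew S\<^esub>H \<in> subsets_of_card (length v) h. monomial S (subst_at \<tau> v H @ z))"
    using dword_inactive_prefix[OF u(1) _ u(2)] dword_active_prefix[OF v z] v z by simp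
  also have "\<dots> = (\<Oplus>\<^bsub>skew S\<^esub>H \<in> subsets_of_card (length v) h. monomial S u \<otimes>\<^bsub>skew S\<^esub> monomial S (subst_at \<tau> v H @ z))"
    using u l by (intro finsum_rdistr finite_subsets_of_card) auto
  finally show ?thesis using monomial_append[OF u(1) l] by simp
qed

end

section \<open>The sign of a coproduct slice\<close>

text \<open>Both sides change sign when two adjacent entries are exchanged.\<close>

lemma sign_nth_inversions:
  assumes "mset xs = mset [0..<n]"
  shows "sign (\<lambda>k. if k < n then xs ! k else k) = (-1) ^ inversions (>) xs"
proof (rule adjacent_swap_induct[OF _ assms, where Q = "\<lambda>xs. sign (\<lambda>k. if k < n then xs ! k else k) = (-1) ^ inversions (>) xs"])
  show "distinct [0..<n]" by simp
  have "(\<lambda>k. if k < n then [0..<n] ! k else k) = id" by auto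
  then show "sign (\<lambda>k. if k < n then [0..<n] ! k else k) = (-1) ^ inversions (>) [0..<n]"
    by (simp add: inversions_sorted)
next
  fix v w :: "nat list" and x y :: nat
  let ?p = "\<lambda>xs k. if k < n then xs ! k else k"
  assume xy: "x \<noteq> y" and m: "mset (v @ [x, y] @ w) = mset [0..<n]"
    and IH: "sign (?p (v @ [x, y] @ w)) = (-1) ^ inversions (>) (v @ [x, y] @ w)"
  have len: "length (v @ [x, y] @ w) = n" using mset_eq_length[OF m] by simp
  have "bij_betw (?p (v @ [x, y] @ w)) {..<n} {..<n}"
  proof -
    have "bij_betw ((!) (v @ [x, y] @ w)) {..<n} {..<n}"
      using mset_eq_setD[OF m] mset_eq_imp_distinct_iff[OF m] len
      by (intro bij_betw_nth) (auto simp: lessThan_atLeast0)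
    then show ?thesis by (rule bij_betw_cong[THEN iffD1, rotated]) auto
  qed
  then have perm: "permutation (?p (v @ [x, y] @ w))"
    by (intro permutes_imp_permutation[of "{..<n}"] bij_imp_permutes) auto
  have "?p (v @ [y, x] @ w) = ?p (v @ [x, y] @ w) \<circ> transpose (length v) (Suc (length v))"
    using len by (auto simp: fun_eq_iff transpose_def nth_append nth_Cons')
  then have "sign (?p (v @ [y, x] @ w)) = - sign (?p (v @ [x, y] @ w))"
    by (simp add: sign_compose[OF perm permutation_swap_id] sign_swap_id del: append.simps)
  also have "\<dots> = (-1) ^ inversions (>) (v @ [y, x] @ w)"
    unfolding IH using xy by (subst inversion_sign_swap) auto
  finally show "sign (?p (v @ [y, x] @ w)) = (-1) ^ inversions (>) (v @ [y, x] @ w)" .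
qed

lemma sorted_list_of_set_insert_max:
  fixes n :: nat
  assumes "finite Z" "\<And>x. x \<in> Z \<Longrightarrow> x < n"
  shows "sorted_list_of_set (insert n Z) = sorted_list_of_set Z @ [n]"
proof (rule sorted_distinct_set_unique)
  show "sorted (sorted_list_of_set (insert n Z))" "distinct (sorted_list_of_set (insert n Z))"
    by (rule sorted_list_of_set.sorted_sorted_key_list_of_set sorted_list_of_set.distinct_sorted_key_list_of_set)+
  show "set (sorted_list_of_set (insert n Z)) = set (sorted_list_of_set Z @ [n])"
    using assms(1) by (subst sorted_list_of_set.set_sorted_key_list_of_set) auto
qed (use assms in \<open>auto simp: sorted_append less_imp_le\<close>)

text \<open>Mark the positions in \<open>I\<close> by the smaller number \<open>a\<close> and the others by \<open>b\<close>. An inversion is on both sides an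
  element of the complement that is smaller than an element of \<open>I\<close>.\<close>

lemma inversions_shuffle:
  fixes a b :: nat
  assumes ab: "a < b"
  shows "inversions (>) (sorted_list_of_set (I \<inter> {..<n}) @ sorted_list_of_set ({..<n} - I)) =
         inversions (>) (map (\<lambda>k. if k \<in> I then a else b) [0..<n])"
proof (induction n)
  case (Suc n)
  let ?X = "I \<inter> {..<n}" and ?Y = "{..<n} - I" and ?w = "map (\<lambda>k. if k \<in> I then a else b) [0..<n]"
  have len: "length (filter Q (sorted_list_of_set Z)) = card {k \<in> Z. Q k}" if "finite Z" for Q and Z :: "nat set"
    using that by (subst distinct_length_filter) (auto intro: arg_cong[where f = card])
  show ?case
  proof (cases "n \<in> I")
    case True
    have sets: "I \<inter> {..<Suc n} = insert n ?X" "{..<Suc n} - I = ?Y" using True by (auto simp: less_Suc_eq)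
    have "length (filter (\<lambda>y. a < y) ?w) = length (filter (\<lambda>k. k \<notin> I) [0..<n])"
      unfolding filter_map length_map comp_def by (rule arg_cong[where f = length], rule filter_cong) (use ab in auto)
    also have "\<dots> = card ?Y"
      by (subst distinct_length_filter) (auto intro: arg_cong[where f = card])
    finally have word: "length (filter (\<lambda>y. a < y) ?w) = card ?Y" .
    have ext: "sorted_list_of_set (insert n ?X) = sorted_list_of_set ?X @ [n]"
      by (rule sorted_list_of_set_insert_max) auto
    have none: "length (filter (\<lambda>x. n < x) (sorted_list_of_set ?X)) = 0"
      and all: "length (filter (\<lambda>x. x < n) (sorted_list_of_set ?Y)) = card ?Y"
      by (subst len; auto intro: arg_cong[where f = card])+
    show ?thesis
      unfolding sets ext using Suc.IH True word none all
      by (simp add: inversions_append crossings_append crossings_Cons crossings_single del: length_0_conv filter_map)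
  next
    case False
    have sets: "I \<inter> {..<Suc n} = ?X" "{..<Suc n} - I = insert n ?Y" using False by (auto simp: less_Suc_eq)
    have word: "filter (\<lambda>y. b < y) ?w = []"
      using ab by (auto simp: filter_empty_conv)
    have ext: "sorted_list_of_set (insert n ?Y) = sorted_list_of_set ?Y @ [n]"
      by (rule sorted_list_of_set_insert_max) auto
    have none: "length (filter (\<lambda>x. n < x) (sorted_list_of_set ?X)) = 0"
        "length (filter (\<lambda>x. n < x) (sorted_list_of_set ?Y)) = 0"
      by (subst len; auto)+
    show ?thesis
      unfolding sets ext using Suc.IH False word none
      by (simp add: inversions_append crossings_append crossings_Cons crossings_single del: length_0_conv filter_map)
  qed
qed simp

lemma slice_sign_inversions:
  assumes "I \<subseteq> {..<length w}" and ab: "a < b"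
  shows "slice_sign w I = (-1) ^ inversions (>) (map (\<lambda>k. if k \<in> I then a else b :: nat) [0..<length w])"
proof -
  let ?n = "length w" and ?J = "{..<length w} - I"
  have fin: "finite I" using assms(1) finite_subset by blast
  have "mset (sorted_list_of_set I @ sorted_list_of_set ?J) = mset [0..<?n]"
    using assms(1) fin by (intro set_eq_iff_mset_eq_distinct[THEN iffD1]) auto
  from sign_nth_inversions[OF this] have "slice_sign w I = (-1) ^ inversions (>) (sorted_list_of_set I @ sorted_list_of_set ?J)"
    by (simp add: slice_sign_def)
  also have "I = I \<inter> {..<?n}" using assms(1) by auto
  then have "inversions (>) (sorted_list_of_set I @ sorted_list_of_set ?J) =
     inversions (>) (map (\<lambda>k. if k \<in> I then a else b) [0..<?n])"
    using inversions_shuffle[OF ab, of I ?n] by simp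
  finally show ?thesis .
qed

section \<open>Moving letters between two places\<close>

abbreviation relabel :: "nat \<Rightarrow> 'a \<times> nat \<Rightarrow> 'a \<times> nat" where
  "relabel t p \<equiv> (fst p, t)"

lemma places_subst_at:
  "map snd (subst_at (relabel t) (labelled s w) H) = map (\<lambda>k. if k \<in> H then t else s) [0..<length w]"
proof (induction w arbitrary: H)
  case (Cons x w)
  have "[0..<Suc (length w)] = 0 # map Suc [0..<length w]" by (simp add: upt_conv_Cons map_Suc_upt del: upt_Suc)
  then show ?case using Cons by (simp del: upt_Suc)
qed simp

lemma inversions_subst_at:
  "inversions place_descent (subst_at (relabel t) (labelled s w) H) =
   inversions (>) (map (\<lambda>k. if k \<in> H then t else s) [0..<length w])"
  unfolding places_subst_at[symmetric] inversions_map ..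

lemma place_part_subst_at:
  assumes "s \<noteq> t"
  shows "place_part k (subst_at (relabel t) (labelled s w) H) =
    (if k = t then nths w H else if k = s then nths w ({..<length w} - H) else [])"
proof (induction w arbitrary: H)
  case (Cons x w)
  have "{j. Suc j \<in> {..<length (x # w)} - H} = {..<length w} - {j. Suc j \<in> H}" by auto
  moreover have "place_part k (p # v) = (if snd p = k then [fst p] else []) @ place_part k v"
    for p and v :: "('a \<times> nat) list" by (simp add: place_part_def)
  ultimately show ?case
    unfolding nths_Cons using assms by (simp add: Cons)
qed (simp add: place_part_def)

lemma set_subst_at: "p \<in> set (subst_at (relabel t) (labelled s w) H) \<Longrightarrow> snd p = s \<or> snd p = t"
  by (induction w arbitrary: H) (auto split: if_splits)

lemma sum_list_two_places:
  assumes "\<And>p. p \<in> set w \<Longrightarrow> snd p = s \<or> snd p = t" "s \<noteq> t" "g s = (0 :: nat)"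
  shows "(\<Sum>p\<leftarrow>w. g (snd p)) = length (place_part t w) * g t"
  using assms(1)
proof (induction w)
  case (Cons p w)
  have "snd p = s \<or> snd p = t" and IH: "(\<Sum>p\<leftarrow>w. g (snd p)) = length (place_part t w) * g t"
    using Cons by simp_all
  then show ?case using assms(2,3) by (elim disjE) (simp_all add: place_part_def)
qed (simp add: place_part_def)

lemma length_nths_subset: "H \<subseteq> {..<length w} \<Longrightarrow> length (nths w H) = card H"
  unfolding length_nths by (rule arg_cong[where f = card]) auto

lemma place_word_split:
  assumes "s \<in> {1..m}"
  shows "place_word m W = block_word W [1..<s] @ labelled s (W s) @ block_word W [Suc s..<Suc m]"
proof -
  have "[1..<Suc m] = [1..<s] @ s # [Suc s..<Suc m]"
    using assms upt_add_eq_append[of 1 s "Suc m - s"] upt_conv_Cons[of s "Suc m"] by (simp del: upt_Suc)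
  then show ?thesis by (simp add: place_word_def block_word_def del: upt_Suc)
qed

text \<open>The blocks are sorted, so the only descents besides those inside the block of \<open>s\<close> involve a moved letter
  and a letter at a place strictly between \<open>s\<close> and \<open>t\<close>: the latter stands to the right of the block if
  \<open>s < t\<close> and to its left if \<open>t < s\<close>.\<close>

lemma inversions_moved:
  fixes W :: "nat \<Rightarrow> 'a list"
  assumes s: "s \<in> {1..m}" and t: "t \<in> {1..m}" and st: "s \<noteq> t" and H: "H \<subseteq> {..<length (W s)}"
  shows "inversions place_descent
      (block_word W [1..<s] @ subst_at (relabel t) (labelled s (W s)) H @ block_word W [Suc s..<Suc m]) =
    card H * (\<Sum>k \<in> {min s t<..<max s t}. length (W k)) +
    inversions (>) (map (\<lambda>k. if k \<in> H then t else s) [0..<length (W s)])"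
proof -
  let ?u = "block_word W [1..<s]" and ?z = "block_word W [Suc s..<Suc m]"
  let ?v = "subst_at (relabel t) (labelled s (W s)) H"
  let ?low = "\<lambda>p. length (filter (\<lambda>q. snd q < p) ?z)"
  have ht: "length (place_part t ?v) = card H"
    using st length_nths_subset[OF H] by (simp add: place_part_subst_at)
  have uz: "crossings place_descent ?u ?z = 0"
  proof -
    have "filter (place_descent p) ?z = []" if "p \<in> set ?u" for p
      using set_block_word[OF that] by (auto simp: filter_empty_conv dest!: set_block_word)
    then show ?thesis by (auto simp: crossings_def)
  qed
  have vz: "crossings place_descent ?v ?z = card H * (\<Sum>k \<in> {s<..<t}. length (W k))"
  proof -
    have "?low s = 0" by (auto simp: filter_empty_conv dest!: set_block_word)
    then have "crossings place_descent ?v ?z = length (place_part t ?v) * ?low t"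
      unfolding crossings_def using st set_subst_at by (intro sum_list_two_places[where s = s]) blast+
    also have "?low t = (\<Sum>k \<in> {k \<in> set [Suc s..<Suc m]. k < t}. length (W k))"
      by (rule length_filter_block_word) simp
    also have "{k \<in> set [Suc s..<Suc m]. k < t} = {s<..<t}" using t by auto
    finally show ?thesis by (simp add: ht)
  qed
  have uv: "crossings place_descent ?u ?v = card H * (\<Sum>k \<in> {t<..<s}. length (W k))"
  proof -
    have *: "length (filter (\<lambda>q. snd q < snd p) ?v) = (if t < snd p then card H else 0)" if "p \<in> set ?u" for p
    proof -
      have p: "snd p < s" using set_block_word[OF that] by simp
      have "filter (\<lambda>q. snd q < snd p) ?v = (if t < snd p then filter (\<lambda>q. snd q = t) ?v else [])"
        using p st by (auto simp: filter_empty_conv intro!: filter_cong dest!: set_subst_at)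
      then show ?thesis using ht by (simp add: place_part_def)
    qed
    have "crossings place_descent ?u ?v = (\<Sum>p\<leftarrow>?u. if t < snd p then card H else 0)"
      unfolding crossings_def using * by (intro arg_cong[where f = sum_list] map_cong) auto
    also have "\<dots> = card H * length (filter (\<lambda>p. t < snd p) ?u)"
    proof -
      have "(\<Sum>p\<leftarrow>xs. if t < snd p then c else 0) = c * length (filter (\<lambda>p. t < snd p) xs)"
        for c :: nat and xs :: "('a \<times> nat) list" by (induction xs) auto
      then show ?thesis .
    qed
    also have "length (filter (\<lambda>p. t < snd p) ?u) = (\<Sum>k \<in> {k \<in> set [1..<s]. t < k}. length (W k))"
      by (rule length_filter_block_word) simp
    also have "{k \<in> set [1..<s]. t < k} = {t<..<s}" using t by auto
    finally show ?thesis .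
  qed
  have between: "(\<Sum>k \<in> {s<..<t}. length (W k)) + (\<Sum>k \<in> {t<..<s}. length (W k)) =
      (\<Sum>k \<in> {min s t<..<max s t}. length (W k))"
    using st by (cases "s < t") (simp_all add: min_def max_def)
  show ?thesis
    by (simp add: inversions_append crossings_append inversions_block_word inversions_subst_at uz vz uv
        between[symmetric] algebra_simps del: upt_Suc)
qed

section \<open>Geometric products\<close>

lemma hom_finprod:
  assumes "comm_group G" "comm_group H" "h \<in> hom G H" "finite A" "f \<in> A \<rightarrow> carrier G"
  shows "h (finprod G f A) = finprod H (\<lambda>x. h (f x)) A"
proof -
  interpret G: comm_group G by fact
  interpret H: comm_group H by fact
  interpret h: group_hom G H h by (rule group_homI[OF G.is_group H.is_group assms(3)])
  show ?thesis
    using assms(4,5)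
  proof (induction A rule: finite_induct)
    case (insert a A)
    have "f a \<in> carrier G" "f \<in> A \<rightarrow> carrier G" "(\<lambda>x. h (f x)) \<in> A \<rightarrow> carrier H" "h (f a) \<in> carrier H"
      using insert.prems h.hom_closed by (auto simp: Pi_iff)
    then show ?case using insert by simp
  qed simp
qed

lemma slice_subsets: "slice w (int h) (int (length w) - int h) = subsets_of_card (length w) h"
  unfolding slice_def subsets_of_card_def
proof (intro Collect_cong iffI conjI; elim conjE)
  fix I assume I: "I \<subseteq> {..<length w}" "card I = h"
  then show "int (card ({..<length w} - I)) = int (length w) - int h"
    using card_mono[OF _ I(1)] by (simp add: card_Diff_subset finite_subset of_nat_diff)
qed simp_all

lemma slice_complements:
  "slice w (int (length w) - int h) (int h) = (\<lambda>H. {..<length w} - H) ` subsets_of_card (length w) h"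
proof (intro equalityI subsetI)
  fix I assume "I \<in> slice w (int (length w) - int h) (int h)"
  then have "I = {..<length w} - ({..<length w} - I)" "{..<length w} - I \<in> subsets_of_card (length w) h"
    by (auto simp: slice_def subsets_of_card_def)
  then show "I \<in> (\<lambda>H. {..<length w} - H) ` subsets_of_card (length w) h" by blast
next
  fix I assume "I \<in> (\<lambda>H. {..<length w} - H) ` subsets_of_card (length w) h"
  then obtain H where H: "H \<subseteq> {..<length w}" "card H = h" and I: "I = {..<length w} - H"
    by (auto simp: subsets_of_card_def)
  have "{..<length w} - I = H" using H I by auto
  moreover have "int (card I) = int (length w) - int h"
    using card_mono[OF _ H(1)] H by (simp add: I card_Diff_subset finite_subset of_nat_diff)
  ultimately show "I \<in> slice w (int (length w) - int h) (int h)"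
    using H I by (auto simp: slice_def)
qed

text \<open>If \<open>t < s\<close>, the set \<open>H\<close> of moved positions is the index set \<open>I\<close> of the slice. If \<open>s < t\<close>, the moved
  letters form the second part of the slice, and \<open>I\<close> is the complement of \<open>H\<close>. In both cases the
  positions in \<open>I\<close> receive the smaller of the two places, as in the description of the sign of a slice.\<close>

lemma geometric_value_subsets:
  fixes W :: "nat \<Rightarrow> 'a list"
  assumes W: "W \<in> words_on L m" and s: "s \<in> {1..m}" and t: "t \<in> {1..m}" and st: "s \<noteq> t"
  shows "geometric_value L m h t s W =
    finprod (tensor_group (skew L) m)
      (\<lambda>H. word_tensor L m
         (block_word W [1..<s] @ subst_at (relabel t) (labelled s (W s)) H @ block_word W [Suc s..<Suc m]))
      (subsets_of_card (length (W s)) h)"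
proof -
  let ?T = "tensor_group (skew L) m" and ?n = "length (W s)"
  let ?w = "\<lambda>H. block_word W [1..<s] @ subst_at (relabel t) (labelled s (W s)) H @ block_word W [Suc s..<Suc m]"
  let ?V = "\<lambda>H. W(s := nths (W s) ({..<?n} - H), t := if s < t then nths (W s) H @ W t else W t @ nths (W s) H)"
  let ?sg = "\<lambda>H. (-1 :: int) ^ inversions (>) (map (\<lambda>k. if k \<in> H then t else s) [0..<?n])"
  let ?c = "(-1 :: int) ^ (h * (\<Sum>k \<in> {min s t<..<max s t}. length (W k)))"
  interpret T: comm_group ?T by (rule skew_tensor_comm_group)
  have Ws: "W s \<in> lists L" "W t \<in> lists L" using W s t by (auto simp: words_on_def)
  have nths_lists: "nths (W s) H \<in> lists L" for H
    using Ws set_nths_subset[of "W s" H] by (auto simp: in_lists_conv_set)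
  have V: "?V H \<in> words_on L m" for H
    using W Ws nths_lists unfolding words_on_def by auto
  have mt: "monomial_tensor L m (?V H) \<in> carrier ?T" for H by (rule monomial_tensor_closed[OF V])
  have word: "word_tensor L m (?w H) = (monomial_tensor L m (?V H) [^]\<^bsub>?T\<^esub> ?sg H) [^]\<^bsub>?T\<^esub> ?c"
    if H: "H \<in> subsets_of_card ?n h" for H
  proof -
    have sub: "H \<subseteq> {..<?n}" and card: "card H = h" using H by (auto simp: subsets_of_card_def)
    have "monomial_tensor L m (\<lambda>k. place_part k (?w H)) = monomial_tensor L m (?V H)"
    proof (rule monomial_tensor_cong)
      fix k assume k: "k \<in> {1..m}"
      show "place_part k (?w H) = ?V H k"
        unfolding place_part_append place_part_subst_at[OF st] place_part_block_word[OF distinct_upt]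
        using k st by auto
    qed
    then have "word_tensor L m (?w H) = monomial_tensor L m (?V H) [^]\<^bsub>?T\<^esub> (?sg H * ?c)"
      unfolding word_tensor_def inversions_moved[where W = W, OF s t st sub] card power_add by (simp add: mult.commute)
    then show ?thesis using T.int_pow_pow[OF mt] by simp
  qed
  have closed: "(\<lambda>H. monomial_tensor L m (?V H) [^]\<^bsub>?T\<^esub> ?sg H) \<in> A \<rightarrow> carrier ?T" for A
    using mt by blast
  have "finprod ?T (\<lambda>H. word_tensor L m (?w H)) (subsets_of_card ?n h) =
      finprod ?T (\<lambda>H. (monomial_tensor L m (?V H) [^]\<^bsub>?T\<^esub> ?sg H) [^]\<^bsub>?T\<^esub> ?c) (subsets_of_card ?n h)"
    by (rule T.finprod_cong') (use mt word in auto)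
  also have "\<dots> = finprod ?T (\<lambda>H. monomial_tensor L m (?V H) [^]\<^bsub>?T\<^esub> ?sg H) (subsets_of_card ?n h) [^]\<^bsub>?T\<^esub> ?c"
    by (rule hom_finprod[OF T.comm_group_axioms T.comm_group_axioms T.int_pow_hom finite_subsets_of_card closed, symmetric])
  also have "\<dots> = geometric_value L m h t s W"
  proof (cases "s < t")
    case True
    let ?g = "\<lambda>I. monomial_tensor L m (W(s := fst_part (W s) I, t := snd_part (W s) I @ W t)) [^]\<^bsub>?T\<^esub> slice_sign (W s) I"
    have "finprod ?T (\<lambda>H. monomial_tensor L m (?V H) [^]\<^bsub>?T\<^esub> ?sg H) (subsets_of_card ?n h) =
        finprod ?T (\<lambda>H. ?g ({..<?n} - H)) (subsets_of_card ?n h)"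
    proof (rule T.finprod_cong')
      show "(\<lambda>H. ?g ({..<?n} - H)) \<in> subsets_of_card ?n h \<rightarrow> carrier ?T"
      proof -
        have "W(s := fst_part (W s) I, t := snd_part (W s) I @ W t) \<in> words_on L m" for I
          using W Ws nths_lists unfolding words_on_def fst_part_def snd_part_def by auto
        then show ?thesis using monomial_tensor_closed by blast
      qed
      fix H assume "H \<in> subsets_of_card ?n h"
      then have H: "H \<subseteq> {..<?n}" by (simp add: subsets_of_card_def)
      have "map (\<lambda>k. if k \<in> {..<?n} - H then s else t) [0..<?n] = map (\<lambda>k. if k \<in> H then t else s) [0..<?n]"
        by (rule map_cong) auto
      then have "slice_sign (W s) ({..<?n} - H) = ?sg H"
        using slice_sign_inversions[OF Diff_subset True, of "W s" H] by (simp only:)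
      moreover have "{..<?n} - ({..<?n} - H) = H" using H by auto
      ultimately show "monomial_tensor L m (?V H) [^]\<^bsub>?T\<^esub> ?sg H = ?g ({..<?n} - H)"
        using True by (simp add: fst_part_def snd_part_def)
    qed simp
    also have "\<dots> = finprod ?T ?g ((\<lambda>H. {..<?n} - H) ` subsets_of_card ?n h)"
    proof (rule T.finprod_reindex[symmetric])
      show "?g \<in> (\<lambda>H. {..<?n} - H) ` subsets_of_card ?n h \<rightarrow> carrier ?T"
      proof -
        have "W(s := fst_part (W s) I, t := snd_part (W s) I @ W t) \<in> words_on L m" for I
          using W Ws nths_lists unfolding words_on_def fst_part_def snd_part_def by auto
        then show ?thesis using monomial_tensor_closed by blast
      qed
      show "inj_on (\<lambda>H. {..<?n} - H) (subsets_of_card ?n h)"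
      proof (rule inj_onI)
        fix H K assume "H \<in> subsets_of_card ?n h" "K \<in> subsets_of_card ?n h" "{..<?n} - H = {..<?n} - K"
        then show "H = K" by (metis (no_types, lifting) double_diff mem_Collect_eq subset_refl subsets_of_card_def)
      qed
    qed
    finally show ?thesis
      unfolding geometric_value_def Let_def finsum_def add_pow_def add_monoid_skew_tensor slice_complements
      using True by simp
  next
    case False
    then have ts: "t < s" using st by simp
    let ?g = "\<lambda>I. monomial_tensor L m (W(t := W t @ fst_part (W s) I, s := snd_part (W s) I)) [^]\<^bsub>?T\<^esub> slice_sign (W s) I"
    have "finprod ?T (\<lambda>H. monomial_tensor L m (?V H) [^]\<^bsub>?T\<^esub> ?sg H) (subsets_of_card ?n h) =
        finprod ?T ?g (subsets_of_card ?n h)"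
    proof (rule T.finprod_cong')
      show "?g \<in> subsets_of_card ?n h \<rightarrow> carrier ?T"
      proof -
        have "W(t := W t @ fst_part (W s) I, s := snd_part (W s) I) \<in> words_on L m" for I
          using W Ws nths_lists unfolding words_on_def fst_part_def snd_part_def by auto
        then show ?thesis using monomial_tensor_closed by blast
      qed
      fix H assume "H \<in> subsets_of_card ?n h"
      then have "H \<subseteq> {..<?n}" by (simp add: subsets_of_card_def)
      then have "slice_sign (W s) H = ?sg H" by (rule slice_sign_inversions[OF _ ts])
      then show "monomial_tensor L m (?V H) [^]\<^bsub>?T\<^esub> ?sg H = ?g H"
        using False st by (simp add: fst_part_def snd_part_def fun_upd_twist)
    qed simp
    then show ?thesis
      unfolding geometric_value_def Let_def finsum_def add_pow_def add_monoid_skew_tensor slice_subsets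
      using False by simp
  qed
  finally show ?thesis ..
qed

theorem proposition4:
  fixes L :: "'a set" and m :: nat
    and \<Phi> :: "(('a \<times> nat) list \<Rightarrow>\<^sub>0 int) set
                \<Rightarrow> ((nat \<Rightarrow> ('a list \<Rightarrow>\<^sub>0 int) set) \<Rightarrow>\<^sub>0 int) set"
  assumes "m \<ge> 1"
    and "\<Phi> \<in> ring_iso (letterplace L m) (skew_tensor L m)"
    and "\<And>x i. x \<in> L \<Longrightarrow> i \<in> {1..m} \<Longrightarrow>
           \<Phi> (letter L m x i) = tensor (skew L) m
             (\<lambda>k \<in> {1..m}. if k = i then monomial L [x] else \<one>\<^bsub>skew L\<^esub>)"
  shows "\<forall>i \<in> {1..m}. \<forall>j \<in> {1..m}. \<forall>h \<ge> 1. i \<noteq> j \<longrightarrow>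
           (\<forall>u \<in> carrier (skew_tensor L m).
              geometric_product L m h j i u =
              \<Phi> (divided_power (letterplace L m) (place_polarization L m j i) h
                   (inv_into (carrier (letterplace L m)) \<Phi> u)))"
proof (intro ballI allI impI)
  fix i j h u
  assume i: "i \<in> {1..m}" and j: "j \<in> {1..m}" and ij: "i \<noteq> j" and u: "u \<in> carrier (skew_tensor L m)"
  let ?S = "L \<times> {1..m}" and ?P = "letterplace L m" and ?T = "tensor_group (skew L) m"
  interpret P: ring ?P unfolding letterplace_def by (rule ring_skew)
  interpret T: comm_group ?T by (rule skew_tensor_comm_group)
  interpret sd: substitution_derivation ?S "\<lambda>p. snd p = i" "relabel j"
    by (rule place_substitution[OF j ij])
  obtain E where E: "E \<in> hom (add_monoid ?P) (add_monoid ?P)"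
    and Ew: "\<And>w. w \<in> lists ?S \<Longrightarrow> E (monomial ?S w) = sd.dword w h"
    and ED: "\<And>u. u \<in> carrier ?P \<Longrightarrow> divided_power ?P (place_polarization L m j i) h u = E u"
    using divided_place_polarization[OF j i ij, of L h] by blast
  have bij: "bij_betw \<Phi> (carrier ?P) (carrier ?T)"
    using assms(2) by (simp add: ring_iso_def skew_tensor_simps)
  have \<Phi>: "\<Phi> \<in> hom (add_monoid ?P) ?T"
    using assms(2) unfolding ring_iso_def ring_hom_def
    by (auto simp: hom_def skew_tensor_simps)
  have \<Phi>w: "\<Phi> (monomial ?S w) = word_tensor L m w" if "w \<in> lists ?S" for w
    by (rule iso_on_words[OF assms(2) _ that]) (rule assms(3))
  let ?inv = "inv_into (carrier ?P) \<Phi>"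
  have inv: "?inv v \<in> carrier ?P" "\<Phi> (?inv v) = v" if "v \<in> carrier ?T" for v
    using bij that by (auto simp: bij_betw_def inv_into_into f_inv_into_f)
  have inv_\<Phi>: "?inv (\<Phi> x) = x" if "x \<in> carrier ?P" for x
    using bij that by (simp add: bij_betw_def inv_into_f_f)
  have inv_hom: "?inv \<in> hom ?T (add_monoid ?P)"
  proof (rule homI)
    fix v w assume vw: "v \<in> carrier ?T" "w \<in> carrier ?T"
    have "\<Phi> (?inv v \<oplus>\<^bsub>?P\<^esub> ?inv w) = v \<otimes>\<^bsub>?T\<^esub> w"
      using hom_mult[OF \<Phi>, of "?inv v" "?inv w"] inv vw by simp
    then show "?inv (v \<otimes>\<^bsub>?T\<^esub> w) = ?inv v \<otimes>\<^bsub>add_monoid ?P\<^esub> ?inv w"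
      using inv_\<Phi>[of "?inv v \<oplus>\<^bsub>?P\<^esub> ?inv w"] inv vw by simp
  qed (simp add: inv)
  \<comment> \<open>The conjugate of the divided power, as a candidate for the geometric product.\<close>
  define G where "G = restrict (\<lambda>v. \<Phi> (E (?inv v))) (carrier ?T)"
  have hom: "(\<lambda>v. \<Phi> (E (?inv v))) \<in> hom ?T ?T"
    using hom_compose[OF hom_compose[OF inv_hom E] \<Phi>] by (simp add: comp_def)
  have on_words: "G (monomial_tensor L m W) = geometric_value L m h j i W" if W: "W \<in> words_on L m" for W
  proof -
    have pw: "place_word m W \<in> lists ?S" by (rule place_word_lists[OF W])
    have "\<Phi> (monomial ?S (place_word m W)) = monomial_tensor L m W"
    proof -
      have "monomial_tensor L m (\<lambda>k. place_part k (place_word m W)) = monomial_tensor L m W"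
        by (rule monomial_tensor_cong) (rule place_part_word)
      then show ?thesis
        using monomial_tensor_closed[OF W] by (simp add: \<Phi>w[OF pw] word_tensor_def inversions_place_word)
    qed
    then have inv_mt: "?inv (monomial_tensor L m W) = monomial ?S (place_word m W)"
      using inv_\<Phi>[of "monomial ?S (place_word m W)"] pw by (simp add: letterplace_def)
    let ?u = "block_word W [1..<i]" and ?v = "labelled i (W i)" and ?z = "block_word W [Suc i..<Suc m]"
    let ?wd = "\<lambda>H. ?u @ subst_at (relabel j) ?v H @ ?z"
    have split: "place_word m W = ?u @ ?v @ ?z" by (rule place_word_split[OF i])
    have lists: "?u \<in> lists ?S" "?v \<in> lists ?S" "?z \<in> lists ?S" using pw unfolding split by auto
    have lw: "?wd H \<in> lists ?S" for H
    proof -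
      have "subst_at (relabel j) ?v H \<in> lists ?S" by (rule sd.subst_at_lists[OF lists(2)]) auto
      then show ?thesis using lists by (simp del: upt_Suc)
    qed
    have "G (monomial_tensor L m W) = \<Phi> (sd.dword (?u @ ?v @ ?z) h)"
      using monomial_tensor_closed[OF W] Ew[OF pw] by (simp add: G_def inv_mt split)
    also have "sd.dword (?u @ ?v @ ?z) h = (\<Oplus>\<^bsub>skew ?S\<^esub>H \<in> subsets_of_card (length ?v) h. monomial ?S (?wd H))"
      by (rule sd.dword_block[OF lists(1) _ lists(2) _ lists(3)]) (auto dest!: set_block_word)
    also have "\<Phi> \<dots> = finprod ?T (\<lambda>H. \<Phi> (monomial ?S (?wd H))) (subsets_of_card (length ?v) h)"
      unfolding finsum_def letterplace_def[symmetric]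
      by (rule hom_finprod[OF P.a_comm_group T.comm_group_axioms \<Phi> finite_subsets_of_card])
         (use lw in \<open>simp add: Pi_iff letterplace_def\<close>)
    also have "\<dots> = finprod ?T (\<lambda>H. word_tensor L m (?wd H)) (subsets_of_card (length (W i)) h)"
      unfolding \<Phi>w[OF lw] by simp
    also have "\<dots> = geometric_value L m h j i W"
      by (rule geometric_value_subsets[OF W i j ij, symmetric])
    finally show ?thesis .
  qed
  have "geometric_product L m h j i = G"
    unfolding geometric_product_def Let_def skew_tensor_simps
  proof (rule the_equality)
    show "G \<in> (carrier ?T \<rightarrow>\<^sub>E carrier ?T) \<and>
        (\<forall>u \<in> carrier ?T. \<forall>v \<in> carrier ?T. G (u \<otimes>\<^bsub>?T\<^esub> v) = G u \<otimes>\<^bsub>?T\<^esub> G v) \<and>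
        (\<forall>W. (\<forall>k \<in> {1..m}. W k \<in> lists L) \<longrightarrow> G (monomial_tensor L m W) = geometric_value L m h j i W)"
      using hom on_words by (auto simp: G_def hom_def words_on_def)
    fix K
    assume K: "K \<in> (carrier ?T \<rightarrow>\<^sub>E carrier ?T) \<and>
        (\<forall>u \<in> carrier ?T. \<forall>v \<in> carrier ?T. K (u \<otimes>\<^bsub>?T\<^esub> v) = K u \<otimes>\<^bsub>?T\<^esub> K v) \<and>
        (\<forall>W. (\<forall>k \<in> {1..m}. W k \<in> lists L) \<longrightarrow> K (monomial_tensor L m W) = geometric_value L m h j i W)"
    have "K \<in> hom ?T ?T" using K by (auto simp: hom_def)
    moreover have "K (monomial_tensor L m W) = \<Phi> (E (?inv (monomial_tensor L m W)))" if "W \<in> words_on L m" for W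
      using K on_words[OF that] that monomial_tensor_closed[OF that] by (simp add: G_def words_on_def)
    ultimately have "K v = \<Phi> (E (?inv v))" if "v \<in> carrier ?T" for v
      using hom_eq_on_monomial_tensors[OF T.is_group _ hom _ that] by blast
    then show "K = G"
      using K by (intro PiE_ext[of K "carrier ?T" "\<lambda>_. carrier ?T" G]) (auto simp: G_def hom_in_carrier[OF hom])
  qed
  then show "geometric_product L m h j i u =
      \<Phi> (divided_power ?P (place_polarization L m j i) h (?inv u))"
    using u inv ED by (simp add: G_def skew_tensor_simps)
qed

end
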